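(* For each $c>\frac32$ the action spectrum of the energy hypersurface of the regularized rotating Kepler problem at energy $-c$ is $$Spec(\Sigma_R^c,\lambda_{can})=2\pi L_R(c)\,\mathbb{N}\ \cup\ (-2\pi L_D(c))\,\mathbb{N}\ \cup\ \Big\{2\pi\big(-lc+\tfrac32k^{2/3}l^{1/3}\big)\ \Big|\ \tfrac lk\in\big(L_R(c)^3,-L_D(c)^3\big),\ k>l,\ k,l\in\mathbb{N}\Big\},$$ where $L_R(c)>0$ and $-1<L_D(c)<0$ are the zeros of $c=\frac{1}{2x^2}-x$. The values $2\pi L_R(c)$ and $-2\pi L_D(c)$ are the actions of the retrograde and direct orbit, respectively.
   Context: $\mathbb{N}=\{1,2,\dots\}$. Rotating Kepler problem: $H_R(q,p)=\frac12|p|^2-\frac1{|q|}+p_1q_2-p_2q_1$ on $T^*(\mathbb{R}^2\setminus\{0\})$ with symplectic form $dp\wedge dq$ (equivalently, after a reflection, with the opposite sign of the angular momentum term); its unique critical value is $-\frac32$. Let $\Psi(q,p)=(p,-q)$ and let $\Phi:T^*\mathbb{R}^2\to T^*(S^2\setminus\{\text{north pole}\})$ be the cotangent lift of inverse stereographic projection $\phi(x)=\frac{1}{|x|^2+1}(2x_1,2x_2,|x|^2-1)$. For $c>\frac32$, $\Sigma_R^c$ is the bounded component of the closure in $T^*S^2$ of $\Phi\circ\Psi(H_R^{-1}(-c))$; it is known to be a fiberwise convex hypersurface, so $\lambda_{can}$ ($=p\,dq$ in canonical coordinates of $T^*S^2$) restricts to a contact form on it. The Reeb vector field $R$ is given by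 $\lambda_{can}(R)=1$, $\iota_Rd\lambda_{can}=0$ on $\Sigma_R^c$. $Spec(\Sigma_R^c,\lambda_{can})$ is the set of all positive periods (= actions $\int_\gamma\lambda_{can}$) of closed Reeb orbits $\gamma$, multiple covers included. The retrograde (direct) orbit is the simple periodic orbit on the bounded component of $H_R^{-1}(-c)$ with $|q|$ constant whose underlying circular Kepler motion is opposite to (in the same direction as) the rotation of the coordinate frame. *)

theory Defs
  imports "HOL-Analysis.Analysis"
begin

section \<open>The rotating Kepler problem\<close>

text \<open>A point of \<open>T\<^sup>*\<real>\<^sup>2\<close> is a pair (base point, covector), covectors being identified with vectors
  through the Euclidean inner product.\<close>

definition H_R :: "(real^2) \<times> (real^2) \<Rightarrow> real" where
  "H_R = (\<lambda>(q, p). (norm p)\<^sup>2 / 2 - 1 / norm q + p$1 * q$2 - p$2 * q$1)"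

definition energy_level :: "real \<Rightarrow> ((real^2) \<times> (real^2)) set" where
  "energy_level c = {(q, p). q \<noteq> 0 \<and> H_R (q, p) = - c}"

text \<open>``Bounded'' refers to the position \<open>q\<close>: the momentum is unbounded near collisions.\<close>

definition bounded_level :: "real \<Rightarrow> ((real^2) \<times> (real^2)) set" where
  "bounded_level c = (THE C. C \<in> components (energy_level c) \<and> bounded (fst ` C))"

definition dp_dq :: "'a::euclidean_space \<times> 'a \<Rightarrow> 'a \<times> 'a \<Rightarrow> real" where
  "dp_dq = (\<lambda>(a, b) (a', b'). b \<bullet> a' - b' \<bullet> a)"

text \<open>The sign makes \<open>X\<^sub>H\<close> the field of Hamilton's equations
  \<open>q' = \<partial>H/\<partial>p\<close>, \<open>p' = - \<partial>H/\<partial>q\<close>.\<close>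

definition ham_field :: "('a::euclidean_space \<times> 'a \<Rightarrow> real) \<Rightarrow> 'a \<times> 'a \<Rightarrow> 'a \<times> 'a" where
  "ham_field H z = (THE X. \<forall>W. dp_dq X W = - frechet_derivative H (at z) W)"

section \<open>Regularization in the cotangent bundle of the sphere\<close>

text \<open>The round metric identifies \<open>T\<^sup>*S\<^sup>2\<close> with
  \<open>{(\<xi>, \<eta>). norm \<xi> = 1 \<and> \<xi> \<bullet> \<eta> = 0}\<close>, a closed subset of \<open>\<real>\<^sup>3 \<times> \<real>\<^sup>3\<close>; closures
  in \<open>T\<^sup>*S\<^sup>2\<close> are therefore closures in \<open>\<real>\<^sup>3 \<times> \<real>\<^sup>3\<close>, and the canonical one-form is the
  restriction of \<open>\<eta> d\<xi>\<close>.\<close>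

definition cotangent_sphere :: "((real^3) \<times> (real^3)) set" where
  "cotangent_sphere = {(\<xi>, \<eta>). norm \<xi> = 1 \<and> \<xi> \<bullet> \<eta> = 0}"

definition lambda_can :: "'a::euclidean_space \<times> 'a \<Rightarrow> 'a \<times> 'a \<Rightarrow> real" where
  "lambda_can = (\<lambda>(x, y) (a, b). y \<bullet> a)"

definition Psi :: "(real^2) \<times> (real^2) \<Rightarrow> (real^2) \<times> (real^2)" where
  "Psi = (\<lambda>(q, p). (p, - q))"

definition inv_stereo :: "real^2 \<Rightarrow> real^3" where
  "inv_stereo x = (1 / ((norm x)\<^sup>2 + 1)) *\<^sub>R vector [2 * x$1, 2 * x$2, (norm x)\<^sup>2 - 1]"

text \<open>Cotangent lift: the covector \<open>y\<close> at \<open>x\<close> goes to the covector \<open>\<eta>\<close> at \<open>\<phi> x\<close> with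
  \<open>\<eta> \<circ> d\<phi>\<^sub>x = y\<close>.\<close>

definition Phi :: "(real^2) \<times> (real^2) \<Rightarrow> (real^3) \<times> (real^3)" where
  "Phi = (\<lambda>(x, y). (inv_stereo x,
     THE \<eta>. (inv_stereo x, \<eta>) \<in> cotangent_sphere \<and>
            (\<forall>v. \<eta> \<bullet> frechet_derivative inv_stereo (at x) v = y \<bullet> v)))"

definition Sigma_R :: "real \<Rightarrow> ((real^3) \<times> (real^3)) set" where
  "Sigma_R c = (THE C. C \<in> components (closure ((Phi \<circ> Psi) ` energy_level c)) \<and> bounded C)"

section \<open>Reeb dynamics and action spectrum\<close>

definition ext_deriv ::
  "('a::euclidean_space \<Rightarrow> 'a \<Rightarrow> real) \<Rightarrow> 'a \<Rightarrow> 'a \<Rightarrow> 'a \<Rightarrow> real" where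
  "ext_deriv \<alpha> z v w =
     frechet_derivative (\<lambda>u. \<alpha> u w) (at z) v - frechet_derivative (\<lambda>u. \<alpha> u v) (at z) w"

lemma ext_deriv_lambda_can: "ext_deriv lambda_can z v w = dp_dq v w"
proof -
  have *: "((\<lambda>u. lambda_can u x) has_derivative (\<lambda>h. snd h \<bullet> fst x)) (at z)" for x :: "'a \<times> 'a"
    by (auto simp: lambda_can_def case_prod_beta intro!: derivative_eq_intros)
  show ?thesis
    unfolding ext_deriv_def frechet_derivative_at[OF *, symmetric]
    by (simp add: dp_dq_def case_prod_beta)
qed

text \<open>For an embedded submanifold \<open>S\<close> this is the usual tangent space.\<close>

definition tangent_vectors :: "'a::euclidean_space set \<Rightarrow> 'a \<Rightarrow> 'a set" where
  "tangent_vectors S z = {v. \<exists>\<gamma> e. e > 0 \<and> \<gamma> 0 = z \<and> (\<forall>t\<in>{-e<..<e}. \<gamma> t \<in> S) \<and>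
     (\<gamma> has_vector_derivative v) (at (0::real))}"

definition reeb_field ::
  "'a::euclidean_space set \<Rightarrow> ('a \<Rightarrow> 'a \<Rightarrow> real) \<Rightarrow> 'a \<Rightarrow> 'a" where
  "reeb_field S \<alpha> z = (THE v. v \<in> tangent_vectors S z \<and> \<alpha> z v = 1 \<and>
     (\<forall>w\<in>tangent_vectors S z. ext_deriv \<alpha> z v w = 0))"

definition integral_curve_on :: "('a::euclidean_space \<Rightarrow> 'a) \<Rightarrow> 'a set \<Rightarrow> (real \<Rightarrow> 'a) \<Rightarrow> bool" where
  "integral_curve_on X S \<gamma> \<longleftrightarrow>
     (\<forall>t. \<gamma> t \<in> S \<and> (\<gamma> has_vector_derivative X (\<gamma> t)) (at t))"

definition is_period :: "(real \<Rightarrow> 'a) \<Rightarrow> real \<Rightarrow> bool" where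
  "is_period \<gamma> T \<longleftrightarrow> T > 0 \<and> (\<forall>t. \<gamma> (t + T) = \<gamma> t)"

text \<open>Since \<open>\<alpha>(R) = 1\<close>, the period \<open>T\<close> of a closed Reeb orbit is its action. \<open>T\<close> need not be
  the minimal period, so multiple covers are included.\<close>

definition action_spectrum :: "'a::euclidean_space set \<Rightarrow> ('a \<Rightarrow> 'a \<Rightarrow> real) \<Rightarrow> real set" where
  "action_spectrum S \<alpha> =
     {T. \<exists>\<gamma>. integral_curve_on (reeb_field S \<alpha>) S \<gamma> \<and> is_period \<gamma> T}"

definition action :: "('a::euclidean_space \<Rightarrow> 'a \<Rightarrow> real) \<Rightarrow> (real \<Rightarrow> 'a) \<Rightarrow> real \<Rightarrow> real" where
  "action \<alpha> \<gamma> T = integral {0..T} (\<lambda>t. \<alpha> (\<gamma> t) (vector_derivative \<gamma> (at t)))"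

section \<open>The circular orbits\<close>

definition simple_period :: "(real \<Rightarrow> 'a) \<Rightarrow> real \<Rightarrow> bool" where
  "simple_period \<gamma> T \<longleftrightarrow> is_period \<gamma> T \<and> (\<forall>s. 0 < s \<and> s < T \<longrightarrow> \<not> is_period \<gamma> s)"

definition circular_orbit :: "real \<Rightarrow> (real \<Rightarrow> (real^2) \<times> (real^2)) \<Rightarrow> real \<Rightarrow> bool" where
  "circular_orbit c \<gamma> T \<longleftrightarrow>
     integral_curve_on (ham_field H_R) (bounded_level c) \<gamma> \<and> simple_period \<gamma> T \<and>
     (\<exists>r. \<forall>t. norm (fst (\<gamma> t)) = r)"

text \<open>For the sign of the angular momentum term in \<open>H_R\<close> the coordinate frame rotates
  counterclockwise with unit angular speed: a point at rest in the inertial frame satisfies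
  \<open>q' = (q\<^sub>2, - q\<^sub>1)\<close>, and rotating \<open>q(t)\<close> by the angle \<open>t\<close> gives the Kepler motion in the
  inertial frame.\<close>

definition rot :: "real \<Rightarrow> real^2 \<Rightarrow> real^2" where
  "rot t v = vector [cos t * v$1 - sin t * v$2, sin t * v$1 + cos t * v$2]"

definition kepler_motion :: "(real \<Rightarrow> (real^2) \<times> (real^2)) \<Rightarrow> real \<Rightarrow> real^2" where
  "kepler_motion \<gamma> t = rot t (fst (\<gamma> t))"

text \<open>Positive if \<open>Q\<close> turns counterclockwise around the origin at time \<open>t\<close>, negative if it
  turns clockwise.\<close>

definition turning :: "(real \<Rightarrow> real^2) \<Rightarrow> real \<Rightarrow> real" where
  "turning Q t = (let v = vector_derivative Q (at t) in Q t $ 1 * v $ 2 - Q t $ 2 * v $ 1)"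

definition retrograde_orbit :: "real \<Rightarrow> (real \<Rightarrow> (real^2) \<times> (real^2)) \<Rightarrow> real \<Rightarrow> bool" where
  "retrograde_orbit c \<gamma> T \<longleftrightarrow>
     circular_orbit c \<gamma> T \<and> (\<forall>t. turning (kepler_motion \<gamma>) t < 0)"

definition direct_orbit :: "real \<Rightarrow> (real \<Rightarrow> (real^2) \<times> (real^2)) \<Rightarrow> real \<Rightarrow> bool" where
  "direct_orbit c \<gamma> T \<longleftrightarrow>
     circular_orbit c \<gamma> T \<and> (\<forall>t. turning (kepler_motion \<gamma>) t > 0)"

definition L_R :: "real \<Rightarrow> real" where
  "L_R c = (THE x. x > 0 \<and> c = 1 / (2 * x\<^sup>2) - x)"

definition L_D :: "real \<Rightarrow> real" where
  "L_D c = (THE x. - 1 < x \<and> x < 0 \<and> c = 1 / (2 * x\<^sup>2) - x)"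

end

theory Submission
  imports Defs
begin

text \<open>The rotating Kepler problem is regularised by Levi-Civita coordinates \<open>q = z\<^sup>2\<close>, \<open>p = w / cnj z\<close>. Together
  with \<open>Psi\<close> and \<open>Phi\<close> they extend to a map \<open>LC_cover\<close> from the nonzero pairs \<open>(z, w)\<close> onto the nonzero
  covectors of the sphere, two to one by \<open>LC_cover_eq_iff\<close>. The energy level becomes
  \<open>(cmod w)\<^sup>2 / 2 + (c - B) (cmod z)\<^sup>2 = 1\<close>, where \<open>B\<close> is the angular momentum \<open>Im (cnj z * w)\<close>. On a ray this is
  a quadratic equation with positive discriminant for \<open>c > 3 / 2\<close> (\<open>discriminant_pos\<close>), so the level falls
  into two halves. The half with \<open>B (cmod z)\<^sup>2 < 1\<close> is star-shaped, compact and connected, and its image is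
  \<open>Sigma_R c\<close> (\<open>Sigma_R_eq\<close>); the other half has only unbounded components.

  The Hamiltonian vector field of the regularised Hamiltonian, divided by the value of the Liouville
  form on it, satisfies the equations of the Reeb field. These have at most one solution, because there
  are enough explicit tangent vectors (\<open>reeb_field_eq\<close>). The angular momentum \<open>B\<close> is conserved, and on the
  double cover the motion is a harmonic oscillation of frequency \<open>k\<close>, where \<open>c = B + 2 k\<^sup>2\<close>, followed by a
  rotation by half the elapsed time \<open>\<theta>\<close>. The solutions are explicit: the amplitudes \<open>w + 2 \<i> k z\<close> and
  \<open>w - 2 \<i> k z\<close> are multiplied by \<open>cis (k s - \<theta> / 2)\<close> and \<open>cis (- k s - \<theta> / 2)\<close>, and the Reeb time is
  \<open>s - B \<theta>\<close>. The Reeb field is Lipschitz on the compact set \<open>Sigma_R c\<close>, so these solutions yield all Reeb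
  orbits, and the spectrum consists of the Reeb times at which a solution returns to its starting point
  up to sign (\<open>action_spectrum_iff\<close>).

  Put \<open>X = 1 / (2 k)\<close>; then \<open>c = B + 1 / (2 X\<^sup>2)\<close>, and the squared moduli of the amplitudes are \<open>2 + 2 B / X\<close> and
  \<open>2 - 2 B / X\<close>. If the first amplitude vanishes, then \<open>B = - X\<close> and \<open>X = L_R c\<close>: this is the retrograde orbit
  with its multiple covers. If the second one vanishes, then \<open>B = X = - L_D c\<close>: this is the direct orbit. If
  both are nonzero, a solution closes up when \<open>k s = pi K\<close> and \<open>\<theta> = 2 pi l\<close>. As \<open>\<theta> = X\<^sup>2 s\<close> after full periods,
  this means \<open>l / K = X\<^sup>3\<close>, and the Reeb time becomes \<open>2 pi (- l c + 3 / 2 K X)\<close>. The condition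
  \<open>- X < B < X\<close> is \<open>L_R c < X < - L_D c\<close> by the monotonicity of \<open>1 / (2 X\<^sup>2) - X\<close> and \<open>1 / (2 X\<^sup>2) + X\<close>; the
  latter is monotone only for \<open>X < 1\<close>, which holds because \<open>B < 1\<close> on the bounded half of the level
  (\<open>ang_less_1\<close>).

  The actions of the two circular orbits are computed in the original coordinates, where the constancy
  of \<open>norm q\<close> determines the motion (\<open>circular_orbit_facts\<close>).\<close>

section \<open>Angular momenta of the circular orbits\<close>

lemma level_retrograde_strict_decreasing:
  fixes x y :: real
  assumes "0 < x" "x < y"
  shows "1 / (2 * y\<^sup>2) - y < 1 / (2 * x\<^sup>2) - x"
proof -
  have "x\<^sup>2 < y\<^sup>2" using assms by (simp add: power_strict_mono)
  then have "1 / (2 * y\<^sup>2) < 1 / (2 * x\<^sup>2)" using assms by (intro divide_strict_left_mono) auto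
  then show ?thesis using assms by simp
qed

text \<open>The factor \<open>x + y - 2 x\<^sup>2 y\<^sup>2\<close> of the difference is positive because \<open>x\<^sup>2 y\<^sup>2 < x\<close> and
  \<open>x\<^sup>2 y\<^sup>2 \<le> y\<close>; this is where \<open>y \<le> 1\<close> enters, and the monotonicity does fail beyond \<open>1\<close>.\<close>
lemma level_direct_strict_decreasing:
  fixes x y :: real
  assumes "0 < x" "x < y" "y \<le> 1"
  shows "1 / (2 * y\<^sup>2) + y < 1 / (2 * x\<^sup>2) + x"
proof -
  have "x * (x * y\<^sup>2) \<le> x * (x * 1)" using assms by (intro mult_left_mono power_le_one) auto
  moreover have "x * x < x * 1" using assms by (intro mult_strict_left_mono) auto
  ultimately have 1: "x\<^sup>2 * y\<^sup>2 < x" by (simp add: power2_eq_square mult.assoc)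
  have "y * y * x\<^sup>2 \<le> y * 1 * 1" using assms by (intro mult_mono power_le_one) auto
  then have 2: "x\<^sup>2 * y\<^sup>2 \<le> y" by (simp add: power2_eq_square mult_ac)
  have "1 / (2 * x\<^sup>2) + x - (1 / (2 * y\<^sup>2) + y)
      = (y - x) * (x + y - 2 * (x\<^sup>2 * y\<^sup>2)) / (2 * (x\<^sup>2 * y\<^sup>2))"
    using assms by (simp add: field_simps power2_eq_square)
  also have "\<dots> > 0" using assms 1 2 by (intro divide_pos_pos mult_pos_pos) auto
  finally show ?thesis by simp
qed

lemma retrograde_momentum_exists:
  fixes c :: real
  assumes "c > 0"
  shows "\<exists>!x. x > 0 \<and> c = 1 / (2 * x\<^sup>2) - x"
proof -
  have "\<exists>x\<ge>0. x \<le> 1 \<and> 2 * x ^ 3 + 2 * c * x\<^sup>2 - 1 = 0"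
    using assms by (intro IVT) auto
  then obtain x where x: "0 \<le> x" "2 * x ^ 3 + 2 * c * x\<^sup>2 - 1 = 0" by blast
  then have "x \<noteq> 0" by auto
  with x have "x > 0 \<and> c = 1 / (2 * x\<^sup>2) - x"
    by (simp add: field_simps power2_eq_square power3_eq_cube)
  then show ?thesis using level_retrograde_strict_decreasing
    by (metis less_irrefl linorder_neqE_linordered_idom)
qed

lemma direct_momentum_exists:
  fixes c :: real
  assumes "c > 3 / 2"
  shows "\<exists>!x. - 1 < x \<and> x < 0 \<and> c = 1 / (2 * x\<^sup>2) - x"
proof -
  have "\<exists>x\<ge>0. x \<le> 1 \<and> 0 = 2 * c * x\<^sup>2 - 2 * x ^ 3 - 1"
    using assms by (intro IVT[of "\<lambda>x. 2 * c * x\<^sup>2 - 2 * x ^ 3 - 1" 0 0 1, simplified eq_commute]) auto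
  then obtain x where x: "0 \<le> x" "x \<le> 1" "2 * c * x\<^sup>2 - 2 * x ^ 3 - 1 = 0" by auto
  then have "x \<noteq> 0" "x \<noteq> 1" using assms by auto
  with x have *: "- 1 < - x \<and> - x < 0 \<and> c = 1 / (2 * (- x)\<^sup>2) - (- x)"
    by (simp add: field_simps power2_eq_square power3_eq_cube)
  have "y = - x" if y: "- 1 < y \<and> y < 0 \<and> c = 1 / (2 * y\<^sup>2) - y" for y
    using level_direct_strict_decreasing[of x "- y"] level_direct_strict_decreasing[of "- y" x] * y
    by (cases "- y" x rule: linorder_cases) auto
  with * show ?thesis by blast
qed

text \<open>Besides the defining equation, the spectrum needs to know on which side of \<open>L_R c\<close> a given \<open>X\<close> lies
  in terms of the energy; this is monotonicity.\<close>
lemma L_R_props: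
  assumes "c > 3 / 2"
  shows L_R_pos: "L_R c > 0"
    and L_R_less_iff: "X > 0 \<Longrightarrow> 1 / (2 * X\<^sup>2) - X < c \<longleftrightarrow> L_R c < X"
    and L_R_eq_iff: "X > 0 \<Longrightarrow> c = 1 / (2 * X\<^sup>2) - X \<longleftrightarrow> X = L_R c"
proof -
  have "L_R c > 0 \<and> c = 1 / (2 * (L_R c)\<^sup>2) - L_R c"
    unfolding L_R_def by (rule theI') (use assms in \<open>auto intro!: retrograde_momentum_exists\<close>)
  then show *: "L_R c > 0" and "X > 0 \<Longrightarrow> 1 / (2 * X\<^sup>2) - X < c \<longleftrightarrow> L_R c < X"
    and "X > 0 \<Longrightarrow> c = 1 / (2 * X\<^sup>2) - X \<longleftrightarrow> X = L_R c"
    using level_retrograde_strict_decreasing[of X "L_R c"] level_retrograde_strict_decreasing[of "L_R c" X]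
    by (cases X "L_R c" rule: linorder_cases; force)+
qed

lemma L_D_props:
  assumes "c > 3 / 2"
  shows L_D_neg: "L_D c < 0" and L_D_gt: "- 1 < L_D c"
    and L_D_less_iff: "0 < X \<Longrightarrow> X < 1 \<Longrightarrow> c < 1 / (2 * X\<^sup>2) + X \<longleftrightarrow> X < - L_D c"
    and L_D_eq_iff: "0 < X \<Longrightarrow> X < 1 \<Longrightarrow> c = 1 / (2 * X\<^sup>2) + X \<longleftrightarrow> X = - L_D c"
proof -
  have *: "- 1 < L_D c \<and> L_D c < 0 \<and> c = 1 / (2 * (L_D c)\<^sup>2) - L_D c"
    unfolding L_D_def by (rule theI') (use assms in \<open>auto intro!: direct_momentum_exists\<close>)
  then show "L_D c < 0" "- 1 < L_D c" by auto
  have **: "c = 1 / (2 * (- L_D c)\<^sup>2) + - L_D c" using * by simp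
  show "0 < X \<Longrightarrow> X < 1 \<Longrightarrow> c < 1 / (2 * X\<^sup>2) + X \<longleftrightarrow> X < - L_D c"
    and "0 < X \<Longrightarrow> X < 1 \<Longrightarrow> c = 1 / (2 * X\<^sup>2) + X \<longleftrightarrow> X = - L_D c"
    using * ** level_direct_strict_decreasing[of X "- L_D c"] level_direct_strict_decreasing[of "- L_D c" X]
    by (cases X "- L_D c" rule: linorder_cases; force)+
qed

section \<open>Energy and angular momentum in Levi-Civita coordinates\<close>

text \<open>With \<open>q = z\<^sup>2\<close> and \<open>p = w / cnj z\<close> one has \<open>cnj q * p = cnj z * w\<close>, so this is the angular momentum
  \<open>q\<^sub>1 p\<^sub>2 - q\<^sub>2 p\<^sub>1\<close>, and it extends smoothly over the collisions \<open>z = 0\<close>.\<close>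
definition ang_mom :: "complex \<times> complex \<Rightarrow> real" where
  "ang_mom = (\<lambda>(z, w). Im (cnj z * w))"

text \<open>Multiplying \<open>H_R = - c\<close> by \<open>norm q = (cmod z)\<^sup>2\<close> turns the energy level into
  \<open>quad_part - quart_part = 1\<close>, with a part of degree two and a part of degree four. The splitting by
  degree makes the intersection of the level with a ray a quadratic equation.\<close>
definition quad_part :: "real \<Rightarrow> complex \<times> complex \<Rightarrow> real" where
  "quad_part c = (\<lambda>(z, w). (cmod w)\<^sup>2 / 2 + c * (cmod z)\<^sup>2)"

definition quart_part :: "complex \<times> complex \<Rightarrow> real" where
  "quart_part = (\<lambda>(z, w). (cmod z)\<^sup>2 * ang_mom (z, w))"

definition LC_level :: "real \<Rightarrow> (complex \<times> complex) set" where
  "LC_level c = {x. quad_part c x - quart_part x = 1}"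

text \<open>The radial derivative of \<open>quad_part - quart_part\<close> on the level is \<open>2 (1 - quart_part)\<close>. The level
  therefore meets each ray at most once where \<open>quart_part < 1\<close>, and this half of it is the bounded one.\<close>
definition LC_bdd :: "real \<Rightarrow> (complex \<times> complex) set" where
  "LC_bdd c = {x. quad_part c x - quart_part x = 1 \<and> quart_part x < 1}"

lemma quart_sextic:
  fixes n r :: real
  shows "16 * n ^ 3 * r \<le> (r\<^sup>2 + 3 * n\<^sup>2)\<^sup>2"
proof -
  have "(r\<^sup>2 + 3 * n\<^sup>2)\<^sup>2 - 16 * n ^ 3 * r = (r - n)\<^sup>2 * ((r + n)\<^sup>2 + 8 * n\<^sup>2)"
    by (simp add: power2_eq_square power3_eq_cube algebra_simps)
  also have "\<dots> \<ge> 0" by simp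
  finally show ?thesis by simp
qed

text \<open>The discriminant of the quadratic equation on the ray through \<open>x\<close>. Its positivity says that the two
  halves of the level do not touch. The worst case \<open>ang_mom = cmod z * cmod w\<close> reduces to the previous
  inequality, whose equality case \<open>cmod z = cmod w\<close> is the critical point at \<open>c = 3 / 2\<close>.\<close>
lemma discriminant_pos:
  assumes c: "c > 3 / 2" and x: "x \<noteq> 0"
  shows "4 * quart_part x < (quad_part c x)\<^sup>2" and "quad_part c x > 0"
proof -
  obtain z w where zw: "x = (z, w)" by force
  have *: "z \<noteq> 0 \<or> w \<noteq> 0" using x zw by (auto simp: zero_prod_def)
  then show pos: "quad_part c x > 0"
  proof (cases "z = 0")
    case False
    then show ?thesis using c by (auto simp: quad_part_def zw intro!: add_nonneg_pos)
  qed (auto simp: quad_part_def zw)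
  show "4 * quart_part x < (quad_part c x)\<^sup>2"
  proof (cases "z = 0")
    case True
    then show ?thesis using * by (simp add: quart_part_def quad_part_def zw)
  next
    case False
    have "ang_mom x \<le> cmod z * cmod w"
      using abs_Im_le_cmod[of "cnj z * w"] by (simp add: ang_mom_def zw norm_mult)
    then have "4 * quart_part x \<le> 4 * (cmod z)\<^sup>2 * (cmod z * cmod w)"
      by (simp add: quart_part_def zw mult_left_mono)
    also have "\<dots> = 4 * (cmod z) ^ 3 * cmod w" by (simp add: power2_eq_square power3_eq_cube)
    also have "\<dots> \<le> ((cmod w)\<^sup>2 / 2 + 3 / 2 * (cmod z)\<^sup>2)\<^sup>2"
      using quart_sextic[of "cmod z" "cmod w"] by (simp add: power2_eq_square power3_eq_cube field_simps)
    also have "\<dots> < (quad_part c x)\<^sup>2"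
      unfolding quad_part_def zw using False c by (auto intro!: power_strict_mono mult_strict_right_mono)
    finally show ?thesis .
  qed
qed

lemma quart_neq_1:
  assumes "c > 3 / 2" "x \<in> LC_level c"
  shows "quart_part x \<noteq> 1"
proof
  assume q: "quart_part x = 1"
  then have "quad_part c x = 2" using assms by (simp add: LC_level_def)
  moreover have "x \<noteq> 0" using q by (auto simp: quart_part_def zero_prod_def)
  ultimately show False using discriminant_pos(1)[of c x] assms q by simp
qed

lemma energy_form:
  "quad_part c (z, w) - quart_part (z, w) = (cmod w)\<^sup>2 / 2 + (c - ang_mom (z, w)) * (cmod z)\<^sup>2"
  by (simp add: quad_part_def quart_part_def algebra_simps)

lemma ang_squared_le: "(ang_mom (z, w))\<^sup>2 \<le> (cmod z)\<^sup>2 * (cmod w)\<^sup>2"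
proof -
  have "\<bar>ang_mom (z, w)\<bar> \<le> cmod z * cmod w"
    using abs_Im_le_cmod[of "cnj z * w"] by (simp add: ang_mom_def norm_mult)
  then have "(ang_mom (z, w))\<^sup>2 \<le> (cmod z * cmod w)\<^sup>2" by (metis abs_ge_zero power2_abs power_mono)
  then show ?thesis by (simp add: power_mult_distrib)
qed

text \<open>With \<open>B\<close> the angular momentum and \<open>n = (cmod z)\<^sup>2\<close>, the level gives \<open>B\<^sup>2 \<le> n (2 - 2 (c - B) n)\<close>, and
  \<open>n < 1 / B\<close> on the bounded half. Replacing \<open>c\<close> by \<open>3 / 2\<close> makes the right side larger; for \<open>B \<ge> 1\<close> it then
  increases up to \<open>n = 1 / B\<close>, where it equals \<open>(4 B - 3) / B\<^sup>2 \<le> B\<^sup>2\<close>. This would give \<open>B\<^sup>2 < B\<^sup>2\<close>.\<close>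
lemma ang_less_1:
  assumes c: "c > 3 / 2" and x: "x \<in> LC_bdd c"
  shows "ang_mom x < 1"
proof (rule ccontr)
  obtain z w where zw: "x = (z, w)" by force
  define B n where "B = ang_mom x" and "n = (cmod z)\<^sup>2"
  assume "\<not> ang_mom x < 1"
  then have B: "B \<ge> 1" by (simp add: B_def)
  have nB: "n * B < 1" using x by (simp add: LC_bdd_def quart_part_def zw n_def B_def)
  have n0: "n \<ge> 0" by (simp add: n_def)
  have w: "(cmod w)\<^sup>2 = 2 - 2 * (c - B) * n"
    using x energy_form[of c z w] by (simp add: LC_bdd_def zw n_def B_def algebra_simps)
  have "B\<^sup>2 \<le> n * (2 - 2 * (c - B) * n)"
    using ang_squared_le[of z w] unfolding w by (simp add: B_def n_def zw)
  \<comment> \<open>If \<open>n = 0\<close>, the estimate just obtained would give \<open>B\<^sup>2 \<le> 0\<close>.\<close>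
  moreover have "n \<noteq> 0" using calculation B by auto
  ultimately have 1: "B\<^sup>2 < 2 * n - (3 - 2 * B) * n\<^sup>2"
  proof -
    have "n\<^sup>2 * (2 * c - 3) > 0" using \<open>n \<noteq> 0\<close> c by simp
    moreover note \<open>B\<^sup>2 \<le> n * (2 - 2 * (c - B) * n)\<close>
    ultimately show ?thesis by (simp add: algebra_simps power2_eq_square)
  qed
  define m where "m = 1 / B"
  have m: "n < m" "m * B = 1" "0 < m" "m \<le> 1" using nB B by (auto simp: m_def field_simps)
  have "(3 - 2 * B) * (m + n) \<le> 2"
  proof (cases "3 - 2 * B \<le> 0")
    case True
    then have "(3 - 2 * B) * (m + n) \<le> 0" using m n0 by (intro mult_nonpos_nonneg) auto
    then show ?thesis by simp
  next
    case False
    then have "(3 - 2 * B) * (m + n) \<le> B * (m + m)" using m n0 B by (intro mult_mono) auto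
    then show ?thesis using m by (simp add: algebra_simps)
  qed
  then have "0 \<le> (m - n) * (2 - (3 - 2 * B) * (m + n))" using m by simp
  then have "2 * n - (3 - 2 * B) * n\<^sup>2 \<le> 2 * m - (3 - 2 * B) * m\<^sup>2"
    by (simp add: algebra_simps power2_eq_square)
  also have "\<dots> = m\<^sup>2 * (4 * B - 3)"
    using m(2) by algebra
  also have "\<dots> \<le> m\<^sup>2 * B ^ 4"
  proof (intro mult_left_mono)
    have "B ^ 4 - (4 * B - 3) = (B - 1)\<^sup>2 * ((B + 1)\<^sup>2 + 2)"
      by (simp add: power2_eq_square power4_eq_xxxx algebra_simps)
    then show "4 * B - 3 \<le> B ^ 4" by (metis add_nonneg_nonneg diff_ge_0_iff_ge mult_nonneg_nonneg zero_le_numeral zero_le_power2)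
  qed auto
  also have "\<dots> = B\<^sup>2" using m(2) by algebra
  finally show False using 1 by simp
qed

section \<open>The double cover of the cotangent bundle of the sphere\<close>

text \<open>The composition of Levi-Civita coordinates with \<open>Psi\<close> and \<open>Phi\<close>, written without the denominator
  \<open>cnj z\<close>, so that it makes sense at collisions as well. The base point is the point of the Riemann
  sphere with homogeneous coordinates \<open>w : cnj z\<close>.\<close>
definition LC_cover :: "complex \<times> complex \<Rightarrow> (real^3) \<times> (real^3)" where
  "LC_cover = (\<lambda>(z, w).
     ((1 / ((cmod z)\<^sup>2 + (cmod w)\<^sup>2)) *\<^sub>R
        vector [2 * Re (w * z), 2 * Im (w * z), (cmod w)\<^sup>2 - (cmod z)\<^sup>2],
      vector [Re (w\<^sup>2 - z\<^sup>2) / 2, Im (w\<^sup>2 - z\<^sup>2) / 2, - Re (cnj w * z)]))"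

lemma inner_real3: "(x::real^3) \<bullet> y = x$1 * y$1 + x$2 * y$2 + x$3 * y$3"
  by (simp add: inner_vec_def sum_3)

lemma norm_real3: "(norm (x::real^3))\<^sup>2 = (x$1)\<^sup>2 + (x$2)\<^sup>2 + (x$3)\<^sup>2"
  by (simp only: power2_norm_eq_inner inner_real3) (simp add: power2_eq_square)

lemma eq_real3_iff: "(x::real^3) = y \<longleftrightarrow> x$1 = y$1 \<and> x$2 = y$2 \<and> x$3 = y$3"
  by (simp add: vec_eq_iff forall_3)

lemma eq_real2_iff: "(x::real^2) = y \<longleftrightarrow> x$1 = y$1 \<and> x$2 = y$2"
  by (simp add: vec_eq_iff forall_2)

lemma inner_real2: "(x::real^2) \<bullet> y = x$1 * y$1 + x$2 * y$2"
  by (simp add: inner_vec_def sum_2)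

lemma norm_real2: "(norm (x::real^2))\<^sup>2 = (x$1)\<^sup>2 + (x$2)\<^sup>2"
  by (simp only: power2_norm_eq_inner inner_real2) (simp add: power2_eq_square)

lemma LC_size_pos:
  assumes "(z, w) \<noteq> 0"
  shows "(cmod z)\<^sup>2 + (cmod w)\<^sup>2 > 0"
  using assms by (cases "z = 0") (auto simp: zero_prod_def intro: add_pos_nonneg)

lemma norm_snd_LC_cover: "norm (snd (LC_cover (z, w))) = ((cmod z)\<^sup>2 + (cmod w)\<^sup>2) / 2"
proof (rule power2_eq_imp_eq)
  show "(norm (snd (LC_cover (z, w))))\<^sup>2 = (((cmod z)\<^sup>2 + (cmod w)\<^sup>2) / 2)\<^sup>2"
    unfolding norm_real3 LC_cover_def
    by (simp add: cmod_power2 field_simps) (simp add: power2_eq_square algebra_simps)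
qed auto

lemma LC_cover_in_cotangent_sphere:
  assumes "x \<noteq> 0"
  shows "LC_cover x \<in> cotangent_sphere"
proof -
  obtain z w where x: "x = (z, w)" by force
  define N where "N = (cmod z)\<^sup>2 + (cmod w)\<^sup>2"
  have N: "N > 0" using LC_size_pos assms x by (simp add: N_def)
  have N': "N = (Re z)\<^sup>2 + (Im z)\<^sup>2 + (Re w)\<^sup>2 + (Im w)\<^sup>2" by (simp add: N_def cmod_power2)
  have "(norm (fst (LC_cover x)))\<^sup>2 = 1"
    unfolding norm_real3 LC_cover_def x
    apply (simp add: flip: N_def) 
    apply (use N in \<open>simp add: field_simps cmod_power2\<close>)
    by (simp add: N' power2_eq_square algebra_simps)
  then have "norm (fst (LC_cover x)) = 1" using power2_eq_imp_eq[of "norm (fst (LC_cover x))" 1] by simp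
  moreover have "fst (LC_cover x) \<bullet> snd (LC_cover x) = 0"
    unfolding inner_real3 LC_cover_def x
    apply (simp add: flip: N_def)
    apply (use N in \<open>simp add: field_simps cmod_power2\<close>)
    by (simp add: power2_eq_square algebra_simps)
  ultimately show ?thesis by (simp add: cotangent_sphere_def case_prod_beta)
qed

text \<open>The equations that determine \<open>(z, w)\<close> from its image; they use only quadratic expressions in \<open>(z, w)\<close>
  because the map is invariant under \<open>(z, w) \<mapsto> (- z, - w)\<close>.\<close>
lemma LC_cover_components:
  assumes "(z, w) \<noteq> 0" and "LC_cover (z, w) = (\<xi>, \<eta>)"
  shows "w * z = norm \<eta> *\<^sub>R Complex (\<xi>$1) (\<xi>$2)" "w\<^sup>2 - z\<^sup>2 = 2 * Complex (\<eta>$1) (\<eta>$2)"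
    "(cmod w)\<^sup>2 = norm \<eta> * (1 + \<xi>$3)" "(cmod z)\<^sup>2 = norm \<eta> * (1 - \<xi>$3)" "Re (cnj w * z) = - \<eta>$3"
    "norm \<eta> > 0" "norm \<eta> * (\<xi>$2 * \<eta>$1 - \<xi>$1 * \<eta>$2) = - norm \<eta> * ang_mom (z, w)"
proof -
  define N where "N = (cmod z)\<^sup>2 + (cmod w)\<^sup>2"
  have N: "N > 0" using LC_size_pos assms by (simp add: N_def)
  have \<eta>: "norm \<eta> = N / 2" using norm_snd_LC_cover[of z w] assms by (simp add: N_def)
  show "norm \<eta> > 0" unfolding \<eta> using N by simp
  have \<xi>: "\<xi> = (1 / N) *\<^sub>R vector [2 * Re (w * z), 2 * Im (w * z), (cmod w)\<^sup>2 - (cmod z)\<^sup>2]"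
   and \<eta>': "\<eta> = vector [Re (w\<^sup>2 - z\<^sup>2) / 2, Im (w\<^sup>2 - z\<^sup>2) / 2, - Re (cnj w * z)]"
    using assms(2) by (auto simp: LC_cover_def N_def)
  show "w * z = norm \<eta> *\<^sub>R Complex (\<xi>$1) (\<xi>$2)"
    unfolding \<eta> \<xi> using N by (simp add: complex_eq_iff)
  show "w\<^sup>2 - z\<^sup>2 = 2 * Complex (\<eta>$1) (\<eta>$2)" unfolding \<eta>' by (simp add: complex_eq_iff)
  show "(cmod w)\<^sup>2 = norm \<eta> * (1 + \<xi>$3)" "(cmod z)\<^sup>2 = norm \<eta> * (1 - \<xi>$3)"
    unfolding \<eta> \<xi> using N by (simp_all add: field_simps) (simp_all add: N_def algebra_simps)
  show "Re (cnj w * z) = - \<eta>$3" unfolding \<eta>' by simp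
  show "norm \<eta> * (\<xi>$2 * \<eta>$1 - \<xi>$1 * \<eta>$2) = - norm \<eta> * ang_mom (z, w)"
  proof -
    have a: "norm \<eta> * \<xi>$1 = Re (w * z)" "norm \<eta> * \<xi>$2 = Im (w * z)"
      unfolding \<eta> \<xi> using N by (simp_all add: complex_eq_iff)
    have "norm \<eta> * (\<xi>$2 * \<eta>$1 - \<xi>$1 * \<eta>$2) = Im (w * z) * \<eta>$1 - Re (w * z) * \<eta>$2"
      unfolding a[symmetric] by (simp add: algebra_simps)
    also have "\<dots> = - norm \<eta> * ang_mom (z, w)"
    proof -
      have e: "\<eta>$1 = Re (w\<^sup>2 - z\<^sup>2) / 2" "\<eta>$2 = Im (w\<^sup>2 - z\<^sup>2) / 2" unfolding \<eta>' by simp_all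
      then show ?thesis
        unfolding \<eta> N_def cmod_power2 ang_mom_def e by (simp add: power2_eq_square field_simps)
    qed
    finally show ?thesis .
  qed
qed

lemma ang_from_LC_cover:
  assumes "(z, w) \<noteq> 0" and "LC_cover (z, w) = (\<xi>, \<eta>)"
  shows "\<xi>$2 * \<eta>$1 - \<xi>$1 * \<eta>$2 = - ang_mom (z, w)"
proof -
  have "norm \<eta> * (\<xi>$2 * \<eta>$1 - \<xi>$1 * \<eta>$2 + ang_mom (z, w)) = 0"
    using LC_cover_components(7)[OF assms] by (simp add: algebra_simps)
  then show ?thesis using LC_cover_components(6)[OF assms] by simp
qed

text \<open>The numbers \<open>a = w + \<i> z\<close> and \<open>b = w - \<i> z\<close> diagonalise the equations: \<open>a\<^sup>2\<close> and \<open>b\<^sup>2\<close> are prescribed, and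
  so is \<open>a * cnj b\<close>. The square of the latter prescription follows from the former ones, hence it only
  fixes the sign of \<open>b\<close>.\<close>
lemma LC_cover_surj:
  assumes "(\<xi>, \<eta>) \<in> cotangent_sphere" "\<eta> \<noteq> 0"
  shows "\<exists>z w. (z, w) \<noteq> 0 \<and> LC_cover (z, w) = (\<xi>, \<eta>)"
proof -
  define n where "n = norm \<eta>"
  have n: "n > 0" "n\<^sup>2 = (\<eta>$1)\<^sup>2 + (\<eta>$2)\<^sup>2 + (\<eta>$3)\<^sup>2" using assms norm_real3[of \<eta>] by (auto simp: n_def)
  have \<xi>: "(\<xi>$1)\<^sup>2 + (\<xi>$2)\<^sup>2 + (\<xi>$3)\<^sup>2 = 1" using assms norm_real3[of \<xi>] by (simp add: cotangent_sphere_def)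
  have o: "\<xi>$1 * \<eta>$1 + \<xi>$2 * \<eta>$2 + \<xi>$3 * \<eta>$3 = 0"
    using assms inner_real3[of \<xi> \<eta>] by (simp add: cotangent_sphere_def)
  define x where "x = Complex (\<xi>$1) (\<xi>$2)"
  define y where "y = Complex (\<eta>$1) (\<eta>$2)"
  define a where "a = csqrt (2 * (y + \<i> * n * x))"
  define b0 where "b0 = csqrt (2 * (y - \<i> * n * x))"
  \<comment> \<open>The value of \<open>a * cnj b\<close> forced by the third components of \<open>\<xi>\<close> and \<open>\<eta>\<close>.\<close>
  define d where "d = Complex (2 * n * \<xi>$3) (- 2 * \<eta>$3)"
  have a: "a\<^sup>2 = 2 * (y + \<i> * n * x)" by (simp add: a_def)
  have b0: "b0\<^sup>2 = 2 * (y - \<i> * n * x)" by (simp add: b0_def)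
  have "(a * cnj b0)\<^sup>2 = a\<^sup>2 * cnj (b0\<^sup>2)" by (simp add: power_mult_distrib)
  also have "\<dots> = d\<^sup>2"
    unfolding a b0 x_def y_def d_def using n(2) \<xi> o
    apply (simp add: complex_eq_iff power2_eq_square)
    apply (intro conjI) by algebra+
  finally have "a * cnj b0 = d \<or> a * cnj b0 = - d" by (simp add: power2_eq_iff)
  then obtain b where b: "b\<^sup>2 = 2 * (y - \<i> * n * x)" "a * cnj b = d"
    using b0 by (metis complex_cnj_minus minus_minus mult_minus_right power2_minus)
  define w where "w = (a + b) / 2"
  define z where "z = (a - b) / (2 * \<i>)"
  have wz: "w * z = n * x"
  proof -
    have "w * z = (a\<^sup>2 - b\<^sup>2) / (4 * \<i>)" by (simp add: w_def z_def power2_eq_square field_simps)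
    then show ?thesis using a b by (simp add: field_simps)
  qed
  have wz2: "w\<^sup>2 - z\<^sup>2 = 2 * y"
  proof -
    have "w\<^sup>2 - z\<^sup>2 = (a\<^sup>2 + b\<^sup>2) / 2" by (simp add: w_def z_def power2_eq_square field_simps)
    then show ?thesis using a b by (simp add: field_simps)
  qed
  have Red: "Re (a * cnj b) = 2 * n * \<xi>$3" "Im (a * cnj b) = - 2 * \<eta>$3" using b by (simp_all add: d_def)
  have parts: "Re z = (Im a - Im b) / 2" "Im z = (Re b - Re a) / 2"
    unfolding z_def by (simp_all add: Re_divide Im_divide field_simps)
  have dif: "(cmod w)\<^sup>2 - (cmod z)\<^sup>2 = 2 * n * \<xi>$3"
    using Red(1) unfolding cmod_power2 parts unfolding w_def
    by (simp add: power2_eq_square field_simps)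
  have re: "- Re (cnj w * z) = \<eta>$3"
    using Red(2) unfolding w_def by (simp add: parts field_simps)
  have sum: "(cmod z)\<^sup>2 + (cmod w)\<^sup>2 = 2 * n"
  proof (rule power2_eq_imp_eq)
    have "((cmod z)\<^sup>2 + (cmod w)\<^sup>2)\<^sup>2 = ((cmod w)\<^sup>2 - (cmod z)\<^sup>2)\<^sup>2 + 4 * (cmod (w * z))\<^sup>2"
      by (simp add: norm_mult power2_eq_square algebra_simps)
    also have "\<dots> = (2 * n)\<^sup>2 * (\<xi>$3)\<^sup>2 + 4 * (n\<^sup>2 * ((\<xi>$1)\<^sup>2 + (\<xi>$2)\<^sup>2))"
      unfolding dif wz by (simp add: norm_mult power_mult_distrib x_def cmod_power2)
    also have "\<dots> = (2 * n)\<^sup>2 * 1" unfolding \<xi>[symmetric] by (simp add: algebra_simps)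
    finally show "((cmod z)\<^sup>2 + (cmod w)\<^sup>2)\<^sup>2 = (2 * n)\<^sup>2" by simp
  qed (use n in auto)
  then have "(z, w) \<noteq> 0" using n by (auto simp: zero_prod_def)
  moreover have "LC_cover (z, w) = (\<xi>, \<eta>)"
  proof -
    have "Re (w * z) = n * \<xi>$1" "Im (w * z) = n * \<xi>$2" unfolding wz x_def by simp_all
    moreover have "Re (w\<^sup>2 - z\<^sup>2) = 2 * \<eta>$1" "Im (w\<^sup>2 - z\<^sup>2) = 2 * \<eta>$2"
      unfolding wz2 y_def by simp_all
    ultimately show ?thesis using n dif re sum
      unfolding LC_cover_def prod.case eq_real3_iff prod.inject vector_scaleR_component vector_3
      by (simp del: times_complex.sel minus_complex.sel)
  qed
  ultimately show ?thesis by blast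
qed

text \<open>Again \<open>w + \<i> z\<close> and \<open>w - \<i> z\<close> are determined up to sign, and the product of one with the conjugate of
  the other couples the two signs.\<close>
lemma LC_cover_eq_iff:
  assumes "x \<noteq> 0" "y \<noteq> 0"
  shows "LC_cover x = LC_cover y \<longleftrightarrow> x = y \<or> x = - y"
proof
  assume eq: "LC_cover x = LC_cover y"
  obtain z w z' w' where x: "x = (z, w)" and y: "y = (z', w')" by (meson surj_pair)
  obtain \<xi> \<eta> where L: "LC_cover (z, w) = (\<xi>, \<eta>)" by force
  then have L': "LC_cover (z', w') = (\<xi>, \<eta>)" using eq x y by simp
  note A = LC_cover_components[OF _ L] and B = LC_cover_components[OF _ L']
  have ne: "(z, w) \<noteq> 0" "(z', w') \<noteq> 0" using assms x y by auto
  define a b a' b' where "a = w + \<i> * z" and "b = w - \<i> * z" and "a' = w' + \<i> * z'" and "b' = w' - \<i> * z'"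
  have wz: "w * z = w' * z'" "w\<^sup>2 - z\<^sup>2 = w'\<^sup>2 - z'\<^sup>2" using A(1,2)[OF ne(1)] B(1,2)[OF ne(2)] by simp_all
  have "a\<^sup>2 = (w\<^sup>2 - z\<^sup>2) + 2 * \<i> * (w * z)" by (simp add: a_def power2_eq_square algebra_simps)
  also have "\<dots> = a'\<^sup>2" unfolding wz by (simp add: a'_def power2_eq_square algebra_simps)
  finally have a: "a = a' \<or> a = - a'" by (simp add: power2_eq_iff)
  have "b\<^sup>2 = (w\<^sup>2 - z\<^sup>2) - 2 * \<i> * (w * z)" by (simp add: b_def power2_eq_square algebra_simps)
  also have "\<dots> = b'\<^sup>2" unfolding wz by (simp add: b'_def power2_eq_square algebra_simps)
  finally have b: "b = b' \<or> b = - b'" by (simp add: power2_eq_iff)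
  have n: "(cmod w)\<^sup>2 - (cmod z)\<^sup>2 = (cmod w')\<^sup>2 - (cmod z')\<^sup>2" "Re (cnj w * z) = Re (cnj w' * z')"
    using A(3-5)[OF ne(1)] B(3-5)[OF ne(2)] by simp_all
  have ab: "a * cnj b = a' * cnj b'"
    unfolding a_def b_def a'_def b'_def using n[unfolded cmod_power2]
    by (simp add: complex_eq_iff power2_eq_square algebra_simps)
  have zw: "w = (a + b) / 2" "z = (a - b) / (2 * \<i>)" "w' = (a' + b') / 2" "z' = (a' - b') / (2 * \<i>)"
    by (simp_all add: a_def b_def a'_def b'_def field_simps)
  have "(a = a' \<and> b = b') \<or> (a = - a' \<and> b = - b')"
    using a b ab by (auto simp: )
  then show "x = y \<or> x = - y"
    unfolding x y zw by (auto simp: field_simps)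
next
  assume "x = y \<or> x = - y"
  then show "LC_cover x = LC_cover y" by (cases x; cases y) (auto simp: LC_cover_def)
qed

section \<open>Calculus of coordinate vectors\<close>

lemma vector3_axis: "(vector [a, b, c] :: real^3) = a *\<^sub>R axis 1 1 + b *\<^sub>R axis 2 1 + c *\<^sub>R axis 3 1"
  by (simp add: eq_real3_iff axis_def)

lemma vector2_axis: "(vector [a, b] :: real^2) = a *\<^sub>R axis 1 1 + b *\<^sub>R axis 2 1"
  by (simp add: eq_real2_iff axis_def)

lemma continuous_on_vector3 [continuous_intros]:
  assumes "continuous_on S f" "continuous_on S g" "continuous_on S h"
  shows "continuous_on S (\<lambda>x. vector [f x, g x, h x] :: real^3)"
  unfolding vector3_axis by (intro continuous_intros assms)

lemma continuous_on_vector2 [continuous_intros]: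
  assumes "continuous_on S f" "continuous_on S g"
  shows "continuous_on S (\<lambda>x. vector [f x, g x] :: real^2)"
  unfolding vector2_axis by (intro continuous_intros assms)

lemma has_derivative_vector3:
  assumes "(f has_derivative f') F" "(g has_derivative g') F" "(h has_derivative h') F"
  shows "((\<lambda>x. vector [f x, g x, h x] :: real^3) has_derivative (\<lambda>v. vector [f' v, g' v, h' v])) F"
  unfolding vector3_axis by (intro derivative_intros assms)

lemma has_derivative_vector2:
  assumes "(f has_derivative f') F" "(g has_derivative g') F"
  shows "((\<lambda>x. vector [f x, g x] :: real^2) has_derivative (\<lambda>v. vector [f' v, g' v])) F"
  unfolding vector2_axis by (intro derivative_intros assms)

lemma has_vector_derivative_vector3:
  assumes "(f has_real_derivative f') F" "(g has_real_derivative g') F" "(h has_real_derivative h') F"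
  shows "((\<lambda>x. vector [f x, g x, h x] :: real^3) has_vector_derivative vector [f', g', h']) F"
  using has_derivative_vector3[OF assms[unfolded has_field_derivative_def]]
  unfolding has_vector_derivative_def by (simp add: vector3_axis scaleR_add_right mult.commute)

lemma has_vector_derivative_vector2:
  assumes "(f has_real_derivative f') F" "(g has_real_derivative g') F"
  shows "((\<lambda>x. vector [f x, g x] :: real^2) has_vector_derivative vector [f', g']) F"
  using has_derivative_vector2[OF assms[unfolded has_field_derivative_def]]
  unfolding has_vector_derivative_def by (simp add: vector2_axis scaleR_add_right mult.commute)

section \<open>The cotangent lift of stereographic projection\<close>

definition stereo_colift :: "real^2 \<Rightarrow> real^2 \<Rightarrow> real^3" where
  "stereo_colift x y = vector [((norm x)\<^sup>2 + 1) / 2 * y$1 - (x \<bullet> y) * x$1,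
                        ((norm x)\<^sup>2 + 1) / 2 * y$2 - (x \<bullet> y) * x$2, x \<bullet> y]"

definition d_inv_stereo :: "real^2 \<Rightarrow> real^2 \<Rightarrow> real^3" where
  "d_inv_stereo x v = vector
     [2 * v$1 / ((norm x)\<^sup>2 + 1) - 4 * x$1 * (x \<bullet> v) / ((norm x)\<^sup>2 + 1)\<^sup>2,
      2 * v$2 / ((norm x)\<^sup>2 + 1) - 4 * x$2 * (x \<bullet> v) / ((norm x)\<^sup>2 + 1)\<^sup>2,
      4 * (x \<bullet> v) / ((norm x)\<^sup>2 + 1)\<^sup>2]"

lemma has_derivative_inv_stereo: "(inv_stereo has_derivative d_inv_stereo x) (at x)"
proof -
  have pos: "x \<bullet> x + 1 > 0" for x :: "real^2" by (simp add: add_nonneg_pos)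
  then have nz: "x \<bullet> x + 1 \<noteq> 0" for x :: "real^2" by (metis less_irrefl)
  have comp: "((\<lambda>x. x $ i) has_derivative (\<lambda>v. v $ i)) (at x)" for i and x :: "real^2"
    by (rule bounded_linear_imp_has_derivative) (rule bounded_linear_vec_nth)
  have eq: "inv_stereo = (\<lambda>x. vector [2 * x$1 / (x \<bullet> x + 1), 2 * x$2 / (x \<bullet> x + 1),
      (x \<bullet> x - 1) / (x \<bullet> x + 1)])"
    by (rule ext) (simp add: inv_stereo_def eq_real3_iff power2_norm_eq_inner)
  have d1: "((\<lambda>x::real^2. x \<bullet> x + 1) has_derivative (\<lambda>v. 2 * (x \<bullet> v))) (at x)"
    and d2: "((\<lambda>x::real^2. x \<bullet> x - 1) has_derivative (\<lambda>v. 2 * (x \<bullet> v))) (at x)"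
    by (auto intro!: derivative_eq_intros simp: inner_commute)
  have d3: "((\<lambda>x. 2 * x $ i) has_derivative (\<lambda>v. 2 * v $ i)) (at x)" for i and x :: "real^2"
    by (intro derivative_intros comp)
  have eq': "d_inv_stereo x = (\<lambda>v. vector
      [(2 * v$1 * (x \<bullet> x + 1) - 2 * x$1 * (2 * (x \<bullet> v))) / ((x \<bullet> x + 1) * (x \<bullet> x + 1)),
       (2 * v$2 * (x \<bullet> x + 1) - 2 * x$2 * (2 * (x \<bullet> v))) / ((x \<bullet> x + 1) * (x \<bullet> x + 1)),
       (2 * (x \<bullet> v) * (x \<bullet> x + 1) - (x \<bullet> x - 1) * (2 * (x \<bullet> v))) / ((x \<bullet> x + 1) * (x \<bullet> x + 1))])"
  proof -
    have "2 * a / k - 4 * b * X / k\<^sup>2 = (2 * a * k - 2 * b * (2 * X)) / (k * k)" if "k \<noteq> 0" for a b k X :: real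
      using that by (simp add: field_simps power2_eq_square)
    moreover have "4 * X / (m + 1)\<^sup>2 = (2 * X * (m + 1) - (m - 1) * (2 * X)) / ((m + 1) * (m + 1))" for X m :: real
      by (simp add: algebra_simps power2_eq_square)
    ultimately show ?thesis
      unfolding d_inv_stereo_def power2_norm_eq_inner using nz[of x] by presburger
  qed
  show ?thesis
    unfolding eq eq'
    by (intro has_derivative_vector3 has_derivative_divide' d1 d2 d3 nz)
qed

lemma stereo_colift_inner: "stereo_colift x y \<bullet> d_inv_stereo x v = y \<bullet> v"
proof -
  define N where "N = (norm x)\<^sup>2 + 1"
  have N: "N > 0" by (simp add: N_def add_nonneg_pos)
  have xx: "x$1 * x$1 + x$2 * x$2 = N - 1" using norm_real2[of x] by (simp add: N_def power2_eq_square)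
  define X Y where "X = x \<bullet> v" and "Y = x \<bullet> y"
  have "stereo_colift x y \<bullet> d_inv_stereo x v * N\<^sup>2 = (y \<bullet> v) * N\<^sup>2 - 2 * X * (x$1 * y$1 + x$2 * y$2) * N
     - 2 * Y * (x$1 * v$1 + x$2 * v$2) * N + 4 * X * Y * ((x$1 * x$1 + x$2 * x$2) + 1)"
    using N unfolding inner_real3 stereo_colift_def d_inv_stereo_def N_def[symmetric] X_def[symmetric] Y_def[symmetric]
    by (simp add: field_simps power2_eq_square inner_real2)
  also have "\<dots> = (y \<bullet> v) * N\<^sup>2" unfolding xx by (simp add: X_def Y_def inner_real2 algebra_simps)
  finally show ?thesis using N by simp
qed

lemma inv_stereo_colift: "(inv_stereo x, stereo_colift x y) \<in> cotangent_sphere"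
proof -
  define N where "N = (norm x)\<^sup>2 + 1"
  have N: "N > 0" by (simp add: N_def add_nonneg_pos)
  have xx: "x$1 * x$1 + x$2 * x$2 = N - 1" using norm_real2[of x] by (simp add: N_def power2_eq_square)
  have st: "inv_stereo x = (1 / N) *\<^sub>R vector [2 * x$1, 2 * x$2, N - 2]"
    by (simp add: inv_stereo_def N_def)
  have "(norm (inv_stereo x))\<^sup>2 * N\<^sup>2 = 4 * (x$1 * x$1 + x$2 * x$2) + (N - 2)\<^sup>2"
    unfolding norm_real3 st using N by (simp add: field_simps power2_eq_square)
  also have "\<dots> = N\<^sup>2" unfolding xx by (simp add: power2_eq_square algebra_simps)
  finally have "(norm (inv_stereo x))\<^sup>2 = 1" using N by simp
  then have 1: "norm (inv_stereo x) = 1" using power2_eq_imp_eq[of "norm (inv_stereo x)" 1] by simp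
  have "(inv_stereo x \<bullet> stereo_colift x y) * N = N * (x \<bullet> y) - 2 * (x \<bullet> y) * (x$1 * x$1 + x$2 * x$2) + (x \<bullet> y) * (N - 2)"
    unfolding inner_real3 st stereo_colift_def N_def[symmetric] using N
    by (simp add: field_simps inner_real2)
  also have "\<dots> = 0" unfolding xx by (simp add: algebra_simps)
  finally show ?thesis using N 1 by (simp add: cotangent_sphere_def)
qed

text \<open>The covector is unique since the derivative of inverse stereographic projection is onto the tangent
  plane: a vector orthogonal to its image and to the base point vanishes.\<close>
lemma Phi_eq: "Phi (x, y) = (inv_stereo x, stereo_colift x y)"
proof -
  have fd: "frechet_derivative inv_stereo (at x) = d_inv_stereo x"
    using frechet_derivative_at[OF has_derivative_inv_stereo] by simp
  have "\<delta> = 0" if o: "inv_stereo x \<bullet> \<delta> = 0" and t: "\<And>v. \<delta> \<bullet> d_inv_stereo x v = 0" for \<delta>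
  proof -
    define N where "N = (norm x)\<^sup>2 + 1"
    have N: "N > 0" by (simp add: N_def add_nonneg_pos)
    have xx: "x \<bullet> x = N - 1" by (simp add: N_def power2_norm_eq_inner)
    define s where "s = x$1 * \<delta>$1 + x$2 * \<delta>$2"
    have a: "2 * s + (N - 2) * \<delta>$3 = 0"
    proof -
      have "inv_stereo x = (1 / N) *\<^sub>R vector [2 * x$1, 2 * x$2, N - 2]"
        by (simp add: inv_stereo_def N_def)
      then have "inv_stereo x \<bullet> \<delta> = (1 / N) * (2 * s + (N - 2) * \<delta>$3)"
        unfolding inner_real3 by (simp add: s_def algebra_simps add_divide_distrib)
      then show ?thesis using o N by simp
    qed
    have b: "2 * (\<delta>$1 * v$1 + \<delta>$2 * v$2) * N - 4 * s * (x \<bullet> v) + 4 * \<delta>$3 * (x \<bullet> v) = 0" for v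
    proof -
      have "0 = (\<delta> \<bullet> d_inv_stereo x v) * N\<^sup>2" using t by simp
      also have "\<dots> = 2 * (\<delta>$1 * v$1 + \<delta>$2 * v$2) * N - 4 * s * (x \<bullet> v) + 4 * \<delta>$3 * (x \<bullet> v)"
        using N unfolding inner_real3 d_inv_stereo_def N_def[symmetric]
        by (simp add: s_def field_simps power2_eq_square)
      finally show ?thesis by simp
    qed
    have "2 * s * N - 4 * s * (N - 1) + 4 * \<delta>$3 * (N - 1) = 0"
      using b[of x] unfolding xx by (simp add: s_def mult.commute)
    moreover have s: "s = - (N - 2) * \<delta>$3 / 2" using a by (simp add: field_simps)
    ultimately have "\<delta>$3 * N\<^sup>2 = 0" by (simp add: field_simps power2_eq_square)
    then have d3: "\<delta>$3 = 0" using N by simp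
    then have "s = 0" using s by simp
    then have "\<delta>$1 * v$1 + \<delta>$2 * v$2 = 0" for v :: "real^2" using b[of v] d3 N by simp
    from this[of "vector [1,0]"] this[of "vector [0,1]"] d3 show ?thesis by (simp add: eq_real3_iff)
  qed
  note uniq = this
  have "(THE \<eta>. (inv_stereo x, \<eta>) \<in> cotangent_sphere \<and>
            (\<forall>v. \<eta> \<bullet> frechet_derivative inv_stereo (at x) v = y \<bullet> v)) = stereo_colift x y"
  proof (rule the_equality)
    show "(inv_stereo x, stereo_colift x y) \<in> cotangent_sphere \<and>
            (\<forall>v. stereo_colift x y \<bullet> frechet_derivative inv_stereo (at x) v = y \<bullet> v)"
      using inv_stereo_colift stereo_colift_inner fd by simp
    fix \<eta>
    assume *: "(inv_stereo x, \<eta>) \<in> cotangent_sphere \<and>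
            (\<forall>v. \<eta> \<bullet> frechet_derivative inv_stereo (at x) v = y \<bullet> v)"
    have "\<eta> - stereo_colift x y = 0"
      by (rule uniq) (use * inv_stereo_colift[of x y] stereo_colift_inner[of x y] fd in
          \<open>auto simp: cotangent_sphere_def inner_diff_left inner_diff_right\<close>)
    then show "\<eta> = stereo_colift x y" by simp
  qed
  then show ?thesis by (simp add: Phi_def)
qed

section \<open>Levi-Civita coordinates\<close>

definition levi_civita :: "complex \<times> complex \<Rightarrow> (real^2) \<times> (real^2)" where
  "levi_civita = (\<lambda>(z, w). (vector [Re (z\<^sup>2), Im (z\<^sup>2)], vector [Re (w / cnj z), Im (w / cnj z)]))"

lemma levi_civita_norms:
  assumes "z \<noteq> 0"
  shows "norm (fst (levi_civita (z, w))) = (cmod z)\<^sup>2" "(norm (snd (levi_civita (z, w))))\<^sup>2 = (cmod w)\<^sup>2 / (cmod z)\<^sup>2"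
proof -
  have v: "norm (vector [Re x, Im x] :: real^2) = cmod x" for x
    by (simp add: norm_vec_def L2_set_def sum_2 cmod_def)
  show "norm (fst (levi_civita (z, w))) = (cmod z)\<^sup>2" "(norm (snd (levi_civita (z, w))))\<^sup>2 = (cmod w)\<^sup>2 / (cmod z)\<^sup>2"
    using v[of "z\<^sup>2"] v[of "w / cnj z"] by (simp_all add: levi_civita_def norm_divide norm_power power_divide)
qed

lemma levi_civita_ang:
  assumes "z \<noteq> 0" "levi_civita (z, w) = (q, p)"
  shows "q$1 * p$2 - q$2 * p$1 = ang_mom (z, w)"
proof -
  have "q$1 * p$2 - q$2 * p$1 = Im (cnj (z\<^sup>2) * (w / cnj z))"
  proof -
    have *: "Im (cnj a * b) = Re a * Im b - Im a * Re b" for a b by simp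
    show ?thesis unfolding * using assms(2) by (auto simp: levi_civita_def)
  qed
  also have "cnj (z\<^sup>2) * (w / cnj z) = cnj z * w" using assms(1) by (simp add: power2_eq_square)
  finally show ?thesis by (simp add: ang_mom_def)
qed

lemma H_R_levi_civita:
  assumes "z \<noteq> 0"
  shows "H_R (levi_civita (z, w)) = - c \<longleftrightarrow> (z, w) \<in> LC_level c"
proof -
  obtain q p where qp: "levi_civita (z, w) = (q, p)" by force
  have "H_R (levi_civita (z, w)) = (cmod w)\<^sup>2 / (cmod z)\<^sup>2 / 2 - 1 / (cmod z)\<^sup>2 - ang_mom (z, w)"
    using levi_civita_norms[OF assms, of w] levi_civita_ang[OF assms qp] by (simp add: H_R_def qp mult.commute)
  then have "(H_R (levi_civita (z, w)) + c) * (cmod z)\<^sup>2 = quad_part c (z, w) - quart_part (z, w) - 1"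
    using assms by (simp add: quad_part_def quart_part_def field_simps)
  then have "H_R (levi_civita (z, w)) + c = 0 \<longleftrightarrow> quad_part c (z, w) - quart_part (z, w) - 1 = 0"
    using assms by (metis mult_eq_0_iff norm_eq_zero power_not_zero)
  then show ?thesis by (auto simp: LC_level_def)
qed

lemma levi_civita_surj:
  assumes "q \<noteq> 0"
  shows "\<exists>z w. z \<noteq> 0 \<and> levi_civita (z, w) = (q, p)"
proof -
  define z where "z = csqrt (Complex (q$1) (q$2))"
  have z: "z\<^sup>2 = Complex (q$1) (q$2)" by (simp add: z_def)
  then have "z \<noteq> 0" using assms by (auto simp: complex_eq_iff eq_real2_iff)
  then have "levi_civita (z, Complex (p$1) (p$2) * cnj z) = (q, p)"
    unfolding levi_civita_def prod.case z by (simp add: eq_real2_iff)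
  then show ?thesis using \<open>z \<noteq> 0\<close> by blast
qed

text \<open>By this identity the double cover regularises the level: the closure of the image of the energy level
  only adds the images of the points with \<open>z = 0\<close>.\<close>
lemma Phi_Psi_levi_civita:
  assumes "z \<noteq> 0"
  shows "Phi (Psi (levi_civita (z, w))) = LC_cover (z, w)"
proof -
  define x where "x = w / cnj z"
  have w: "w = x * cnj z" using assms by (simp add: x_def)
  define n where "n = (cmod z)\<^sup>2"
  have n: "n > 0" using assms by (simp add: n_def)
  define xv :: "real^2" where "xv = vector [Re x, Im x]"
  define yv :: "real^2" where "yv = vector [- Re (z\<^sup>2), - Im (z\<^sup>2)]"
  have PL: "Phi (Psi (levi_civita (z, w))) = (inv_stereo xv, stereo_colift xv yv)"
  proof -
    have "levi_civita (z, w) = (vector [Re (z\<^sup>2), Im (z\<^sup>2)], xv)" by (simp add: levi_civita_def xv_def x_def)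
    moreover have "- (vector [Re (z\<^sup>2), Im (z\<^sup>2)] :: real^2) = yv" unfolding yv_def by (simp only: eq_real2_iff) simp
    ultimately show ?thesis by (simp only: Psi_def prod.case Phi_eq)
  qed
  have nx: "(norm xv)\<^sup>2 = (Re x)\<^sup>2 + (Im x)\<^sup>2" by (simp add: norm_real2 xv_def)
  have xy: "xv \<bullet> yv = - Re x * Re (z\<^sup>2) - Im x * Im (z\<^sup>2)" by (simp add: inner_real2 xv_def yv_def)
  define k where "k = (Re x)\<^sup>2 + (Im x)\<^sup>2 + 1"
  have k: "k > 0" by (simp add: k_def add_nonneg_pos)
  have zz: "complex_of_real n = z * cnj z" by (simp only: n_def complex_norm_square)
  have wz: "w * z = n *\<^sub>R x"
    unfolding w scaleR_conv_of_real zz by (simp add: mult_ac)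
  have cw: "(cmod w)\<^sup>2 = n * (k - 1)"
    by (simp add: w norm_mult power_mult_distrib n_def k_def cmod_power2)
  have "fst (LC_cover (z, w)) = (1 / (n * k)) *\<^sub>R vector [2 * (n * Re x), 2 * (n * Im x), n * (k - 2)]"
    unfolding LC_cover_def prod.case fst_conv cw wz n_def[symmetric] by (simp add: algebra_simps)
  also have "\<dots> = inv_stereo xv"
    unfolding inv_stereo_def nx using n k
    by (simp only: eq_real3_iff) (simp add: xv_def flip: k_def, simp add: k_def)
  finally have 1: "fst (LC_cover (z, w)) = inv_stereo xv" .
  have 2: "snd (LC_cover (z, w)) = stereo_colift xv yv"
    unfolding LC_cover_def prod.case snd_conv stereo_colift_def nx xy w eq_real3_iff
    by (simp add: xv_def yv_def power2_eq_square field_simps)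
  show ?thesis using 1 2 PL by (metis prod.collapse)
qed

section \<open>Components of the energy level\<close>

text \<open>Components are recognised by a continuous function that omits the value \<open>1\<close>: it separates the part
  below \<open>1\<close>, which is connected, from the part above, each of whose components is unbounded. The
  predicate \<open>P\<close> stands for the two notions of boundedness in use, in \<open>T\<^sup>*S\<^sup>2\<close> and in the position \<open>q\<close>
  alone.\<close>
lemma the_component_below:
  fixes S :: "'a::topological_space set" and F :: "'a \<Rightarrow> real"
  assumes cont: "continuous_on S F" and ne1: "\<And>x. x \<in> S \<Longrightarrow> F x \<noteq> 1"
    and conn: "connected {x \<in> S. F x < 1}" and ne: "{x \<in> S. F x < 1} \<noteq> {}"
    and P: "P {x \<in> S. F x < 1}" and mono: "\<And>C D. P C \<Longrightarrow> D \<subseteq> C \<Longrightarrow> P D"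
    and above: "\<And>x. x \<in> S \<Longrightarrow> F x > 1 \<Longrightarrow> \<exists>C. connected C \<and> x \<in> C \<and> C \<subseteq> S \<and> \<not> P C"
  shows "(THE C. C \<in> components S \<and> P C) = {x \<in> S. F x < 1}"
proof -
  let ?A = "{x \<in> S. F x < 1}"
  have A: "?A \<in> components S"
    unfolding in_components_maximal
  proof (intro conjI allI impI)
    fix d assume d: "d \<noteq> {} \<and> ?A \<subseteq> d \<and> d \<subseteq> S \<and> connected d"
    have "connected (F ` d)" using d cont by (meson connected_continuous_image continuous_on_subset)
    obtain a where a: "a \<in> ?A" using ne by blast
    have "F y < 1" if y: "y \<in> d" for y
    proof (rule ccontr)
      assume "\<not> F y < 1"
      then have "1 \<in> F ` d"
        using connectedD_interval[OF \<open>connected (F ` d)\<close>, of "F a" "F y" 1] a y d by force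
      then obtain v where "v \<in> d" "F v = 1" by force
      then show False using ne1[of v] d by blast
    qed
    then show "d = ?A" using d by blast
  qed (use ne conn in auto)
  show ?thesis
  proof (rule the_equality[of "\<lambda>C. C \<in> components S \<and> P C"])
    fix C assume C: "C \<in> components S \<and> P C"
    show "C = ?A"
    proof (cases "C \<inter> ?A = {}")
      case False
      then show ?thesis using A C components_eq by blast
    next
      case True
      obtain x where x: "x \<in> C" using C in_components_nonempty by blast
      have "x \<in> S" using C x in_components_subset by blast
      then have "F x > 1" using True x ne1[of x] x by force
      then obtain D where D: "connected D" "x \<in> D" "D \<subseteq> S" "\<not> P D" using above \<open>x \<in> S\<close> by blast
      then have "D \<subseteq> C" using C x components_maximal by (metis disjoint_iff)
      then show ?thesis using mono[of C D] C D(4) by blast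
    qed
  qed (use A P in auto)
qed

lemma quad_scale: "quad_part c (s *\<^sub>R x) = s\<^sup>2 * quad_part c x"
  by (cases x) (simp add: quad_part_def power_mult_distrib algebra_simps)

lemma quart_scale: "quart_part (s *\<^sub>R x) = s ^ 4 * quart_part x"
proof (cases x)
  case (Pair z w)
  have "ang_mom (s *\<^sub>R z, s *\<^sub>R w) = s\<^sup>2 * ang_mom (z, w)"
    by (simp add: ang_mom_def power2_eq_square algebra_simps)
  then have "quart_part (s *\<^sub>R x) = s\<^sup>2 * (cmod z)\<^sup>2 * (s\<^sup>2 * ang_mom (z, w))"
    unfolding Pair quart_part_def by (simp add: power_mult_distrib)
  also have "\<dots> = s ^ 4 * quart_part x" by (simp add: Pair quart_part_def power4_eq_xxxx power2_eq_square)
  finally show ?thesis .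
qed

lemma continuous_on_quad [continuous_intros]:
  "continuous_on S f \<Longrightarrow> continuous_on S (\<lambda>x. quad_part c (f x))"
  unfolding quad_part_def case_prod_beta by (intro continuous_intros) auto

lemma continuous_on_quart [continuous_intros]:
  "continuous_on S f \<Longrightarrow> continuous_on S (\<lambda>x. quart_part (f x))"
  unfolding quart_part_def ang_mom_def case_prod_beta by (intro continuous_intros) auto

lemma continuous_on_LC_cover:
  assumes "continuous_on S f" "\<And>x. x \<in> S \<Longrightarrow> f x \<noteq> 0"
  shows "continuous_on S (\<lambda>x. LC_cover (f x))"
proof -
  have nz: "(cmod (fst (f x)))\<^sup>2 + (cmod (snd (f x)))\<^sup>2 \<noteq> 0" if "x \<in> S" for x
    using LC_size_pos[of "fst (f x)" "snd (f x)"] assms(2)[OF that] by (metis prod.collapse less_irrefl)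
  show ?thesis
    unfolding LC_cover_def case_prod_beta by (intro continuous_intros assms(1) ballI nz) simp_all
qed

lemma continuous_on_levi_civita:
  assumes "continuous_on S f" "\<And>x. x \<in> S \<Longrightarrow> fst (f x) \<noteq> 0"
  shows "continuous_on S (\<lambda>x. levi_civita (f x))"
  unfolding levi_civita_def case_prod_beta using assms by (intro continuous_intros) auto

text \<open>Rescales \<open>x\<close> to the bounded half of the level; the scaling factor is the square root of the smaller
  solution \<open>r\<close> of \<open>quad_part c x * r - quart_part x * r\<^sup>2 = 1\<close>. Written in this form the solution is continuous
  through \<open>quart_part x = 0\<close>.\<close>
definition to_bdd :: "real \<Rightarrow> complex \<times> complex \<Rightarrow> complex \<times> complex" where
  "to_bdd c x = sqrt (2 / (quad_part c x + sqrt ((quad_part c x)\<^sup>2 - 4 * quart_part x))) *\<^sub>R x"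

lemma smaller_root:
  fixes a b :: real
  assumes "a > 0" "4 * b < a\<^sup>2"
  defines "r \<equiv> 2 / (a + sqrt (a\<^sup>2 - 4 * b))"
  shows "r > 0" "a * r - b * r\<^sup>2 = 1" "b * r\<^sup>2 < 1"
proof -
  define d where "d = sqrt (a\<^sup>2 - 4 * b)"
  have d: "d > 0" "d\<^sup>2 = a\<^sup>2 - 4 * b" using assms by (simp_all add: d_def)
  then have "a + d > 0" using assms by simp
  then show r: "r > 0" by (simp add: r_def d_def)
  have ad: "(a + d) * r = 2"
    unfolding r_def d_def[symmetric] times_divide_eq_right
    by (rule nonzero_mult_div_cancel_left) (use \<open>a + d > 0\<close> in simp)
  have q: "4 * (b * r\<^sup>2) = 2 * ((a - d) * r)"
  proof -
    have "4 * (b * r\<^sup>2) = (a\<^sup>2 - d\<^sup>2) * r\<^sup>2" using d(2) by simp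
    also have "\<dots> = (a - d) * r * ((a + d) * r)" by (simp add: power2_eq_square algebra_simps)
    finally show ?thesis unfolding ad by simp
  qed
  have "d * r > 0" using r d by simp
  then show "b * r\<^sup>2 < 1" "a * r - b * r\<^sup>2 = 1" using q ad by (simp_all add: algebra_simps)
qed

lemma to_bdd_in:
  assumes c: "c > 3 / 2" and x: "x \<noteq> 0"
  shows "to_bdd c x \<in> LC_bdd c"
proof -
  define r where "r = 2 / (quad_part c x + sqrt ((quad_part c x)\<^sup>2 - 4 * quart_part x))"
  note r = smaller_root[OF discriminant_pos(2,1)[OF assms], folded r_def]
  have "to_bdd c x = sqrt r *\<^sub>R x" by (simp add: to_bdd_def r_def)
  then have "quad_part c (to_bdd c x) = quad_part c x * r" "quart_part (to_bdd c x) = quart_part x * r\<^sup>2"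
    using r(1) by (simp_all add: quad_scale quart_scale power4_eq_xxxx power2_eq_square)
  then show ?thesis using r by (simp add: LC_bdd_def)
qed

lemma to_bdd_id:
  assumes "x \<in> LC_bdd c"
  shows "to_bdd c x = x"
proof -
  have "(quad_part c x)\<^sup>2 - 4 * quart_part x = (1 - quart_part x)\<^sup>2" and "quad_part c x = 1 + quart_part x"
    using assms by (auto simp: LC_bdd_def power2_eq_square algebra_simps)
  then show ?thesis using assms by (simp add: to_bdd_def LC_bdd_def)
qed

lemma LC_bdd_nonzero: "x \<in> LC_bdd c \<Longrightarrow> x \<noteq> 0"
  by (auto simp: LC_bdd_def quad_part_def quart_part_def zero_prod_def)

lemma LC_level_nonzero: "x \<in> LC_level c \<Longrightarrow> x \<noteq> 0"
  by (auto simp: LC_level_def quad_part_def quart_part_def zero_prod_def)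

lemma LC_bdd_subset: "LC_bdd c \<subseteq> LC_level c"
  by (auto simp: LC_bdd_def LC_level_def)

lemma continuous_on_to_bdd:
  assumes "c > 3 / 2" "0 \<notin> S"
  shows "continuous_on S (to_bdd c)"
proof -
  have "quad_part c x + sqrt ((quad_part c x)\<^sup>2 - 4 * quart_part x) > 0" if "x \<in> S" for x
    using discriminant_pos[OF assms(1), of x] that assms(2) by (cases "x = 0") (auto intro!: add_pos_nonneg)
  then have "quad_part c x + sqrt ((quad_part c x)\<^sup>2 - 4 * quart_part x) \<noteq> 0" if "x \<in> S" for x
    using that by fastforce
  then show ?thesis
    unfolding to_bdd_def by (intro continuous_intros) auto
qed

text \<open>Rescaling is a continuous retraction of a cone onto its part of the bounded half of the level.\<close>
lemma connected_LC_bdd_cone: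
  assumes c: "c > 3 / 2" and D: "connected D" "0 \<notin> D" "\<And>s x. s > 0 \<Longrightarrow> x \<in> D \<Longrightarrow> s *\<^sub>R x \<in> D"
  shows "connected (LC_bdd c \<inter> D)"
proof -
  have "to_bdd c x \<in> D" if "x \<in> D" for x
  proof -
    have "quad_part c x + sqrt ((quad_part c x)\<^sup>2 - 4 * quart_part x) > 0"
      using discriminant_pos[OF c, of x] that D(2) by (cases "x = 0") (auto intro!: add_pos_nonneg)
    then show ?thesis unfolding to_bdd_def using that by (intro D(3)) auto
  qed
  then have "to_bdd c ` D = LC_bdd c \<inter> D"
  proof (intro equalityI subsetI)
    fix x assume "x \<in> to_bdd c ` D"
    then obtain y where "y \<in> D" "x = to_bdd c y" by blast
    moreover have "y \<noteq> 0" using \<open>y \<in> D\<close> D(2) by blast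
    ultimately show "x \<in> LC_bdd c \<inter> D" using to_bdd_in[OF c] \<open>\<And>x. x \<in> D \<Longrightarrow> to_bdd c x \<in> D\<close> by blast
  next
    fix x assume x: "x \<in> LC_bdd c \<inter> D"
    then show "x \<in> to_bdd c ` D" using to_bdd_id[of x c] by (metis IntE image_eqI)
  qed
  then show ?thesis
    using connected_continuous_image[OF continuous_on_to_bdd[OF c D(2)] D(1)] by simp
qed

lemma connected_LC_bdd:
  assumes "c > 3 / 2"
  shows "connected (LC_bdd c)"
proof -
  have "connected (- {0 :: complex \<times> complex})"
    by (rule connected_punctured_universe) simp
  then have "connected (LC_bdd c \<inter> - {0})" by (intro connected_LC_bdd_cone assms) auto
  moreover have "LC_bdd c \<inter> - {0} = LC_bdd c" using LC_bdd_nonzero by auto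
  ultimately show ?thesis by simp
qed

lemma connected_LC_bdd_noncollision:
  assumes "c > 3 / 2"
  shows "connected (LC_bdd c \<inter> {x. fst x \<noteq> 0})"
proof (rule connected_LC_bdd_cone)
  have "connected ((- {0 :: complex}) \<times> (UNIV :: complex set))"
    by (intro connected_Times connected_punctured_universe) auto
  moreover have "(- {0 :: complex}) \<times> (UNIV :: complex set) = {x. fst x \<noteq> 0}" by auto
  ultimately show "connected {x :: complex \<times> complex. fst x \<noteq> 0}" by simp
qed (use assms in auto)

text \<open>Shrinking \<open>w\<close> to \<open>0\<close> makes \<open>quart_part\<close> tend to \<open>0\<close> from above, and the larger solution of the quadratic
  equation on the ray then tends to infinity.\<close>
lemma unbounded_path:
  assumes c: "c > 3 / 2" and x: "x \<in> LC_level c" "quart_part x > 1"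
  shows "\<exists>C. connected C \<and> x \<in> C \<and> C \<subseteq> LC_level c \<inter> {x. fst x \<noteq> 0} \<and> (\<forall>M. \<exists>y\<in>C. (cmod (fst y))\<^sup>2 > M)"
proof -
  obtain z w where zw: "x = (z, w)" by force
  have z: "z \<noteq> 0" using x by (auto simp: zw quart_part_def)
  \<comment> \<open>The path of rays; \<open>r\<close> is the larger solution of the quadratic equation on the ray of \<open>X t\<close>.\<close>
  define X where "X = (\<lambda>t::real. (z, (1 - t) *\<^sub>R w))"
  define r where "r = (\<lambda>t. (quad_part c (X t) + sqrt ((quad_part c (X t))\<^sup>2 - 4 * quart_part (X t))) / (2 * quart_part (X t)))"
  define y where "y = (\<lambda>t. sqrt (r t) *\<^sub>R X t)"
  have X0: "X t \<noteq> 0" for t using z by (simp add: X_def zero_prod_def)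
  have qX: "quart_part (X t) = (1 - t) * quart_part x" for t by (simp add: X_def zw quart_part_def ang_mom_def algebra_simps)
  have qpos: "quart_part (X t) > 0" if "t \<in> {0..<1}" for t using that x by (simp add: qX)
  have rpos: "r t > 0" if "t \<in> {0..<1}" for t
    unfolding r_def using qpos[OF that] discriminant_pos[OF c X0[of t]]
    by (intro divide_pos_pos add_pos_nonneg) auto
  have "continuous_on {0..<1} y"
  proof -
    have X: "continuous_on {0..<1} X" unfolding X_def by (intro continuous_intros)
    have "2 * quart_part (X t) \<noteq> 0" if "t \<in> {0..<1}" for t using qpos[OF that] by simp
    then show ?thesis unfolding y_def r_def by (intro continuous_intros X) blast
  qed
  then have conn: "connected (y ` {0..<1})" by (intro connected_continuous_image) auto
  have lev: "y t \<in> LC_level c" "fst (y t) \<noteq> 0" if t: "t \<in> {0..<1}" for t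
  proof -
    define a b d where "a = quad_part c (X t)" and "b = quart_part (X t)" and "d = sqrt (a\<^sup>2 - 4 * b)"
    have ad: "a > 0" "d > 0" "d\<^sup>2 = a\<^sup>2 - 4 * b" "b > 0"
      using discriminant_pos[OF c X0[of t]] qpos[OF t] by (auto simp: a_def b_def d_def)
    have r: "2 * b * r t = a + d" using ad(4) by (simp add: r_def a_def b_def d_def)
    have "quad_part c (y t) = r t * a" "quart_part (y t) = (r t)\<^sup>2 * b"
      unfolding y_def quad_scale quart_scale using rpos[OF t]
      by (simp_all add: a_def b_def real_sqrt_pow2 power4_eq_xxxx power2_eq_square)
    moreover have "4 * b * (r t * a - (r t)\<^sup>2 * b) = 4 * b * 1"
    proof -
      have "4 * b * (r t * a - (r t)\<^sup>2 * b) = 2 * (2 * b * r t) * a - (2 * b * r t)\<^sup>2"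
        by (simp add: power2_eq_square algebra_simps)
      also have "\<dots> = a\<^sup>2 - d\<^sup>2" unfolding r by (simp add: power2_eq_square algebra_simps)
      finally show ?thesis using ad(3) by simp
    qed
    ultimately show "y t \<in> LC_level c" using ad(4) by (simp add: LC_level_def)
    show "fst (y t) \<noteq> 0" using rpos[OF t] z by (simp add: y_def X_def)
  qed
  have "y 0 = x"
  proof -
    have X: "X 0 = x" by (simp add: X_def zw)
    have "(quad_part c x)\<^sup>2 - 4 * quart_part x = (quart_part x - 1)\<^sup>2" and "quad_part c x = 1 + quart_part x"
      using x by (auto simp: LC_level_def power2_eq_square algebra_simps)
    then show ?thesis using x by (simp add: y_def r_def X)
  qed
  then have "x \<in> y ` {0..<1}" by force
  moreover have "\<exists>v\<in>y ` {0..<1}. (cmod (fst v))\<^sup>2 > M" for M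
  proof -
    define m where "m = c * (cmod z)\<^sup>2 / (2 * quart_part x) * (cmod z)\<^sup>2"
    have m: "m > 0" unfolding m_def using c x z by (auto intro!: mult_pos_pos divide_pos_pos)
    have low: "m / (1 - t) \<le> (cmod (fst (y t)))\<^sup>2" if t: "t \<in> {0..<1}" for t
    proof -
      have "c * (cmod z)\<^sup>2 / (2 * quart_part (X t)) \<le> r t"
        unfolding r_def using qpos[OF t] discriminant_pos[OF c X0[of t]]
        by (intro divide_right_mono add_increasing2) (auto simp: quad_part_def X_def)
      then have "c * (cmod z)\<^sup>2 / (2 * quart_part (X t)) * (cmod z)\<^sup>2 \<le> r t * (cmod z)\<^sup>2"
        by (intro mult_right_mono) auto
      then show ?thesis using rpos[OF t] by (simp add: y_def X_def m_def qX[unfolded X_def] power_mult_distrib mult_ac)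
    qed
    \<comment> \<open>Chosen such that \<open>m / (1 - t) = m + \<bar>M\<bar> + 1\<close>.\<close>
    define t where "t = 1 - m / (m + \<bar>M\<bar> + 1)"
    have t: "t \<in> {0..<1}" using m by (auto simp: t_def field_simps)
    have "M < m / (1 - t)" using m by (simp add: t_def)
    then show ?thesis using less_le_trans[OF _ low[OF t]] t by blast
  qed
  moreover have "y ` {0..<1} \<subseteq> LC_level c \<inter> {x. fst x \<noteq> 0}" using lev by blast
  ultimately show ?thesis using conn by blast
qed

lemma bounded_below_norm_contradiction:
  assumes "\<forall>M. \<exists>y\<in>C. g y > (M::real)" "\<And>y. y \<in> C \<Longrightarrow> g y \<le> k * norm (f y)" "k > 0"
  shows "\<not> bounded (f ` C)"
proof
  assume "bounded (f ` C)"
  then obtain B where B: "\<And>y. y \<in> C \<Longrightarrow> norm (f y) \<le> B" by (auto simp: bounded_iff)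
  obtain y where y: "y \<in> C" "g y > k * B" using assms(1) by blast
  have "k * norm (f y) \<le> k * B" using B[OF y(1)] assms(3) by (intro mult_left_mono) auto
  then show False using assms(2)[OF y(1)] y(2) by linarith
qed

lemma energy_level_levi_civita: "energy_level c = levi_civita ` (LC_level c \<inter> {x. fst x \<noteq> 0})"
proof (intro equalityI subsetI)
  fix y assume "y \<in> energy_level c"
  then obtain q p where y: "y = (q, p)" "q \<noteq> 0" "H_R (q, p) = - c" by (auto simp: energy_level_def)
  then obtain z w where zw: "z \<noteq> 0" "levi_civita (z, w) = (q, p)" using levi_civita_surj by blast
  then have "(z, w) \<in> LC_level c" using H_R_levi_civita y by metis
  then show "y \<in> levi_civita ` (LC_level c \<inter> {x. fst x \<noteq> 0})" using y zw by (metis (mono_tags) IntI fst_conv image_eqI mem_Collect_eq)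
next
  fix y assume "y \<in> levi_civita ` (LC_level c \<inter> {x. fst x \<noteq> 0})"
  then obtain z w where zw: "y = levi_civita (z, w)" "z \<noteq> 0" "(z, w) \<in> LC_level c" by auto
  then have "H_R y = - c" using H_R_levi_civita by metis
  moreover have "fst y \<noteq> 0" using levi_civita_norms(1)[OF zw(2), of w] zw by auto
  ultimately show "y \<in> energy_level c" by (cases y) (auto simp: energy_level_def)
qed

lemma LC_level_bounded_part:
  assumes "c > 3 / 2" "x \<in> LC_bdd c"
  shows "(cmod (fst x))\<^sup>2 \<le> 2" "(cmod (snd x))\<^sup>2 \<le> 4"
proof -
  have x: "quad_part c x < 2" using assms by (simp add: LC_bdd_def)
  have "c * (cmod (fst x))\<^sup>2 \<ge> 3 / 2 * (cmod (fst x))\<^sup>2" using assms by (intro mult_right_mono) auto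
  moreover have "(cmod (fst x))\<^sup>2 \<ge> 0" "(cmod (snd x))\<^sup>2 \<ge> 0" by auto
  ultimately show "(cmod (fst x))\<^sup>2 \<le> 2" "(cmod (snd x))\<^sup>2 \<le> 4"
    using x unfolding quad_part_def case_prod_beta by linarith+
qed

lemma LC_bdd_witness: "(0, of_real (sqrt 2)) \<in> LC_bdd c"
  by (simp add: LC_bdd_def quad_part_def quart_part_def)

lemma LC_bdd_noncollision_witness:
  assumes "c > 3 / 2"
  shows "(of_real (1 / sqrt c), 0) \<in> LC_bdd c \<inter> {x. fst x \<noteq> 0}"
  using assms by (simp add: LC_bdd_def quad_part_def quart_part_def ang_mom_def norm_divide power_divide)

text \<open>The negative of the angular momentum of the Kepler motion; it generates the rotation of the frame.\<close>
definition spin :: "(real^3) \<times> (real^3) \<Rightarrow> real" where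
  "spin = (\<lambda>(\<xi>, \<eta>). \<xi>$2 * \<eta>$1 - \<xi>$1 * \<eta>$2)"

text \<open>The distance \<open>norm q\<close> from the centre of attraction, as a function on \<open>T\<^sup>*S\<^sup>2\<close>.\<close>
definition rad :: "(real^3) \<times> (real^3) \<Rightarrow> real" where
  "rad = (\<lambda>(\<xi>, \<eta>). norm \<eta> * (1 - \<xi>$3))"

text \<open>The regularised Hamiltonian \<open>norm q * (H_R + c) + 1\<close> in the coordinates of \<open>T\<^sup>*S\<^sup>2\<close>.\<close>
definition reg_ham :: "real \<Rightarrow> (real^3) \<times> (real^3) \<Rightarrow> real" where
  "reg_ham c = (\<lambda>(\<xi>, \<eta>). norm \<eta> * (1 + (1 - \<xi>$3) * (c - 1 / 2 + spin (\<xi>, \<eta>))))"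

lemma LC_cover_pullbacks:
  assumes "x \<noteq> 0"
  shows "spin (LC_cover x) = - ang_mom x" "rad (LC_cover x) = (cmod (fst x))\<^sup>2" "reg_ham c (LC_cover x) = quad_part c x - quart_part x"
    "rad (LC_cover x) * spin (LC_cover x) = - quart_part x"
proof -
  obtain z w where x: "x = (z, w)" by force
  obtain \<xi> \<eta> where L: "LC_cover (z, w) = (\<xi>, \<eta>)" by force
  have nz: "(z, w) \<noteq> 0" using assms x by simp
  note A = LC_cover_components[OF nz L]
  show 1: "spin (LC_cover x) = - ang_mom x" using ang_from_LC_cover[OF nz L] by (simp add: x L spin_def)
  show 2: "rad (LC_cover x) = (cmod (fst x))\<^sup>2" using A(4) by (simp add: x L rad_def)
  show "rad (LC_cover x) * spin (LC_cover x) = - quart_part x" by (simp only: 1 2) (simp add: x quart_part_def)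
  have "reg_ham c (LC_cover x) = norm \<eta> * (1 + \<xi>$3) / 2 + norm \<eta> * (1 - \<xi>$3) * (c + spin (LC_cover x))"
    by (simp add: x L reg_ham_def field_simps)
  also have "\<dots> = quad_part c x - quart_part x"
    unfolding 1 A(3,4)[symmetric] by (simp add: x quad_part_def quart_part_def algebra_simps)
  finally show "reg_ham c (LC_cover x) = quad_part c x - quart_part x" .
qed

lemma LC_cover_LC_level: "LC_cover ` LC_level c = {\<zeta> \<in> cotangent_sphere. reg_ham c \<zeta> = 1}"
proof (intro equalityI subsetI)
  fix y assume "y \<in> LC_cover ` LC_level c"
  then obtain x where x: "y = LC_cover x" "x \<in> LC_level c" by blast
  then have "x \<noteq> 0" by (simp add: LC_level_nonzero)
  then show "y \<in> {\<zeta> \<in> cotangent_sphere. reg_ham c \<zeta> = 1}"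
    using x LC_cover_pullbacks(3)[of x c] LC_cover_in_cotangent_sphere[of x] by (simp add: LC_level_def)
next
  fix y assume y: "y \<in> {\<zeta> \<in> cotangent_sphere. reg_ham c \<zeta> = 1}"
  obtain \<xi> \<eta> where xe: "y = (\<xi>, \<eta>)" by force
  have "\<eta> \<noteq> 0" using y by (auto simp: xe reg_ham_def)
  then obtain z w where zw: "(z, w) \<noteq> 0" "LC_cover (z, w) = y" using LC_cover_surj[of \<xi> \<eta>] y xe by auto
  then have "(z, w) \<in> LC_level c" using y LC_cover_pullbacks(3)[of "(z, w)" c] by (simp add: LC_level_def)
  then show "y \<in> LC_cover ` LC_level c" using zw by blast
qed

lemma LC_cover_LC_bdd:
  "LC_cover ` LC_bdd c = {\<zeta> \<in> LC_cover ` LC_level c. - (rad \<zeta> * spin \<zeta>) < 1}"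
proof (intro equalityI subsetI)
  fix y assume "y \<in> LC_cover ` LC_bdd c"
  then obtain x where x: "y = LC_cover x" "x \<in> LC_bdd c" by blast
  then show "y \<in> {\<zeta> \<in> LC_cover ` LC_level c. - (rad \<zeta> * spin \<zeta>) < 1}"
    using LC_cover_pullbacks(4)[of x] LC_bdd_nonzero[of x c] LC_bdd_subset by (auto simp: LC_bdd_def)
next
  fix y assume "y \<in> {\<zeta> \<in> LC_cover ` LC_level c. - (rad \<zeta> * spin \<zeta>) < 1}"
  then obtain x where x: "y = LC_cover x" "x \<in> LC_level c" "- (rad y * spin y) < 1" by blast
  then have "x \<in> LC_bdd c"
    using LC_cover_pullbacks(4)[of x] LC_level_nonzero[of x c] by (auto simp: LC_bdd_def LC_level_def)
  then show "y \<in> LC_cover ` LC_bdd c" using x by blast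
qed

lemma closed_cotangent_sphere: "closed cotangent_sphere"
proof -
  have "closed {x :: (real^3) \<times> (real^3). norm (fst x) = 1 \<and> fst x \<bullet> snd x = 0}"
    by (intro closed_Collect_conj closed_Collect_eq continuous_intros)
  moreover have "cotangent_sphere = {x. norm (fst x) = 1 \<and> fst x \<bullet> snd x = 0}"
    by (auto simp: cotangent_sphere_def)
  ultimately show ?thesis by simp
qed

lemma continuous_on_reg_ham: "continuous_on S (reg_ham c)"
  unfolding reg_ham_def spin_def case_prod_beta fst_conv snd_conv by (intro continuous_intros)

lemma continuous_on_rad_spin: "continuous_on S (\<lambda>\<zeta>. - (rad \<zeta> * spin \<zeta>))"
  unfolding rad_def spin_def case_prod_beta by (intro continuous_intros)

lemma closed_LC_cover_LC_level: "closed (LC_cover ` LC_level c)"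
  unfolding LC_cover_LC_level
  using continuous_closed_preimage_constant[OF continuous_on_reg_ham closed_cotangent_sphere] by simp

text \<open>A collision point \<open>(0, w)\<close> is the limit of \<open>(h w, w)\<close>, rescaled to the level, for \<open>h\<close> to \<open>0\<close>. The angular
  momentum of these points vanishes, so that the scaling factor is explicit.\<close>
lemma closure_noncollision:
  assumes c: "c > 3 / 2"
  shows "closure (LC_cover ` (LC_level c \<inter> {x. fst x \<noteq> 0})) = LC_cover ` LC_level c" (is "closure ?S = _")
proof
  show "closure ?S \<subseteq> LC_cover ` LC_level c"
    by (intro closure_minimal closed_LC_cover_LC_level) auto
  show "LC_cover ` LC_level c \<subseteq> closure ?S"
  proof (intro image_subsetI)
    fix x assume x: "x \<in> LC_level c"
    obtain z w where zw: "x = (z, w)" by force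
    show "LC_cover x \<in> closure ?S"
    proof (cases "z = 0")
      case False
      then show ?thesis using x zw closure_subset by fastforce
    next
      case True
      have w: "(cmod w)\<^sup>2 = 2" using x by (simp add: zw True LC_level_def quad_part_def quart_part_def)
      define X where "X = (\<lambda>h::real. (1 / sqrt (1 + 2 * c * h\<^sup>2)) *\<^sub>R (h *\<^sub>R w, w))"
      have pos: "1 + 2 * c * h\<^sup>2 > 0" for h :: real using c by (simp add: add_pos_nonneg)
      have "w \<noteq> 0" using w by auto
      have nz: "X h \<noteq> 0" for h using pos[of h] \<open>w \<noteq> 0\<close> by (simp add: X_def zero_prod_def)
      have lev: "X h \<in> LC_level c" for h
      proof -
        have "quart_part (h *\<^sub>R w, w) = 0" by (simp add: quart_part_def ang_mom_def)
        moreover have "quad_part c (h *\<^sub>R w, w) = 1 + 2 * c * h\<^sup>2"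
          using w by (simp add: quad_part_def power_mult_distrib)
        ultimately show ?thesis
          using pos[of h] by (simp add: LC_level_def X_def quad_scale quart_scale power_divide real_sqrt_pow2 del: scaleR_Pair)
      qed
      have "continuous_on {0..1} (\<lambda>h. LC_cover (X h))"
      proof (rule continuous_on_LC_cover)
        have "sqrt (1 + 2 * c * h\<^sup>2) \<noteq> 0" for h using pos[of h] by simp
        then show "continuous_on {0..1} X" unfolding X_def by (intro continuous_intros) auto
      qed (use nz in auto)
      moreover have "(\<lambda>h. LC_cover (X h)) ` {0<..<1} \<subseteq> closure ?S"
      proof (intro image_subsetI)
        fix h :: real assume "h \<in> {0<..<1}"
        then have "fst (X h) \<noteq> 0" using \<open>w \<noteq> 0\<close> pos[of h] by (simp add: X_def)
        then have "LC_cover (X h) \<in> ?S" using lev[of h] by simp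
        then show "LC_cover (X h) \<in> closure ?S" by (rule subsetD[OF closure_subset])
      qed
      ultimately have "(\<lambda>h. LC_cover (X h)) ` closure {0<..<1} \<subseteq> closure ?S"
        by (intro image_closure_subset) auto
      then have "LC_cover (X 0) \<in> closure ?S" by auto
      moreover have "X 0 = x" by (simp add: X_def zw True)
      ultimately show ?thesis by simp
    qed
  qed
qed

lemma compact_LC_bdd:
  assumes c: "c > 3 / 2"
  shows "compact (LC_bdd c)"
proof -
  have "LC_bdd c = {x. quad_part c x - quart_part x = 1} \<inter> {x. quart_part x \<le> 1}"
    using quart_neq_1[OF c] by (force simp: LC_bdd_def LC_level_def)
  then have "closed (LC_bdd c)"
    by (auto intro!: closed_Int closed_Collect_eq closed_Collect_le continuous_intros)
  moreover have "bounded (LC_bdd c)"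
  proof (rule bounded_subset)
    show "LC_bdd c \<subseteq> cball 0 2 \<times> cball 0 2"
    proof
      fix x assume "x \<in> LC_bdd c"
      then have "(cmod (fst x))\<^sup>2 \<le> 2\<^sup>2" "(cmod (snd x))\<^sup>2 \<le> 2\<^sup>2"
        using LC_level_bounded_part[OF c, of x] by simp_all
      then have "cmod (fst x) \<le> 2" "cmod (snd x) \<le> 2" by (auto intro: power2_le_imp_le)
      then show "x \<in> cball 0 2 \<times> cball 0 2" by (cases x) simp
    qed
    show "bounded (cball (0::complex) 2 \<times> cball (0::complex) 2)" by (intro bounded_Times) auto
  qed
  ultimately show ?thesis by (simp add: compact_eq_bounded_closed)
qed

lemma Sigma_R_eq:
  assumes c: "c > 3 / 2"
  shows "Sigma_R c = LC_cover ` LC_bdd c"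
proof -
  have "(Phi \<circ> Psi) ` energy_level c = LC_cover ` (LC_level c \<inter> {x. fst x \<noteq> 0})"
    unfolding energy_level_levi_civita image_image o_def using Phi_Psi_levi_civita by (intro image_cong) auto
  then have cl: "closure ((Phi \<circ> Psi) ` energy_level c) = LC_cover ` LC_level c"
    using closure_noncollision[OF c] by simp
  have comp: "compact (LC_cover ` LC_bdd c)"
    by (intro compact_continuous_image compact_LC_bdd c continuous_on_LC_cover continuous_intros)
      (auto simp: LC_bdd_nonzero)
  show ?thesis
    unfolding Sigma_R_def cl LC_cover_LC_bdd
  proof (rule the_component_below)
    show "connected {x \<in> LC_cover ` LC_level c. - (rad x * spin x) < 1}"
      unfolding LC_cover_LC_bdd[symmetric]
      by (intro connected_continuous_image connected_LC_bdd c continuous_on_LC_cover continuous_intros)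
        (auto simp: LC_bdd_nonzero)
    show "{x \<in> LC_cover ` LC_level c. - (rad x * spin x) < 1} \<noteq> {}"
      unfolding LC_cover_LC_bdd[symmetric] using LC_bdd_witness by blast
    show "bounded {x \<in> LC_cover ` LC_level c. - (rad x * spin x) < 1}"
      unfolding LC_cover_LC_bdd[symmetric] using comp by (rule compact_imp_bounded)
    show "continuous_on (LC_cover ` LC_level c) (\<lambda>x. - (rad x * spin x))" by (rule continuous_on_rad_spin)
  next
    fix y assume "y \<in> LC_cover ` LC_level c"
    then show "- (rad y * spin y) \<noteq> 1"
      using LC_cover_pullbacks(4) LC_level_nonzero quart_neq_1[OF c] by fastforce
  next
    fix y assume y: "y \<in> LC_cover ` LC_level c" "- (rad y * spin y) > 1"
    then obtain x where x: "y = LC_cover x" "x \<in> LC_level c" by blast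
    then have "quart_part x > 1" using y(2) LC_cover_pullbacks(4)[of x] LC_level_nonzero[of x c] by simp
    then obtain C where C: "connected C" "x \<in> C" "C \<subseteq> LC_level c \<inter> {x. fst x \<noteq> 0}"
      "\<forall>M. \<exists>y\<in>C. (cmod (fst y))\<^sup>2 > M" using unbounded_path[OF c x(2)] by blast
    have nz: "u \<noteq> 0" if "u \<in> C" for u using C(3) that LC_level_nonzero by blast
    have "\<not> bounded (LC_cover ` C)"
    proof (rule bounded_below_norm_contradiction[OF C(4), where k = 2])
      fix u assume "u \<in> C"
      have "(cmod (fst u))\<^sup>2 \<le> 2 * norm (snd (LC_cover u))"
        by (cases u) (simp add: norm_snd_LC_cover)
      also have "\<dots> \<le> 2 * norm (LC_cover u)" using norm_snd_le[where x = "fst (LC_cover u)" and y = "snd (LC_cover u)"] by simp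
      finally show "(cmod (fst u))\<^sup>2 \<le> 2 * norm (LC_cover u)" .
    qed simp
    moreover have "connected (LC_cover ` C)"
      by (intro connected_continuous_image C continuous_on_LC_cover continuous_intros) (auto simp: nz)
    ultimately show "\<exists>C. connected C \<and> y \<in> C \<and> C \<subseteq> LC_cover ` LC_level c \<and> \<not> bounded C"
      using C x by (intro exI[of _ "LC_cover ` C"]) blast
  next
    fix C D :: "((real^3) \<times> (real^3)) set" assume "bounded C" "D \<subseteq> C"
    then show "bounded D" by (rule bounded_subset)
  qed
qed

lemma compact_Sigma_R:
  assumes c: "c > 3 / 2"
  shows "compact (Sigma_R c)"
  unfolding Sigma_R_eq[OF c]
  by (intro compact_continuous_image compact_LC_bdd c continuous_on_LC_cover continuous_intros)
      (auto simp: LC_bdd_nonzero)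

text \<open>The last condition says that the Liouville form is positive on the Hamiltonian vector field, which is
  what singles out the bounded component.\<close>
lemma Sigma_R_iff:
  assumes c: "c > 3 / 2"
  shows "\<zeta> \<in> Sigma_R c \<longleftrightarrow> \<zeta> \<in> cotangent_sphere \<and> reg_ham c \<zeta> = 1 \<and> 1 + rad \<zeta> * spin \<zeta> > 0"
  unfolding Sigma_R_eq[OF c] LC_cover_LC_bdd LC_cover_LC_level by auto

lemma bounded_level_iff:
  assumes c: "c > 3 / 2"
  shows "(q, p) \<in> bounded_level c \<longleftrightarrow>
    q \<noteq> 0 \<and> H_R (q, p) = - c \<and> norm q * (q$1 * p$2 - q$2 * p$1) < 1"
proof -
  define F :: "(real^2) \<times> (real^2) \<Rightarrow> real" where "F = (\<lambda>(q, p). norm q * (q$1 * p$2 - q$2 * p$1))"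
  have F: "F (levi_civita x) = quart_part x" if "fst x \<noteq> 0" for x
  proof -
    obtain q p where L: "levi_civita (fst x, snd x) = (q, p)" by force
    show ?thesis using levi_civita_ang[OF that L] levi_civita_norms(1)[OF that, of "snd x"] L
      by (cases x) (simp add: F_def quart_part_def)
  qed
  have A: "{y \<in> energy_level c. F y < 1} = levi_civita ` (LC_bdd c \<inter> {x. fst x \<noteq> 0})"
    unfolding energy_level_levi_civita using F by (auto simp: LC_bdd_def LC_level_def)
  have "bounded_level c = {y \<in> energy_level c. F y < 1}"
    unfolding bounded_level_def
  proof (rule the_component_below)
    show "connected {y \<in> energy_level c. F y < 1}" unfolding A
      by (intro connected_continuous_image connected_LC_bdd_noncollision c continuous_on_levi_civita continuous_intros) auto
    show "{y \<in> energy_level c. F y < 1} \<noteq> {}"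
      unfolding A using LC_bdd_noncollision_witness[OF c] by blast
    have "norm (fst (levi_civita x)) \<le> 2" if "x \<in> LC_bdd c \<inter> {x. fst x \<noteq> 0}" for x
      using that levi_civita_norms(1)[of "fst x" "snd x"] LC_level_bounded_part(1)[OF c, of x] by simp
    then show "bounded (fst ` {y \<in> energy_level c. F y < 1})"
      unfolding A bounded_iff by (intro exI[of _ 2]) auto
    show "continuous_on (energy_level c) F" unfolding F_def case_prod_beta by (intro continuous_intros)
  next
    fix y assume "y \<in> energy_level c"
    then show "F y \<noteq> 1" unfolding energy_level_levi_civita using F quart_neq_1[OF c] by force
  next
    fix y assume y: "y \<in> energy_level c" "F y > 1"
    then obtain x where x: "y = levi_civita x" "x \<in> LC_level c" "fst x \<noteq> 0" unfolding energy_level_levi_civita by blast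
    then have "quart_part x > 1" using y(2) F[of x] by simp
    then obtain C where C: "connected C" "x \<in> C" "C \<subseteq> LC_level c \<inter> {x. fst x \<noteq> 0}"
      "\<forall>M. \<exists>y\<in>C. (cmod (fst y))\<^sup>2 > M" using unbounded_path[OF c x(2)] by blast
    have "\<not> bounded ((\<lambda>u. fst (levi_civita u)) ` C)"
    proof (rule bounded_below_norm_contradiction[OF C(4), where k = 1])
      fix u assume "u \<in> C"
      then show "(cmod (fst u))\<^sup>2 \<le> 1 * norm (fst (levi_civita u))"
        using levi_civita_norms(1)[of "fst u" "snd u"] C(3) by auto
    qed simp
    moreover have "connected (levi_civita ` C)"
      by (intro connected_continuous_image C continuous_on_levi_civita continuous_intros) (use C(3) in auto)
    ultimately show "\<exists>C. connected C \<and> y \<in> C \<and> C \<subseteq> energy_level c \<and> \<not> bounded (fst ` C)"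
      using C x unfolding energy_level_levi_civita by (intro exI[of _ "levi_civita ` C"]) (auto simp: image_image)
  next
    fix C D :: "((real^2) \<times> (real^2)) set" assume "bounded (fst ` C)" "D \<subseteq> C"
    then show "bounded (fst ` D)" by (meson bounded_subset image_mono)
  qed
  then show ?thesis by (auto simp: F_def energy_level_def)
qed

section \<open>Circular orbits\<close>

definition rkp_field :: "(real^2) \<times> (real^2) \<Rightarrow> (real^2) \<times> (real^2)" where
  "rkp_field = (\<lambda>(q, p). (p + vector [q$2, - q$1], - (1 / norm q ^ 3) *\<^sub>R q + vector [p$2, - p$1]))"

lemma has_derivative_nth: "((\<lambda>x. f x $ i) has_derivative (\<lambda>v. f' v $ i)) F"
  if "(f has_derivative f') F" for f :: "_ \<Rightarrow> real^'n"
  using bounded_linear.has_derivative[OF bounded_linear_vec_nth that] .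

lemma has_real_derivative_nth: "((\<lambda>x. f x $ i) has_real_derivative f' $ i) F"
  if "(f has_vector_derivative f') F" for f :: "real \<Rightarrow> real^'n"
  using bounded_linear.has_vector_derivative[OF bounded_linear_vec_nth that, of i]
  by (simp add: has_real_derivative_iff_has_vector_derivative)

lemma has_derivative_H_R:
  assumes "q \<noteq> 0"
  shows "(H_R has_derivative (\<lambda>(a, b). p \<bullet> b + (q \<bullet> a) / norm q ^ 3
     + (b$1 * q$2 + p$1 * a$2 - b$2 * q$1 - p$2 * a$1))) (at (q, p))"
proof -
  have eq: "H_R = (\<lambda>x. (snd x \<bullet> snd x) / 2 - inverse (norm (fst x)) + snd x $ 1 * fst x $ 2 - snd x $ 2 * fst x $ 1)"
    by (rule ext) (simp add: H_R_def case_prod_beta power2_norm_eq_inner inverse_eq_divide)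
  have n3: "norm q ^ 3 = norm q * (norm q * norm q)" by (simp add: power3_eq_cube mult.assoc)
  show ?thesis
  proof -
    have f: "(fst has_derivative fst) (at (q, p))" and g: "(snd has_derivative snd) (at (q, p))"
      by (auto intro: bounded_linear_imp_has_derivative bounded_linear_fst bounded_linear_snd)
    have n: "((\<lambda>x. norm (fst x)) has_derivative (\<lambda>x. sgn q \<bullet> fst x)) (at (q, p))"
      using has_derivative_compose[OF f, of norm "\<lambda>h. h \<bullet> sgn q"] has_derivative_norm[OF assms]
      by (simp add: inner_commute)
    have i: "((\<lambda>x. inverse (norm (fst x))) has_derivative
        (\<lambda>x. - (inverse (norm q) * (sgn q \<bullet> fst x) * inverse (norm q)))) (at (q, p))"
      using Deriv.has_derivative_inverse[OF _ n] assms by simp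
    have k: "((\<lambda>x. snd x \<bullet> snd x / 2) has_derivative (\<lambda>x. p \<bullet> snd x)) (at (q, p))"
      using has_derivative_divide'[OF has_derivative_inner[OF g g] has_derivative_const[of 2]]
      by (simp add: inner_commute)
    have m: "((\<lambda>x. snd x $ i * fst x $ j) has_derivative (\<lambda>x. p $ i * fst x $ j + snd x $ i * q $ j)) (at (q, p))" for i j
      using has_derivative_mult[OF has_derivative_nth[OF g, of i] has_derivative_nth[OF f, of j]] by simp
    show ?thesis
      unfolding eq
      by (rule has_derivative_eq_rhs[OF has_derivative_diff[OF has_derivative_add[OF has_derivative_diff[OF k i] m] m]])
         (use assms in \<open>auto simp: fun_eq_iff sgn_div_norm n3 field_simps\<close>)
  qed
qed

lemma ham_field_H_R:
  assumes "q \<noteq> 0"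
  shows "ham_field H_R (q, p) = rkp_field (q, p)"
proof -
  have fd: "frechet_derivative H_R (at (q, p)) = (\<lambda>(a, b). p \<bullet> b + (q \<bullet> a) / norm q ^ 3
     + (b$1 * q$2 + p$1 * a$2 - b$2 * q$1 - p$2 * a$1))"
    using frechet_derivative_at[OF has_derivative_H_R[OF assms]] by simp
  show ?thesis
    unfolding ham_field_def fd
  proof (rule the_equality)
    show *: "\<forall>W. dp_dq (rkp_field (q, p)) W = - (case W of (a, b) \<Rightarrow> p \<bullet> b + (q \<bullet> a) / norm q ^ 3
     + (b$1 * q$2 + p$1 * a$2 - b$2 * q$1 - p$2 * a$1))"
      by (auto simp: dp_dq_def rkp_field_def inner_real2 algebra_simps add_divide_distrib)
    fix X assume X: "\<forall>W. dp_dq X W = - (case W of (a, b) \<Rightarrow> p \<bullet> b + (q \<bullet> a) / norm q ^ 3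
     + (b$1 * q$2 + p$1 * a$2 - b$2 * q$1 - p$2 * a$1))"
    then have "dp_dq X W = dp_dq (rkp_field (q, p)) W" for W
      using * by presburger
    moreover have "dp_dq (X - Y) W = dp_dq X W - dp_dq Y W" for Y W :: "(real^2) \<times> (real^2)"
      by (simp add: dp_dq_def case_prod_beta inner_diff_left inner_diff_right)
    ultimately have "dp_dq (X - rkp_field (q, p)) W = 0" for W by simp
    moreover define D where "D = X - rkp_field (q, p)"
    ultimately have "dp_dq D (snd D, - fst D) = 0" by simp
    then have "snd D \<bullet> snd D + fst D \<bullet> fst D = 0" by (simp add: dp_dq_def case_prod_beta)
    then have "snd D = 0 \<and> fst D = 0" by (metis add_nonneg_eq_0_iff inner_eq_zero_iff inner_ge_zero)
    then show "X = rkp_field (q, p)" by (simp add: prod_eq_iff D_def)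
  qed
qed

lemma rkp_derivatives:
  assumes c: "c > 3 / 2" and \<gamma>: "integral_curve_on (ham_field H_R) (bounded_level c) \<gamma>"
  defines "q1 \<equiv> \<lambda>t. fst (\<gamma> t) $ 1" and "q2 \<equiv> \<lambda>t. fst (\<gamma> t) $ 2"
    and "p1 \<equiv> \<lambda>t. snd (\<gamma> t) $ 1" and "p2 \<equiv> \<lambda>t. snd (\<gamma> t) $ 2"
  shows "(q1 has_real_derivative p1 t + q2 t) (at t)" "(q2 has_real_derivative p2 t - q1 t) (at t)"
    "(p1 has_real_derivative - q1 t / norm (fst (\<gamma> t)) ^ 3 + p2 t) (at t)"
    "(p2 has_real_derivative - q2 t / norm (fst (\<gamma> t)) ^ 3 - p1 t) (at t)"
    "fst (\<gamma> t) \<noteq> 0"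
    "(\<gamma> has_vector_derivative rkp_field (\<gamma> t)) (at t)"
proof -
  have "\<gamma> t \<in> bounded_level c" using \<gamma> by (simp add: integral_curve_on_def)
  then show nz: "fst (\<gamma> t) \<noteq> 0" using bounded_level_iff[OF c, of "fst (\<gamma> t)" "snd (\<gamma> t)"] by simp
  then have "ham_field H_R (\<gamma> t) = rkp_field (\<gamma> t)" using ham_field_H_R[of "fst (\<gamma> t)" "snd (\<gamma> t)"] by simp
  then show d: "(\<gamma> has_vector_derivative rkp_field (\<gamma> t)) (at t)"
    using \<gamma> unfolding integral_curve_on_def by metis
  have 1: "((\<lambda>t. fst (\<gamma> t)) has_vector_derivative fst (rkp_field (\<gamma> t))) (at t)"
    using bounded_linear.has_vector_derivative[OF bounded_linear_fst d] .
  have 2: "((\<lambda>t. snd (\<gamma> t)) has_vector_derivative snd (rkp_field (\<gamma> t))) (at t)"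
    using bounded_linear.has_vector_derivative[OF bounded_linear_snd d] .
  show "(q1 has_real_derivative p1 t + q2 t) (at t)" "(q2 has_real_derivative p2 t - q1 t) (at t)"
    using has_real_derivative_nth[OF 1, of 1] has_real_derivative_nth[OF 1, of 2]
    by (simp_all add: q1_def q2_def p1_def p2_def rkp_field_def case_prod_beta)
  show "(p1 has_real_derivative - q1 t / norm (fst (\<gamma> t)) ^ 3 + p2 t) (at t)"
    "(p2 has_real_derivative - q2 t / norm (fst (\<gamma> t)) ^ 3 - p1 t) (at t)"
    unfolding q1_def q2_def p1_def p2_def
    by (rule DERIV_cong[OF has_real_derivative_nth[OF 2]], simp add: rkp_field_def case_prod_beta)+
qed

lemma turning_kepler_motion:
  assumes c: "c > 3 / 2" and \<gamma>: "integral_curve_on (ham_field H_R) (bounded_level c) \<gamma>"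
  shows "turning (kepler_motion \<gamma>) t = fst (\<gamma> t) $ 1 * snd (\<gamma> t) $ 2 - fst (\<gamma> t) $ 2 * snd (\<gamma> t) $ 1"
proof -
  note d = rkp_derivatives[OF c \<gamma>, of t]
  have "(kepler_motion \<gamma> has_vector_derivative rot t (snd (\<gamma> t))) (at t)"
    unfolding kepler_motion_def[abs_def] rot_def
    by (rule has_vector_derivative_vector2)
       (rule derivative_eq_intros d refl | simp add: algebra_simps)+
  then have "vector_derivative (kepler_motion \<gamma>) (at t) = rot t (snd (\<gamma> t))"
    by (rule vector_derivative_at)
  moreover have "(C * a - S * b) * (S * x + C * y) - (S * a + C * b) * (C * x - S * y) = (S\<^sup>2 + C\<^sup>2) * (a * y - b * x)"
    for C S a b x y :: real by (simp add: power2_eq_square algebra_simps)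
  ultimately show ?thesis by (simp add: turning_def kepler_motion_def rot_def)
qed

text \<open>The Liouville form pulls back to \<open>- q dp\<close>, because \<open>Phi\<close> is a cotangent lift and \<open>Psi (q, p) = (p, - q)\<close>.\<close>
lemma lambda_can_along:
  assumes q: "(q has_vector_derivative q') (at t)" and p: "(p has_vector_derivative p') (at t)"
  shows "lambda_can ((Phi \<circ> Psi \<circ> (\<lambda>t. (q t, p t))) t)
     (vector_derivative (Phi \<circ> Psi \<circ> (\<lambda>t. (q t, p t))) (at t)) = - (q t \<bullet> p')"
proof -
  have eq: "Phi \<circ> Psi \<circ> (\<lambda>t. (q t, p t)) = (\<lambda>t. (inv_stereo (p t), stereo_colift (p t) (- q t)))"
    by (auto simp: Psi_def Phi_eq)
  have "((\<lambda>t. inv_stereo (p t)) has_derivative (\<lambda>h. d_inv_stereo (p t) (h *\<^sub>R p'))) (at t)"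
    using has_derivative_compose[OF p[unfolded has_vector_derivative_def] has_derivative_inv_stereo] .
  moreover have "linear (d_inv_stereo (p t))"
    using has_derivative_linear[OF has_derivative_inv_stereo] .
  ultimately have 1: "((\<lambda>t. inv_stereo (p t)) has_vector_derivative d_inv_stereo (p t) p') (at t)"
    by (simp add: has_vector_derivative_def linear_scale)
  have 2: "((\<lambda>t. stereo_colift (p t) (- q t)) has_vector_derivative stereo_colift' ) (at t)"
    if "stereo_colift' = vector_derivative (\<lambda>t. stereo_colift (p t) (- q t)) (at t)" for stereo_colift'
  proof -
    have pd: "p differentiable at t" "q differentiable at t"
      using p q by (auto intro: differentiableI_vector)
    have nth: "(\<lambda>t. f t $ i) differentiable at t" if "f differentiable at t" for f :: "real \<Rightarrow> real^2" and i
      using that has_derivative_nth unfolding differentiable_def by blast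
    have "(\<lambda>t. stereo_colift (p t) (- q t)) differentiable at t"
      unfolding stereo_colift_def vector3_axis power2_norm_eq_inner inner_real2
      by (intro derivative_intros differentiable_scaleR differentiable_mult differentiable_add differentiable_diff
            differentiable_const differentiable_divide nth pd differentiable_minus) auto
    then show ?thesis unfolding that by (rule vector_derivative_works[THEN iffD1])
  qed
  have "((\<lambda>t. (inv_stereo (p t), stereo_colift (p t) (- q t))) has_vector_derivative
    (d_inv_stereo (p t) p', vector_derivative (\<lambda>t. stereo_colift (p t) (- q t)) (at t))) (at t)"
    by (intro has_vector_derivative_Pair 1 2 refl)
  then have vd: "vector_derivative (\<lambda>t. (inv_stereo (p t), stereo_colift (p t) (- q t))) (at t) =
     (d_inv_stereo (p t) p', vector_derivative (\<lambda>t. stereo_colift (p t) (- q t)) (at t))"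
    by (rule vector_derivative_at)
  show ?thesis unfolding eq vd by (simp add: lambda_can_def stereo_colift_inner)
qed


lemma cos_eq_1_ge_2pi:
  fixes x :: real
  assumes "x > 0" "cos x = 1"
  shows "2 * pi \<le> x"
proof -
  obtain n :: nat where n: "x = real n * 2 * pi \<or> x = - (real n * 2 * pi)"
    using assms(2) unfolding cos_one_2pi by blast
  have "- (real n * 2 * pi) \<le> 0" by simp
  then have x: "x = n * (2 * pi)" using n assms(1) by linarith
  then have "n \<noteq> 0" using assms(1) by (metis less_irrefl mult_zero_left of_nat_0)
  then have "1 * (2 * pi) \<le> n * (2 * pi)" by (intro mult_right_mono) auto
  then show ?thesis using x by simp
qed

text \<open>If \<open>norm q\<close> is a constant \<open>r\<close>, differentiating it twice gives \<open>q \<bullet> p = 0\<close> and \<open>(norm p)\<^sup>2 = 1 / r\<close>. Hence the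
  angular momentum \<open>L\<close> satisfies \<open>L\<^sup>2 = r\<close>, and everything else is a function of \<open>L\<close>: the energy, the
  angular velocity \<open>w = 1 / L\<^sup>3 - 1\<close> in the rotating frame, and the constant value \<open>1 / L\<^sup>2 - L = L w\<close> of
  the Liouville form. The action is \<open>L w\<close> times the period \<open>2 pi / \<bar>w\<bar>\<close>.\<close>
lemma circular_orbit_facts:
  assumes c: "c > 3 / 2" and circ: "circular_orbit c \<gamma> T"
  shows "\<exists>L. L \<noteq> 0 \<and> L < 1 \<and> c = 1 / (2 * L\<^sup>2) + L \<and> (\<forall>t. turning (kepler_motion \<gamma>) t = L) \<and>
    action lambda_can (Phi \<circ> Psi \<circ> \<gamma>) T = 2 * pi * \<bar>L\<bar>"
proof -
  have \<gamma>: "integral_curve_on (ham_field H_R) (bounded_level c) \<gamma>" and per: "simple_period \<gamma> T"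
    using circ by (auto simp: circular_orbit_def)
  obtain r where r: "\<And>t. norm (fst (\<gamma> t)) = r" using circ by (auto simp: circular_orbit_def)
  define q1 q2 p1 p2 where "q1 = (\<lambda>t. fst (\<gamma> t) $ 1)" and "q2 = (\<lambda>t. fst (\<gamma> t) $ 2)"
    and "p1 = (\<lambda>t. snd (\<gamma> t) $ 1)" and "p2 = (\<lambda>t. snd (\<gamma> t) $ 2)"
  note defs = q1_def q2_def p1_def p2_def
  have d: "(q1 has_real_derivative p1 t + q2 t) (at t)" "(q2 has_real_derivative p2 t - q1 t) (at t)"
    "(p1 has_real_derivative - q1 t / r ^ 3 + p2 t) (at t)" "(p2 has_real_derivative - q2 t / r ^ 3 - p1 t) (at t)"
    "fst (\<gamma> t) \<noteq> 0" "(\<gamma> has_vector_derivative rkp_field (\<gamma> t)) (at t)" for t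
    using rkp_derivatives[OF c \<gamma>, of t] unfolding defs r by simp_all
  have r0: "r > 0" using d(5)[of 0] r[of 0] by (metis norm_eq_zero norm_ge_zero order_le_less)
  have qq: "(q1 t)\<^sup>2 + (q2 t)\<^sup>2 = r\<^sup>2" for t using norm_real2[of "fst (\<gamma> t)"] r[of t] by (simp add: defs)
  have qp: "q1 t * p1 t + q2 t * p2 t = 0" for t
  proof -
    have "((\<lambda>t. (q1 t)\<^sup>2 + (q2 t)\<^sup>2) has_real_derivative 2 * (q1 t * p1 t + q2 t * p2 t)) (at t)"
      by (rule derivative_eq_intros d refl | simp add: algebra_simps)+
    then show ?thesis using DERIV_unique[OF _ DERIV_const[of "r\<^sup>2"]] unfolding qq by fastforce
  qed
  have pp: "(p1 t)\<^sup>2 + (p2 t)\<^sup>2 = 1 / r" for t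
  proof -
    have "((\<lambda>t. q1 t * p1 t + q2 t * p2 t) has_real_derivative
       (p1 t)\<^sup>2 + (p2 t)\<^sup>2 - ((q1 t)\<^sup>2 + (q2 t)\<^sup>2) / r ^ 3) (at t)"
      by (rule derivative_eq_intros d refl | simp add: power2_eq_square add_divide_distrib algebra_simps)+
    then have "(p1 t)\<^sup>2 + (p2 t)\<^sup>2 - ((q1 t)\<^sup>2 + (q2 t)\<^sup>2) / r ^ 3 = 0"
      using DERIV_unique[OF _ DERIV_const[of 0]] unfolding qp by fastforce
    then show ?thesis unfolding qq using r0 by (simp add: power2_eq_square power3_eq_cube)
  qed
  define l where "l = (\<lambda>t. q1 t * p2 t - q2 t * p1 t)"
  define L where "L = l 0"
  have "(l has_real_derivative 0) (at t)" for t
    unfolding l_def by (rule derivative_eq_intros d refl | simp add: power2_eq_square algebra_simps)+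
  then have L: "q1 t * p2 t - q2 t * p1 t = L" for t
    using DERIV_isconst_all[of l t 0] by (simp add: L_def l_def)
  have L2: "L\<^sup>2 = r"
  proof -
    have "(q1 0 * p2 0 - q2 0 * p1 0)\<^sup>2 =
        ((q1 0)\<^sup>2 + (q2 0)\<^sup>2) * ((p1 0)\<^sup>2 + (p2 0)\<^sup>2) - (q1 0 * p1 0 + q2 0 * p2 0)\<^sup>2"
      by (simp add: power2_eq_square algebra_simps)
    then show ?thesis unfolding L qq pp qp using r0 by (simp add: power2_eq_square)
  qed
  have L0: "L \<noteq> 0" using L2 r0 by auto
  have "\<gamma> 0 \<in> bounded_level c" using \<gamma> by (simp add: integral_curve_on_def)
  then have bl: "H_R (\<gamma> 0) = - c" "r * L < 1"
    using bounded_level_iff[OF c, of "fst (\<gamma> 0)" "snd (\<gamma> 0)"] L[of 0] r[of 0] by (simp_all add: defs)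
  have "L ^ 3 < 1 ^ 3" using bl(2) L2 by (simp add: power2_eq_square power3_eq_cube)
  then have L1: "L < 1" by (rule power_less_imp_less_base) simp
  have "- c = 1 / r / 2 - 1 / r - L"
    using bl(1) pp[of 0] L[of 0] norm_real2[of "snd (\<gamma> 0)"] r[of 0]
    by (simp add: H_R_def case_prod_beta defs mult.commute)
  then have cL: "c = 1 / (2 * L\<^sup>2) + L" using r0 L2 by (simp add: field_simps)
  have turn: "turning (kepler_motion \<gamma>) t = L" for t
    using turning_kepler_motion[OF c \<gamma>, of t] L[of t] by (simp add: defs)
  define w where "w = L / r\<^sup>2 - 1"
  have w: "w = 1 / L ^ 3 - 1"
    unfolding w_def L2[symmetric] using L0 by (simp add: field_simps power2_eq_square power3_eq_cube)
  have mom: "p1 t = - (L / r\<^sup>2) * q2 t" "p2 t = (L / r\<^sup>2) * q1 t" for t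
  proof -
    have "r\<^sup>2 * p1 t = - L * q2 t" "r\<^sup>2 * p2 t = L * q1 t"
      unfolding qq[symmetric, of t] L[symmetric, of t] using qp[of t] by algebra+
    then show "p1 t = - (L / r\<^sup>2) * q2 t" "p2 t = (L / r\<^sup>2) * q1 t" using r0 by (simp_all add: field_simps)
  qed
  have q': "(q1 has_real_derivative - w * q2 t) (at t)" "(q2 has_real_derivative w * q1 t) (at t)" for t
    by (rule DERIV_cong[OF d(1)] DERIV_cong[OF d(2)], simp add: mom w_def algebra_simps)+
  have rot1: "q1 t * cos (w * t) + q2 t * sin (w * t) = q1 0" for t
  proof -
    have "((\<lambda>t. q1 t * cos (w * t) + q2 t * sin (w * t)) has_real_derivative 0) (at t)" for t
      by (rule derivative_eq_intros q' refl | simp add: algebra_simps)+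
    then show ?thesis using DERIV_isconst_all[of "\<lambda>t. q1 t * cos (w * t) + q2 t * sin (w * t)" t 0] by simp
  qed
  have rot2: "q2 t * cos (w * t) - q1 t * sin (w * t) = q2 0" for t
  proof -
    have "((\<lambda>t. q2 t * cos (w * t) - q1 t * sin (w * t)) has_real_derivative 0) (at t)" for t
      by (rule derivative_eq_intros q' refl | simp add: algebra_simps)+
    then show ?thesis using DERIV_isconst_all[of "\<lambda>t. q2 t * cos (w * t) - q1 t * sin (w * t)" t 0] by simp
  qed
  have sol: "q1 t = q1 0 * cos (w * t) - q2 0 * sin (w * t)" "q2 t = q2 0 * cos (w * t) + q1 0 * sin (w * t)" for t
    unfolding rot1[symmetric, of t] rot2[symmetric, of t] using sin_cos_squared_add[of "w * t"] by algebra+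
  have w0: "w \<noteq> 0" using L1 L0 unfolding w
    by (metis \<open>L ^ 3 < 1 ^ 3\<close> div_by_1 eq_iff_diff_eq_0 eq_divide_eq_1 less_irrefl power_one divide_eq_eq_1)
  define S where "S = 2 * pi / \<bar>w\<bar>"
  have S0: "S > 0" using w0 by (simp add: S_def)
  have trig: "cos (w * (t + S)) = cos (w * t)" "sin (w * (t + S)) = sin (w * t)" for t
  proof -
    have "w * S = 2 * pi \<or> w * S = - (2 * pi)" using w0 by (cases "w > 0") (auto simp: S_def)
    then show "cos (w * (t + S)) = cos (w * t)" "sin (w * (t + S)) = sin (w * t)"
      by (auto simp: distrib_left cos_add sin_add)
  qed
  have "\<gamma> (t + S) = \<gamma> t" for t
  proof -
    have "q1 (t + S) = q1 t" "q2 (t + S) = q2 t" using sol[of "t + S"] sol[of t] trig by simp_all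
    moreover from this have "p1 (t + S) = p1 t" "p2 (t + S) = p2 t" using mom by simp_all
    ultimately show ?thesis by (simp add: defs prod_eq_iff eq_real2_iff)
  qed
  then have "is_period \<gamma> S" using S0 by (simp add: is_period_def)
  then have "T \<le> S" using per S0 by (metis simple_period_def not_less)
  have T0: "T > 0" and \<gamma>T: "\<gamma> T = \<gamma> 0" using per by (auto simp: simple_period_def is_period_def dest: spec[of _ 0])
  have "q1 T = q1 0" "q2 T = q2 0" using \<gamma>T by (simp_all add: defs)
  then have "r\<^sup>2 * cos (w * T) = r\<^sup>2"
  proof -
    have "((q1 0)\<^sup>2 + (q2 0)\<^sup>2) * cos (w * T) =
        q1 0 * (q1 T * cos (w * T) + q2 T * sin (w * T)) + q2 0 * (q2 T * cos (w * T) - q1 T * sin (w * T))"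
      using \<open>q1 T = q1 0\<close> \<open>q2 T = q2 0\<close> by (simp add: power2_eq_square algebra_simps)
    also have "\<dots> = (q1 0)\<^sup>2 + (q2 0)\<^sup>2" unfolding rot1 rot2 by (simp add: power2_eq_square)
    finally show ?thesis unfolding qq .
  qed
  then have "cos (\<bar>w\<bar> * T) = 1" using r0 T0 by (auto simp: abs_if)
  then have "2 * pi \<le> \<bar>w\<bar> * T" using cos_eq_1_ge_2pi w0 T0 by simp
  then have "S \<le> T" using w0 by (simp add: S_def field_simps)
  with \<open>T \<le> S\<close> have TS: "T = S" by simp
  have "lambda_can ((Phi \<circ> Psi \<circ> \<gamma>) t) (vector_derivative (Phi \<circ> Psi \<circ> \<gamma>) (at t)) = 1 / r - L" for t
  proof -
    have 1: "((\<lambda>t. fst (\<gamma> t)) has_vector_derivative fst (rkp_field (\<gamma> t))) (at t)"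
      using bounded_linear.has_vector_derivative[OF bounded_linear_fst d(6)] .
    have 2: "((\<lambda>t. snd (\<gamma> t)) has_vector_derivative snd (rkp_field (\<gamma> t))) (at t)"
      using bounded_linear.has_vector_derivative[OF bounded_linear_snd d(6)] .
    have "lambda_can ((Phi \<circ> Psi \<circ> \<gamma>) t) (vector_derivative (Phi \<circ> Psi \<circ> \<gamma>) (at t))
      = - (fst (\<gamma> t) \<bullet> snd (rkp_field (\<gamma> t)))"
      using lambda_can_along[OF 1 2] by simp
    also have "\<dots> = ((q1 t)\<^sup>2 + (q2 t)\<^sup>2) / r ^ 3 - (q1 t * p2 t - q2 t * p1 t)"
      by (simp add: inner_real2 rkp_field_def case_prod_beta r defs power2_eq_square algebra_simps add_divide_distrib)
    also have "\<dots> = 1 / r - L" unfolding qq L using r0 by (simp add: power2_eq_square power3_eq_cube)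
    finally show ?thesis .
  qed
  then have "action lambda_can (Phi \<circ> Psi \<circ> \<gamma>) T = T * (1 / r - L)"
    using T0 by (simp add: action_def)
  also have "1 / r - L = L * w"
    unfolding w L2[symmetric] using L0 by (simp add: field_simps power2_eq_square power3_eq_cube)
  also have "T * (L * w) = 2 * pi * (L * sgn w)"
    unfolding TS S_def using w0 by (simp add: sgn_if abs_if)
  also have "L * sgn w = \<bar>L\<bar>"
  proof (cases "L > 0")
    case True
    then have "1 < 1 / L ^ 3" using \<open>L ^ 3 < 1 ^ 3\<close> by simp
    then show ?thesis using True by (simp add: w sgn_if)
  next
    case False
    then have "L ^ 3 < 0" using L0 by (simp add: power3_eq_cube mult_neg_neg mult_pos_neg zero_less_mult_iff mult_less_0_iff)
    then have "1 / L ^ 3 < 0" by simp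
    then have "w < 0" unfolding w by linarith
    then show ?thesis using False by (simp add: sgn_if)
  qed
  finally show ?thesis using L0 L1 cL turn by blast
qed


lemma circular_orbit_exists:
  assumes c: "c > 3 / 2" and L: "L \<noteq> 0" "L < 1" "c = 1 / (2 * L\<^sup>2) + L"
  shows "\<exists>\<gamma> T. circular_orbit c \<gamma> T \<and> (\<forall>t. turning (kepler_motion \<gamma>) t = L)"
proof -
  define w where "w = 1 / L ^ 3 - 1"
  define q where "q = (\<lambda>t::real. vector [L\<^sup>2 * cos (w * t), L\<^sup>2 * sin (w * t)] :: real^2)"
  define p where "p = (\<lambda>t::real. vector [- (1 / L) * sin (w * t), (1 / L) * cos (w * t)] :: real^2)"
  define \<gamma> where "\<gamma> = (\<lambda>t. (q t, p t))"
  have sc: "(cos x)\<^sup>2 + (sin x)\<^sup>2 = 1" for x :: real by simp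
  have L3: "L ^ 3 < 1"
  proof (cases "L > 0")
    case True
    then show ?thesis using L power_strict_mono[of L 1 3] by simp
  next
    case False
    then have "L ^ 3 < 0" using L by (simp add: power3_eq_cube mult_less_0_iff zero_less_mult_iff)
    then show ?thesis by linarith
  qed
  have w0: "w \<noteq> 0" using L L3 by (auto simp: w_def)
  have h: "(norm (q t))\<^sup>2 = (L\<^sup>2)\<^sup>2 * ((cos (w * t))\<^sup>2 + (sin (w * t))\<^sup>2)" for t
    unfolding norm_real2 q_def by (simp only: vector_2 power_mult_distrib distrib_left)
  have nq: "norm (q t) = L\<^sup>2" for t
    by (rule power2_eq_imp_eq) (simp_all only: h sc mult_1_right norm_ge_zero zero_le_power2)
  have h': "(norm (p t))\<^sup>2 = (1 / L)\<^sup>2 * ((cos (w * t))\<^sup>2 + (sin (w * t))\<^sup>2)" for t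
    unfolding norm_real2 p_def vector_2 power_mult_distrib power2_minus distrib_left by (rule add.commute)
  have np: "(norm (p t))\<^sup>2 = 1 / L\<^sup>2" for t unfolding h' sc by (simp add: power_divide)
  have ang_mom: "q t $ 1 * p t $ 2 - q t $ 2 * p t $ 1 = L" for t
  proof -
    have "q t $ 1 * p t $ 2 - q t $ 2 * p t $ 1 = L * ((cos (w * t))\<^sup>2 + (sin (w * t))\<^sup>2)"
      using L(1) by (simp add: q_def p_def power2_eq_square algebra_simps
          del: sin_cos_squared_add sin_cos_squared_add2 sin_cos_squared_add3)
    then show ?thesis by simp
  qed
  have q0: "q t \<noteq> 0" for t using nq[of t] L by auto
  have mem: "\<gamma> t \<in> bounded_level c" for t
  proof -
    have "H_R (q t, p t) = 1 / L\<^sup>2 / 2 - 1 / L\<^sup>2 - L"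
      using ang_mom[of t] by (simp add: H_R_def nq np mult.commute)
    also have "\<dots> = - c" unfolding L(3) by simp
    finally show ?thesis
      unfolding \<gamma>_def bounded_level_iff[OF c] ang_mom nq using q0 L3 by (simp add: power2_eq_square power3_eq_cube)
  qed
  have "(\<gamma> has_vector_derivative rkp_field (\<gamma> t)) (at t)" for t
  proof -
    have dq: "(q has_vector_derivative vector [- L\<^sup>2 * w * sin (w * t), L\<^sup>2 * w * cos (w * t)]) (at t)"
      unfolding q_def by (rule has_vector_derivative_vector2; (rule derivative_eq_intros refl | simp)+)
    have dp: "(p has_vector_derivative vector [- (w / L) * cos (w * t), - (w / L) * sin (w * t)]) (at t)"
      unfolding p_def by (rule has_vector_derivative_vector2; (rule derivative_eq_intros refl | simp)+)
    have rk: "rkp_field (\<gamma> t) = (vector [- L\<^sup>2 * w * sin (w * t), L\<^sup>2 * w * cos (w * t)],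
        vector [- (w / L) * cos (w * t), - (w / L) * sin (w * t)])"
    proof -
      have a: "L\<^sup>2 * w = 1 / L - L\<^sup>2" "w / L = L\<^sup>2 / (L\<^sup>2) ^ 3 - 1 / L"
        using L by (simp_all add: w_def field_simps power2_eq_square power3_eq_cube)
      have b: "- L\<^sup>2 * w * S = - (1 / L - L\<^sup>2) * S" "- (w / L) * S = - (L\<^sup>2 / (L\<^sup>2) ^ 3 - 1 / L) * S" for S
        unfolding a[symmetric] by simp_all
      show ?thesis
        unfolding rkp_field_def \<gamma>_def prod.case nq b a(1)
        by (simp add: q_def p_def eq_real2_iff algebra_simps)
    qed
    show ?thesis unfolding rk unfolding \<gamma>_def by (rule has_vector_derivative_Pair[OF dq dp])
  qed
  then have int: "integral_curve_on (ham_field H_R) (bounded_level c) \<gamma>"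
    unfolding integral_curve_on_def using mem ham_field_H_R[OF q0] by (simp add: \<gamma>_def)
  define T where "T = 2 * pi / \<bar>w\<bar>"
  have T0: "T > 0" using w0 by (simp add: T_def)
  have "is_period \<gamma> T"
  proof -
    have "w * T = 2 * pi \<or> w * T = - (2 * pi)" using w0 by (cases "w > 0") (auto simp: T_def)
    then have "cos (w * (t + T)) = cos (w * t)" "sin (w * (t + T)) = sin (w * t)" for t
      by (auto simp: distrib_left cos_add sin_add)
    then show ?thesis using T0 by (simp add: is_period_def \<gamma>_def q_def p_def)
  qed
  moreover have "\<not> is_period \<gamma> s" if s: "0 < s" "s < T" for s
  proof
    assume "is_period \<gamma> s"
    then have "\<gamma> (0 + s) = \<gamma> 0" unfolding is_period_def by blast
    then have "q s $ 1 = q 0 $ 1" by (simp add: \<gamma>_def)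
    then have "cos (w * s) = 1" using L by (simp add: q_def)
    then have "cos (\<bar>w\<bar> * s) = 1" by (auto simp: abs_if)
    then have "2 * pi \<le> \<bar>w\<bar> * s" using cos_eq_1_ge_2pi w0 s by simp
    then have "T \<le> s" using w0 by (simp add: T_def field_simps)
    then show False using s by simp
  qed
  ultimately have "simple_period \<gamma> T" by (auto simp: simple_period_def)
  moreover have "\<forall>t. norm (fst (\<gamma> t)) = L\<^sup>2" by (simp add: \<gamma>_def nq)
  ultimately have "circular_orbit c \<gamma> T" unfolding circular_orbit_def using int by blast
  moreover have "turning (kepler_motion \<gamma>) t = L" for t
    using turning_kepler_motion[OF c int, of t] ang_mom[of t] by (simp add: \<gamma>_def)
  ultimately show ?thesis by blast
qed

text \<open>The sign of \<open>L\<close> is the direction of rotation, so retrograde orbits have \<open>L = - L_R c\<close>.\<close>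
lemma retrograde_orbits:
  assumes c: "c > 3 / 2"
  shows "\<exists>\<gamma> T. retrograde_orbit c \<gamma> T"
    and "retrograde_orbit c \<gamma> T \<Longrightarrow> action lambda_can (Phi \<circ> Psi \<circ> \<gamma>) T = 2 * pi * L_R c"
proof -
  have "c = 1 / (2 * (- L_R c)\<^sup>2) + - L_R c" using L_R_eq_iff[OF c L_R_pos[OF c]] by simp
  then show "\<exists>\<gamma> T. retrograde_orbit c \<gamma> T"
    using circular_orbit_exists[OF c, of "- L_R c"] L_R_pos[OF c] unfolding retrograde_orbit_def
    by fastforce
  assume r: "retrograde_orbit c \<gamma> T"
  then obtain L where L: "c = 1 / (2 * L\<^sup>2) + L" "\<forall>t. turning (kepler_motion \<gamma>) t = L"
    "action lambda_can (Phi \<circ> Psi \<circ> \<gamma>) T = 2 * pi * \<bar>L\<bar>"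
    using circular_orbit_facts[OF c] unfolding retrograde_orbit_def by blast
  then have "L < 0" using r by (simp add: retrograde_orbit_def)
  then have "- L = L_R c" using L_R_eq_iff[OF c, of "- L"] L(1) by simp
  then show "action lambda_can (Phi \<circ> Psi \<circ> \<gamma>) T = 2 * pi * L_R c" using L(3) \<open>L < 0\<close> by simp
qed

lemma direct_orbits:
  assumes c: "c > 3 / 2"
  shows "\<exists>\<gamma> T. direct_orbit c \<gamma> T"
    and "direct_orbit c \<gamma> T \<Longrightarrow> action lambda_can (Phi \<circ> Psi \<circ> \<gamma>) T = - (2 * pi * L_D c)"
proof -
  have "c = 1 / (2 * (- L_D c)\<^sup>2) + - L_D c"
    using L_D_eq_iff[OF c, of "- L_D c"] L_D_gt[OF c] L_D_neg[OF c] by simp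
  then show "\<exists>\<gamma> T. direct_orbit c \<gamma> T"
    using circular_orbit_exists[OF c, of "- L_D c"] L_D_gt[OF c] L_D_neg[OF c] unfolding direct_orbit_def
    by fastforce
  assume r: "direct_orbit c \<gamma> T"
  then obtain L where L: "L < 1" "c = 1 / (2 * L\<^sup>2) + L" "\<forall>t. turning (kepler_motion \<gamma>) t = L"
    "action lambda_can (Phi \<circ> Psi \<circ> \<gamma>) T = 2 * pi * \<bar>L\<bar>"
    using circular_orbit_facts[OF c] unfolding direct_orbit_def by blast
  then have "L > 0" using r by (simp add: direct_orbit_def)
  then have "L = - L_D c" using L_D_eq_iff[OF c, of "L"] L(1,2) by simp
  then show "action lambda_can (Phi \<circ> Psi \<circ> \<gamma>) T = - (2 * pi * L_D c)" using L(4) \<open>L > 0\<close> by simp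
qed

section \<open>The Reeb vector field\<close>

text \<open>The Hamiltonian vector field of \<open>reg_ham c\<close> on the level \<open>1\<close>. The first summands are the geodesic
  flow, the second one of the fibre part comes from \<open>\<xi>\<^sub>3\<close>, and the terms with \<open>rad\<close> are the rotation of the
  frame.\<close>
definition reg_field :: "real \<Rightarrow> (real^3) \<times> (real^3) \<Rightarrow> (real^3) \<times> (real^3)" where
  "reg_field c = (\<lambda>(\<xi>, \<eta>).
     ((1 / (norm \<eta>)\<^sup>2) *\<^sub>R \<eta> + rad (\<xi>, \<eta>) *\<^sub>R vector [\<xi>$2, - \<xi>$1, 0],
      - \<xi> + (norm \<eta> * (c - 1 / 2 + spin (\<xi>, \<eta>))) *\<^sub>R (axis 3 1 - \<xi>$3 *\<^sub>R \<xi>)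
        + rad (\<xi>, \<eta>) *\<^sub>R vector [\<eta>$2, - \<eta>$1, 0]))"

text \<open>The value of the Liouville form on \<open>reg_field\<close>.\<close>
definition reeb_speed :: "(real^3) \<times> (real^3) \<Rightarrow> real" where
  "reeb_speed \<zeta> = 1 + rad \<zeta> * spin \<zeta>"

lemma Sigma_R_facts:
  assumes c: "c > 3 / 2" and z: "(\<xi>, \<eta>) \<in> Sigma_R c"
  shows "norm \<xi> = 1" "\<xi> \<bullet> \<eta> = 0" "\<eta> \<noteq> 0" "reeb_speed (\<xi>, \<eta>) > 0"
    "1 + (1 - \<xi>$3) * (c - 1 / 2 + spin (\<xi>, \<eta>)) = 1 / norm \<eta>"
proof -
  note S = z[unfolded Sigma_R_iff[OF c]]
  show "norm \<xi> = 1" "\<xi> \<bullet> \<eta> = 0" "reeb_speed (\<xi>, \<eta>) > 0"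
    using S by (simp_all add: cotangent_sphere_def reeb_speed_def)
  show "\<eta> \<noteq> 0" using S by (auto simp: reg_ham_def)
  then show "1 + (1 - \<xi>$3) * (c - 1 / 2 + spin (\<xi>, \<eta>)) = 1 / norm \<eta>"
    using S by (simp add: reg_ham_def field_simps)
qed

lemma lambda_can_reg_field:
  assumes "\<eta> \<noteq> 0"
  shows "lambda_can (\<xi>, \<eta>) (reg_field c (\<xi>, \<eta>)) = reeb_speed (\<xi>, \<eta>)"
proof -
  have "\<eta> \<bullet> \<eta> = (norm \<eta>)\<^sup>2" by (simp add: power2_norm_eq_inner)
  moreover have "\<eta> \<bullet> vector [\<xi>$2, - \<xi>$1, 0] = spin (\<xi>, \<eta>)" by (simp add: inner_real3 spin_def)
  ultimately show ?thesis using assms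
    by (simp add: lambda_can_def reg_field_def inner_add_right reeb_speed_def)
qed

text \<open>The linearised equations of \<open>Sigma_R c\<close>: those of \<open>norm \<xi> = 1\<close>, of \<open>\<xi> \<bullet> \<eta> = 0\<close> and of \<open>reg_ham c = 1\<close>,
  the last one simplified by means of \<open>reg_ham c = 1\<close> itself.\<close>
definition tangent_eqs :: "real \<Rightarrow> (real^3) \<times> (real^3) \<Rightarrow> (real^3) \<times> (real^3) \<Rightarrow> bool" where
  "tangent_eqs c = (\<lambda>(\<xi>, \<eta>) (a, b). \<xi> \<bullet> a = 0 \<and> a \<bullet> \<eta> + \<xi> \<bullet> b = 0 \<and>
     (\<eta> \<bullet> b) / (norm \<eta>)\<^sup>2 - norm \<eta> * (c - 1 / 2 + spin (\<xi>, \<eta>)) * a$3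
       + rad (\<xi>, \<eta>) * (a$2 * \<eta>$1 + \<xi>$2 * b$1 - a$1 * \<eta>$2 - \<xi>$1 * b$2) = 0)"

lemma tangent_eqs_diff: "tangent_eqs c \<zeta> v \<Longrightarrow> tangent_eqs c \<zeta> w \<Longrightarrow> tangent_eqs c \<zeta> (v - w)"
  unfolding tangent_eqs_def case_prod_beta
  by (auto simp: inner_diff_left inner_diff_right algebra_simps diff_divide_distrib)

text \<open>Hamilton's equations: contracting the symplectic form with \<open>reg_field\<close> gives the differential of the
  Hamiltonian up to multiples of the constraints.\<close>
lemma dp_dq_reg_field:
  assumes "tangent_eqs c (\<xi>, \<eta>) W"
  shows "dp_dq (reg_field c (\<xi>, \<eta>)) W = 0"
proof -
  obtain a b where W: "W = (a, b)" by force
  have t: "\<xi> \<bullet> a = 0" and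
    k: "(\<eta> \<bullet> b) / (norm \<eta>)\<^sup>2 - norm \<eta> * (c - 1 / 2 + spin (\<xi>, \<eta>)) * a$3
       + rad (\<xi>, \<eta>) * (a$2 * \<eta>$1 + \<xi>$2 * b$1 - a$1 * \<eta>$2 - \<xi>$1 * b$2) = 0"
    using assms by (auto simp: tangent_eqs_def W)
  have e1: "axis 3 1 \<bullet> a = a $ 3" by (simp add: inner_real3 axis_def)
  have e2: "vector [\<eta>$2, - \<eta>$1, 0] \<bullet> a = \<eta>$2 * a$1 - \<eta>$1 * a$2"
    "b \<bullet> vector [\<xi>$2, - \<xi>$1, 0] = b$1 * \<xi>$2 - b$2 * \<xi>$1" by (simp_all add: inner_real3)
  have "dp_dq (reg_field c (\<xi>, \<eta>)) W = - ((\<eta> \<bullet> b) / (norm \<eta>)\<^sup>2 - norm \<eta> * (c - 1 / 2 + spin (\<xi>, \<eta>)) * a$3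
       + rad (\<xi>, \<eta>) * (a$2 * \<eta>$1 + \<xi>$2 * b$1 - a$1 * \<eta>$2 - \<xi>$1 * b$2))"
    unfolding dp_dq_def reg_field_def W prod.case inner_add_left inner_add_right inner_diff_left
      inner_minus_left inner_scaleR_left inner_scaleR_right e1 e2
    using t by (simp add: algebra_simps inner_commute)
  then show ?thesis unfolding k by simp
qed

lemma has_vector_derivative_fst_snd:
  assumes "(\<gamma> has_vector_derivative v) F"
  shows "((\<lambda>t. fst (\<gamma> t)) has_vector_derivative fst v) F" "((\<lambda>t. snd (\<gamma> t)) has_vector_derivative snd v) F"
  using bounded_linear.has_vector_derivative[OF bounded_linear_fst assms]
    bounded_linear.has_vector_derivative[OF bounded_linear_snd assms] by auto

lemma has_real_derivative_inner:
  assumes "(f has_vector_derivative f') (at t)" "(g has_vector_derivative g') (at t)"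
  shows "((\<lambda>t. f t \<bullet> g t) has_real_derivative f t \<bullet> g' + f' \<bullet> g t) (at t)"
  using bounded_bilinear.has_vector_derivative[OF bounded_bilinear_inner assms]
  by (simp add: has_real_derivative_iff_has_vector_derivative)

lemma tangent_vectors_eqs:
  assumes c: "c > 3 / 2" and z: "\<zeta> \<in> Sigma_R c" and v: "v \<in> tangent_vectors (Sigma_R c) \<zeta>"
  shows "tangent_eqs c \<zeta> v"
proof -
  obtain \<gamma> e where e: "e > 0" and g0: "\<gamma> 0 = \<zeta>" and gS: "\<And>t. t \<in> {-e<..<e} \<Longrightarrow> \<gamma> t \<in> Sigma_R c"
    and d: "(\<gamma> has_vector_derivative v) (at (0::real))"
    using v unfolding tangent_vectors_def by blast
  obtain \<xi> \<eta> where ze: "\<zeta> = (\<xi>, \<eta>)" by force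
  obtain a b where ab: "v = (a, b)" by force
  define x y where "x = (\<lambda>t. fst (\<gamma> t))" and "y = (\<lambda>t. snd (\<gamma> t))"
  have x: "(x has_vector_derivative a) (at 0)" and y: "(y has_vector_derivative b) (at 0)"
    using has_vector_derivative_fst_snd[OF d] by (simp_all add: x_def y_def ab)
  have xy0: "x 0 = \<xi>" "y 0 = \<eta>" by (simp_all add: x_def y_def g0 ze)
  note S0 = Sigma_R_facts[OF c z[unfolded ze]]
  have loc: "D = 0" if "(h has_real_derivative D) (at 0)" "\<And>t. t \<in> {-e<..<e} \<Longrightarrow> h t = h 0" for h D
    by (rule DERIV_local_const[OF that(1) e], intro allI impI that(2)[symmetric]) auto
  have S: "norm (x t) = 1" "x t \<bullet> y t = 0" "reg_ham c (x t, y t) = 1" if "t \<in> {-e<..<e}" for t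
    using gS[OF that] unfolding Sigma_R_iff[OF c] by (auto simp: x_def y_def cotangent_sphere_def case_prod_beta)
  have e0: "0 \<in> {-e<..<e}" using e by simp
  have "x 0 \<bullet> a + a \<bullet> x 0 = 0"
    by (rule loc[OF has_real_derivative_inner[OF x x]]) (use S(1) e0 in \<open>simp add: dot_square_norm\<close>)
  then have 1: "\<xi> \<bullet> a = 0" by (simp add: xy0 inner_commute)
  have "x 0 \<bullet> b + a \<bullet> y 0 = 0"
    by (rule loc[OF has_real_derivative_inner[OF x y]]) (use S(2) e0 in simp)
  then have 2: "a \<bullet> \<eta> + \<xi> \<bullet> b = 0" by (simp add: xy0)
  have n: "((\<lambda>t. norm (y t)) has_real_derivative (\<eta> \<bullet> b) / norm \<eta>) (at 0)"
  proof -
    have "((\<lambda>t. norm (y t)) has_derivative (\<lambda>h. (h *\<^sub>R b) \<bullet> sgn (y 0))) (at 0)"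
      using has_derivative_compose[OF y[unfolded has_vector_derivative_def], of norm "\<lambda>h. h \<bullet> sgn (y 0)"]
        has_derivative_norm[of "y 0"] S0(3) xy0 by simp
    then show ?thesis
      unfolding has_field_derivative_def by (rule has_derivative_eq_rhs) (simp add: fun_eq_iff xy0 sgn_div_norm inner_commute divide_inverse mult_ac)
  qed
  note nx = has_real_derivative_nth[OF x] and ny = has_real_derivative_nth[OF y]
  define h where "h = (\<lambda>t. norm (y t) * (1 + (1 - x t $ 3) * (c - 1 / 2 + (x t $ 2 * y t $ 1 - x t $ 1 * y t $ 2))))"
  have "(h has_real_derivative (\<eta> \<bullet> b) / norm \<eta> * (1 + (1 - \<xi>$3) * (c - 1 / 2 + spin (\<xi>, \<eta>)))
      + norm \<eta> * (- a$3 * (c - 1 / 2 + spin (\<xi>, \<eta>)) + (1 - \<xi>$3) *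
        (a$2 * \<eta>$1 + \<xi>$2 * b$1 - a$1 * \<eta>$2 - \<xi>$1 * b$2))) (at 0)"
    unfolding h_def by (rule derivative_eq_intros n nx ny refl | simp add: xy0 spin_def algebra_simps)+
  then have "(\<eta> \<bullet> b) / norm \<eta> * (1 + (1 - \<xi>$3) * (c - 1 / 2 + spin (\<xi>, \<eta>)))
      + norm \<eta> * (- a$3 * (c - 1 / 2 + spin (\<xi>, \<eta>)) + (1 - \<xi>$3) *
        (a$2 * \<eta>$1 + \<xi>$2 * b$1 - a$1 * \<eta>$2 - \<xi>$1 * b$2)) = 0"
  proof (rule loc)
    fix t assume "t \<in> {-e<..<e}"
    then show "h t = h 0" using S(3) S(3)[OF e0] by (simp add: h_def reg_ham_def spin_def)
  qed
  then have 3: "(\<eta> \<bullet> b) / (norm \<eta>)\<^sup>2 - norm \<eta> * (c - 1 / 2 + spin (\<xi>, \<eta>)) * a$3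
       + rad (\<xi>, \<eta>) * (a$2 * \<eta>$1 + \<xi>$2 * b$1 - a$1 * \<eta>$2 - \<xi>$1 * b$2) = 0"
    unfolding S0(5) by (simp add: rad_def power2_eq_square algebra_simps)
  show ?thesis using 1 2 3 by (simp add: tangent_eqs_def ze ab)
qed

lemma norm_add_orthogonal:
  fixes u v :: "'a::real_inner"
  assumes "u \<bullet> v = 0"
  shows "(norm (u + v))\<^sup>2 = (norm u)\<^sup>2 + (norm v)\<^sup>2"
  using assms by (simp add: power2_norm_eq_inner inner_add_left inner_add_right inner_commute)

text \<open>A fibre ray meets \<open>Sigma_R c\<close> in exactly one point, which depends differentiably on the ray. Any curve of
  covectors can therefore be pushed onto \<open>Sigma_R c\<close> at the cost of a multiple of \<open>\<eta>\<close> in its velocity.\<close>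
lemma rescaled_curve_tangent:
  assumes c: "c > 3 / 2" and z: "(\<xi>, \<eta>) \<in> Sigma_R c"
    and x: "(x has_vector_derivative a) (at 0)" and y: "(y has_vector_derivative b) (at 0)"
    and xy0: "x 0 = \<xi>" "y 0 = \<eta>"
    and cot: "\<And>t. (x t, y t) \<in> cotangent_sphere" and nrm: "\<And>t. norm (y t) = norm \<eta>"
  shows "\<exists>k. (a, b + k *\<^sub>R \<eta>) \<in> tangent_vectors (Sigma_R c) (\<xi>, \<eta>)"
proof -
  note S0 = Sigma_R_facts[OF c z]
  define A where "A = (\<lambda>t. norm \<eta> * (1 + (1 - x t $ 3) * (c - 1 / 2)))"
  define Q where "Q = (\<lambda>t. norm \<eta> * (1 - x t $ 3) * (x t $ 2 * y t $ 1 - x t $ 1 * y t $ 2))"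
  have disc: "(A t)\<^sup>2 + 4 * Q t > 0" "A t > 0" for t
  proof -
    have "y t \<noteq> 0" using nrm[of t] S0(3) by auto
    then obtain p q where pq: "(p, q) \<noteq> 0" "LC_cover (p, q) = (x t, y t)" using LC_cover_surj[OF cot[of t]] by blast
    have "Q t = - quart_part (p, q)"
      using LC_cover_pullbacks(4)[OF pq(1)] by (simp add: pq(2) Q_def rad_def spin_def nrm)
    moreover have "A t + Q t = quad_part c (p, q) - quart_part (p, q)"
      using LC_cover_pullbacks(3)[OF pq(1), of c] by (simp add: pq(2) A_def Q_def reg_ham_def spin_def nrm algebra_simps)
    ultimately show "(A t)\<^sup>2 + 4 * Q t > 0" "A t > 0" using discriminant_pos[OF c pq(1)] by simp_all
  qed
  define s where "s = (\<lambda>t. 2 / (A t + sqrt ((A t)\<^sup>2 + 4 * Q t)))"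
  have "A 0 + Q 0 = 1" "1 + Q 0 > 0"
    using z unfolding Sigma_R_iff[OF c] by (simp_all add: A_def Q_def reg_ham_def rad_def spin_def xy0 algebra_simps)
  moreover have "(A 0)\<^sup>2 + 4 * Q 0 = (1 + Q 0)\<^sup>2"
  proof -
    have a: "A 0 = 1 - Q 0" using calculation by simp
    show ?thesis unfolding a by (simp add: power2_eq_square algebra_simps)
  qed
  ultimately have s0: "s 0 = 1" by (simp add: s_def)
  have onS: "(x t, s t *\<^sub>R y t) \<in> Sigma_R c" for t
  proof -
    have r: "s t > 0" "A t * s t + Q t * (s t)\<^sup>2 = 1" "1 + Q t * (s t)\<^sup>2 > 0"
      using smaller_root[of "A t" "- Q t"] disc[of t] by (simp_all add: s_def)
    have "reg_ham c (x t, s t *\<^sub>R y t) = A t * s t + Q t * (s t)\<^sup>2"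
      using r(1) by (simp add: reg_ham_def spin_def A_def Q_def nrm power2_eq_square algebra_simps)
    moreover have "rad (x t, s t *\<^sub>R y t) * spin (x t, s t *\<^sub>R y t) = Q t * (s t)\<^sup>2"
      using r(1) by (simp add: rad_def spin_def Q_def nrm power2_eq_square algebra_simps)
    moreover have "(x t, s t *\<^sub>R y t) \<in> cotangent_sphere" using cot[of t] by (simp add: cotangent_sphere_def)
    ultimately show ?thesis unfolding Sigma_R_iff[OF c] using r by simp
  qed
  note nx = has_real_derivative_nth[OF x] and ny = has_real_derivative_nth[OF y]
  have "\<exists>k. (s has_real_derivative k) (at 0)"
  proof -
    have "\<exists>A'. (A has_real_derivative A') (at 0)" "\<exists>Q'. (Q has_real_derivative Q') (at 0)"
      unfolding A_def Q_def by (rule exI, (rule derivative_eq_intros nx ny refl)+)+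
    then obtain A' Q' where AQ: "(A has_real_derivative A') (at 0)" "(Q has_real_derivative Q') (at 0)" by blast
    have pos: "A 0 * A 0 + 4 * Q 0 > 0" "A 0 + sqrt (A 0 * A 0 + 4 * Q 0) \<noteq> 0"
      using disc[of 0] by (simp_all add: power2_eq_square add_pos_nonneg less_imp_neq[THEN not_sym])
    have "((\<lambda>x. A x * A x + 4 * Q x) has_real_derivative A' * A 0 + A' * A 0 + 4 * Q') (at 0)"
      by (rule derivative_eq_intros AQ refl | simp)+
    from DERIV_divide[OF DERIV_const DERIV_add[OF AQ(1) DERIV_chain2[OF DERIV_real_sqrt[OF pos(1)] this]] pos(2)]
    show ?thesis unfolding s_def power2_eq_square by blast
  qed
  then obtain k where k: "(s has_real_derivative k) (at 0)" by blast
  have "((\<lambda>t. s t *\<^sub>R y t) has_vector_derivative s 0 *\<^sub>R b + k *\<^sub>R y 0) (at 0)"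
    by (rule has_vector_derivative_scaleR[OF k y])
  then have "((\<lambda>t. (x t, s t *\<^sub>R y t)) has_vector_derivative (a, b + k *\<^sub>R \<eta>)) (at 0)"
    using x by (intro has_vector_derivative_Pair) (auto simp: s0 xy0)
  then show ?thesis
    unfolding tangent_vectors_def using onS
    by (intro exI[of _ k] CollectI exI[of _ "\<lambda>t. (x t, s t *\<^sub>R y t)"] exI[of _ 1]) (simp add: xy0 s0)
qed

lemma norm_rotation:
  fixes u v :: "'a::real_inner"
  assumes "u \<bullet> v = 0" "norm v = norm u"
  shows "norm (cos t *\<^sub>R u + sin t *\<^sub>R v) = norm u"
proof (rule power2_eq_imp_eq)
  have o: "(cos t *\<^sub>R u) \<bullet> (sin t *\<^sub>R v) = 0" using assms by simp
  have "(norm (cos t *\<^sub>R u + sin t *\<^sub>R v))\<^sup>2 = ((cos t)\<^sup>2 + (sin t)\<^sup>2) * (norm u)\<^sup>2"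
    unfolding norm_add_orthogonal[OF o] norm_scaleR power_mult_distrib power2_abs assms(2) distrib_right ..
  then show "(norm (cos t *\<^sub>R u + sin t *\<^sub>R v))\<^sup>2 = (norm u)\<^sup>2" by simp
qed auto

lemma norm_cross_orthogonal:
  assumes "norm \<xi> = 1" "\<xi> \<bullet> \<eta> = 0"
  shows "norm (cross3 \<xi> \<eta>) = norm \<eta>"
  using norm_cross[of \<xi> \<eta>] assms by (auto intro: power2_eq_imp_eq)

lemma fibre_rotation_tangent:
  assumes c: "c > 3 / 2" and z: "(\<xi>, \<eta>) \<in> Sigma_R c"
  shows "\<exists>k. (0, cross3 \<xi> \<eta> + k *\<^sub>R \<eta>) \<in> tangent_vectors (Sigma_R c) (\<xi>, \<eta>)"
proof (rule rescaled_curve_tangent[OF c z, where x = "\<lambda>t. \<xi>" and y = "\<lambda>t. cos t *\<^sub>R \<eta> + sin t *\<^sub>R (cross3 \<xi> \<eta>)"])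
  note S0 = Sigma_R_facts[OF c z]
  show "((\<lambda>t. cos t *\<^sub>R \<eta> + sin t *\<^sub>R (cross3 \<xi> \<eta>)) has_vector_derivative cross3 \<xi> \<eta>) (at 0)"
    by (auto intro!: derivative_eq_intros)
  show "(\<xi>, cos t *\<^sub>R \<eta> + sin t *\<^sub>R (cross3 \<xi> \<eta>)) \<in> cotangent_sphere" for t
    using S0 by (simp add: cotangent_sphere_def inner_add_right dot_cross_self)
  show "norm (cos t *\<^sub>R \<eta> + sin t *\<^sub>R (cross3 \<xi> \<eta>)) = norm \<eta>" for t
    by (rule norm_rotation) (simp_all add: dot_cross_self norm_cross_orthogonal S0(1,2))
qed auto

lemma base_rotation_tangent:
  assumes c: "c > 3 / 2" and z: "(\<xi>, \<eta>) \<in> Sigma_R c"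
  shows "\<exists>k. ((1 / norm \<eta>) *\<^sub>R (cross3 \<xi> \<eta>), k *\<^sub>R \<eta>) \<in> tangent_vectors (Sigma_R c) (\<xi>, \<eta>)"
proof -
  note S0 = Sigma_R_facts[OF c z]
  have "\<exists>k. ((1 / norm \<eta>) *\<^sub>R (cross3 \<xi> \<eta>), 0 + k *\<^sub>R \<eta>) \<in> tangent_vectors (Sigma_R c) (\<xi>, \<eta>)"
  proof (rule rescaled_curve_tangent[OF c z, where y = "\<lambda>t. \<eta>" and x = "\<lambda>t. cos t *\<^sub>R \<xi> + sin t *\<^sub>R ((1 / norm \<eta>) *\<^sub>R (cross3 \<xi> \<eta>))"])
    show "((\<lambda>t. cos t *\<^sub>R \<xi> + sin t *\<^sub>R ((1 / norm \<eta>) *\<^sub>R (cross3 \<xi> \<eta>))) has_vector_derivative (1 / norm \<eta>) *\<^sub>R (cross3 \<xi> \<eta>)) (at 0)"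
      using S0(3) by (auto intro!: derivative_eq_intros)
    show "(cos t *\<^sub>R \<xi> + sin t *\<^sub>R ((1 / norm \<eta>) *\<^sub>R (cross3 \<xi> \<eta>)), \<eta>) \<in> cotangent_sphere" for t
    proof -
      have "norm (cos t *\<^sub>R \<xi> + sin t *\<^sub>R ((1 / norm \<eta>) *\<^sub>R (cross3 \<xi> \<eta>))) = norm \<xi>"
        by (rule norm_rotation) (use S0(3) in \<open>simp_all add: dot_cross_self norm_cross_orthogonal S0(1,2)\<close>)
      then show ?thesis using S0 by (simp add: cotangent_sphere_def inner_add_left dot_cross_self)
    qed
  qed auto
  then show ?thesis by simp
qed

lemma orthogonal_frame_eq_0:
  fixes d \<xi> \<eta> :: "real^3"
  assumes "\<xi> \<bullet> \<eta> = 0" "\<xi> \<noteq> 0" "\<eta> \<noteq> 0" "d \<bullet> \<xi> = 0" "d \<bullet> \<eta> = 0" "d \<bullet> (cross3 \<xi> \<eta>) = 0"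
  shows "d = 0"
proof -
  have "cross3 d (cross3 \<xi> \<eta>) = 0" unfolding Lagrange using assms by (simp add: inner_commute)
  then have "(norm d)\<^sup>2 * (norm (cross3 \<xi> \<eta>))\<^sup>2 = 0"
    using norm_cross[of d "cross3 \<xi> \<eta>"] assms by simp
  moreover have "(norm (cross3 \<xi> \<eta>))\<^sup>2 = (norm \<xi>)\<^sup>2 * (norm \<eta>)\<^sup>2" using norm_cross[of \<xi> \<eta>] assms by simp
  ultimately show ?thesis using assms by simp
qed

text \<open>The difference \<open>(a, b)\<close> of two candidates is annihilated by the Liouville form and by its exterior
  derivative on tangent vectors. Testing against the rotation of the fibre kills \<open>a\<close>, testing against
  the rotation of the base point in the plane orthogonal to \<open>\<eta>\<close> leaves a multiple of \<open>\<eta>\<close> for \<open>b\<close>, and that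
  multiple is not tangent because \<open>reeb_speed\<close> does not vanish.\<close>
lemma reeb_field_eq:
  assumes c: "c > 3 / 2" and z: "\<zeta> \<in> Sigma_R c"
    and t: "(1 / reeb_speed \<zeta>) *\<^sub>R reg_field c \<zeta> \<in> tangent_vectors (Sigma_R c) \<zeta>"
  shows "reeb_field (Sigma_R c) lambda_can \<zeta> = (1 / reeb_speed \<zeta>) *\<^sub>R reg_field c \<zeta>"
proof -
  obtain \<xi> \<eta> where ze: "\<zeta> = (\<xi>, \<eta>)" by force
  note S0 = Sigma_R_facts[OF c z[unfolded ze]]
  let ?R = "(1 / reeb_speed \<zeta>) *\<^sub>R reg_field c \<zeta>"
  have lam1: "lambda_can \<zeta> ?R = 1"
    using lambda_can_reg_field[OF S0(3), of \<xi> c] S0(4) by (simp add: ze lambda_can_def case_prod_beta)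
  have dlam: "dp_dq ?R W = 0" if "W \<in> tangent_vectors (Sigma_R c) \<zeta>" for W
    using dp_dq_reg_field[of c \<xi> \<eta> W] tangent_vectors_eqs[OF c z that]
    by (simp add: ze dp_dq_def case_prod_beta inner_scaleR_left inner_scaleR_right flip: right_diff_distrib)
  show ?thesis
    unfolding reeb_field_def ext_deriv_lambda_can
  proof (rule the_equality)
    show "?R \<in> tangent_vectors (Sigma_R c) \<zeta> \<and> lambda_can \<zeta> ?R = 1 \<and>
      (\<forall>w\<in>tangent_vectors (Sigma_R c) \<zeta>. dp_dq ?R w = 0)" using t lam1 dlam by blast
    fix v assume v: "v \<in> tangent_vectors (Sigma_R c) \<zeta> \<and> lambda_can \<zeta> v = 1 \<and>
      (\<forall>w\<in>tangent_vectors (Sigma_R c) \<zeta>. dp_dq v w = 0)"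
    define d where "d = v - ?R"
    obtain a b where ab: "d = (a, b)" by force
    have eqs: "tangent_eqs c \<zeta> d"
      unfolding d_def using tangent_eqs_diff tangent_vectors_eqs[OF c z] v t by blast
    have lamd: "\<eta> \<bullet> a = 0"
    proof -
      have "lambda_can \<zeta> d = lambda_can \<zeta> v - lambda_can \<zeta> ?R"
        by (simp add: d_def lambda_can_def case_prod_beta inner_diff_right)
      then have "lambda_can \<zeta> d = 0" using v lam1 by simp
      then show ?thesis by (simp add: lambda_can_def ze ab)
    qed
    have dd: "b \<bullet> u - w \<bullet> a = 0" if "(u, w) \<in> tangent_vectors (Sigma_R c) \<zeta>" for u w
    proof -
      have "dp_dq d (u, w) = dp_dq v (u, w) - dp_dq ?R (u, w)"
        unfolding d_def dp_dq_def case_prod_beta fst_diff snd_diff inner_diff_left inner_diff_right by simp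
      then have "dp_dq d (u, w) = 0" using v dlam that by simp
      then show ?thesis by (simp add: dp_dq_def ab)
    qed
    have \<xi>a: "\<xi> \<bullet> a = 0" and ab0: "a \<bullet> \<eta> + \<xi> \<bullet> b = 0" using eqs by (auto simp: tangent_eqs_def ze ab)
    have \<xi>0: "\<xi> \<noteq> 0" using S0(1) by auto
    obtain k where k: "(0, cross3 \<xi> \<eta> + k *\<^sub>R \<eta>) \<in> tangent_vectors (Sigma_R c) \<zeta>"
      using fibre_rotation_tangent[OF c z[unfolded ze]] ze by blast
    have a0: "a = 0"
      by (rule orthogonal_frame_eq_0[OF S0(2) \<xi>0 S0(3)])
        (use dd[OF k] \<xi>a lamd in \<open>simp_all add: inner_commute inner_add_right inner_add_left\<close>)
    obtain k where k: "((1 / norm \<eta>) *\<^sub>R (cross3 \<xi> \<eta>), k *\<^sub>R \<eta>) \<in> tangent_vectors (Sigma_R c) \<zeta>"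
      using base_rotation_tangent[OF c z[unfolded ze]] ze by blast
    have b1: "b \<bullet> (cross3 \<xi> \<eta>) = 0" using dd[OF k] a0 S0(3) by simp
    define \<beta> where "\<beta> = (\<eta> \<bullet> b) / (norm \<eta>)\<^sup>2"
    have "b - \<beta> *\<^sub>R \<eta> = 0"
    proof (rule orthogonal_frame_eq_0[OF S0(2) \<xi>0 S0(3)])
      show "(b - \<beta> *\<^sub>R \<eta>) \<bullet> \<xi> = 0"
        using ab0 a0 S0(2) by (simp add: inner_diff_left inner_commute[of \<eta>] inner_commute[of b])
      show "(b - \<beta> *\<^sub>R \<eta>) \<bullet> \<eta> = 0"
        using S0(3) by (simp add: inner_diff_left \<beta>_def inner_commute[of b] dot_square_norm)
      show "(b - \<beta> *\<^sub>R \<eta>) \<bullet> (cross3 \<xi> \<eta>) = 0" using b1 by (simp add: inner_diff_left dot_cross_self)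
    qed
    then have b: "b = \<beta> *\<^sub>R \<eta>" by simp
    have "\<beta> + rad \<zeta> * (\<xi>$2 * b$1 - \<xi>$1 * b$2) = 0"
      using eqs a0 by (simp add: tangent_eqs_def ze ab \<beta>_def)
    then have "\<beta> * reeb_speed \<zeta> = 0" unfolding b by (simp add: reeb_speed_def ze spin_def algebra_simps)
    then have "\<beta> = 0" using S0(4) ze by simp
    then have "d = 0" using a0 b by (simp add: ab zero_prod_def)
    then show "v = ?R" by (simp add: d_def)
  qed
qed

section \<open>The equations of motion on the double cover\<close>

lemma has_vector_derivative_cis:
  assumes "(f has_real_derivative f') (at s)"
  shows "((\<lambda>s. cis (f s)) has_vector_derivative f' *\<^sub>R (\<i> * cis (f s))) (at s)"
  unfolding has_vector_derivative_complex_iff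
  by (auto intro!: derivative_eq_intros assms)

text \<open>In Levi-Civita coordinates the regularised motion is linear up to a rotation: in the time \<open>s\<close> with
  \<open>dt = norm q ds\<close> the Kepler motion of energy \<open>E = ang_mom - c\<close> satisfies \<open>z' = w / 2\<close> and \<open>w' = E z\<close>, and the
  rotating frame adds a rotation with angular velocity \<open>- norm q / 2\<close>. Both sides are computed in real
  coordinates.\<close>
lemma LC_cover_has_derivative:
  fixes z w :: "real \<Rightarrow> complex"
  assumes lev: "(z s, w s) \<in> LC_level c"
    and z: "(z has_vector_derivative w s / 2 - \<i> * (cmod (z s))\<^sup>2 * z s / 2) (at s)"
    and w: "(w has_vector_derivative (ang_mom (z s, w s) - c) * z s - \<i> * (cmod (z s))\<^sup>2 * w s / 2) (at s)"
  shows "((\<lambda>s. LC_cover (z s, w s)) has_vector_derivative reg_field c (LC_cover (z s, w s))) (at s)"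
proof -
  define a b d e where "a = (\<lambda>s. Re (z s))" and "b = (\<lambda>s. Im (z s))"
    and "d = (\<lambda>s. Re (w s))" and "e = (\<lambda>s. Im (w s))"
  define N where "N = (\<lambda>s. (a s)\<^sup>2 + (b s)\<^sup>2 + ((d s)\<^sup>2 + (e s)\<^sup>2))"
  define n where "n = (a s)\<^sup>2 + (b s)\<^sup>2"
  define E where "E = a s * e s - b s * d s - c"
  have cz: "(cmod (z s))\<^sup>2 = (a s)\<^sup>2 + (b s)\<^sup>2" and cw: "(cmod (w s))\<^sup>2 = (d s)\<^sup>2 + (e s)\<^sup>2" for s
    by (simp_all add: cmod_power2 a_def b_def d_def e_def)
  have ang_mom: "ang_mom (z s, w s) = a s * e s - b s * d s"
    by (simp add: ang_mom_def a_def b_def d_def e_def)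
  \<comment> \<open>The level equation; it is used below to make \<open>4 h\<^sub>i = 4 h\<^sub>i * 1\<close> homogeneous.\<close>
  have one: "((d s)\<^sup>2 + (e s)\<^sup>2) / 2 - E * n = 1"
    using lev by (simp add: LC_level_def quad_part_def quart_part_def ang_mom cz cw n_def E_def algebra_simps)
  have nz: "(z s, w s) \<noteq> 0" using lev LC_level_nonzero by blast
  then have N0: "N s > 0" using LC_size_pos[OF nz] by (simp add: N_def cz cw)
  have da: "(a has_real_derivative d s / 2 + n * b s / 2) (at s)"
    and db: "(b has_real_derivative e s / 2 - n * a s / 2) (at s)"
    using z unfolding has_vector_derivative_complex_iff cz
    by (simp_all add: a_def b_def d_def e_def n_def)
  have dd: "(d has_real_derivative E * a s + n * e s / 2) (at s)"
    and de: "(e has_real_derivative E * b s - n * d s / 2) (at s)"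
    using w unfolding has_vector_derivative_complex_iff cz ang_mom
    by (simp_all add: a_def b_def d_def e_def n_def E_def)
  note ders = da db dd de
  have Leq: "LC_cover (z s, w s) =
     (vector [2 * (d s * a s - e s * b s) / N s, 2 * (d s * b s + e s * a s) / N s, ((d s)\<^sup>2 + (e s)\<^sup>2 - ((a s)\<^sup>2 + (b s)\<^sup>2)) / N s],
      vector [((d s)\<^sup>2 - (e s)\<^sup>2 - (a s)\<^sup>2 + (b s)\<^sup>2) / 2, d s * e s - a s * b s, - (a s * d s + b s * e s)])" for s
    unfolding LC_cover_def prod.case cz cw prod.inject eq_real3_iff
    by (simp add: N_def a_def b_def d_def e_def power2_eq_square field_simps)
  define P1 P2 P3 where "P1 = 2 * (d s * a s - e s * b s)" and "P2 = 2 * (d s * b s + e s * a s)"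
    and "P3 = (d s)\<^sup>2 + (e s)\<^sup>2 - ((a s)\<^sup>2 + (b s)\<^sup>2)"
  define h1 h2 h3 where "h1 = ((d s)\<^sup>2 - (e s)\<^sup>2 - (a s)\<^sup>2 + (b s)\<^sup>2) / 2" and "h2 = d s * e s - a s * b s"
    and "h3 = - (a s * d s + b s * e s)"
  have Ls: "LC_cover (z s, w s) = (vector [P1 / N s, P2 / N s, P3 / N s], vector [h1, h2, h3])"
    unfolding Leq P1_def P2_def P3_def h1_def h2_def h3_def by simp
  have nrm: "norm (vector [h1, h2, h3] :: real^3) = N s / 2"
    using norm_snd_LC_cover[of "z s" "w s"] unfolding Ls by (simp add: N_def cz cw)
  have sp: "spin (vector [P1 / N s, P2 / N s, P3 / N s], vector [h1, h2, h3]) = - (E + c)"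
    using LC_cover_pullbacks(1)[OF nz] unfolding Ls ang_mom by (simp add: E_def)
  have rd: "rad (vector [P1 / N s, P2 / N s, P3 / N s], vector [h1, h2, h3]) = n"
    using LC_cover_pullbacks(2)[OF nz] unfolding Ls fst_conv cz by (simp add: n_def)
  have dN: "(N has_real_derivative (1 + 2 * E) * (a s * d s + b s * e s)) (at s)"
    unfolding N_def by (rule derivative_eq_intros ders refl | simp add: power2_eq_square algebra_simps)+
  let ?N' = "(1 + 2 * E) * (a s * d s + b s * e s)"
  have quo: "(4 * h * 1 + m * P * N s) / (N s * N s) = h / (N s / 2)\<^sup>2 + m * (P / N s)" for h m P
    using N0 by (simp add: field_simps power2_eq_square)
  have x1: "((\<lambda>s. 2 * (d s * a s - e s * b s) / N s) has_real_derivative h1 / (N s / 2)\<^sup>2 + n * (P2 / N s)) (at s)"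
  proof (rule DERIV_cong)
    let ?D = "2 * ((E * a s + n * e s / 2) * a s + d s * (d s / 2 + n * b s / 2) - (E * b s - n * d s / 2) * b s - e s * (e s / 2 - n * a s / 2))"
    have "((\<lambda>s. 2 * (d s * a s - e s * b s)) has_real_derivative ?D) (at s)"
      by (rule derivative_eq_intros ders refl | simp add: algebra_simps)+
    then show "((\<lambda>s. 2 * (d s * a s - e s * b s) / N s) has_real_derivative
      (?D * N s - P1 * ?N') / (N s * N s)) (at s)"
      using DERIV_divide[OF _ dN] N0 by (auto simp: P1_def)
    have e: "?D * N s - P1 * ?N' = 4 * h1 * (((d s)\<^sup>2 + (e s)\<^sup>2) / 2 - E * n) + n * P2 * N s"
      unfolding N_def P1_def P2_def h1_def n_def by (simp add: field_simps power2_eq_square)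
    show "(?D * N s - P1 * ?N') / (N s * N s) = h1 / (N s / 2)\<^sup>2 + n * (P2 / N s)"
      unfolding e one quo by simp
  qed
  have x2: "((\<lambda>s. 2 * (d s * b s + e s * a s) / N s) has_real_derivative h2 / (N s / 2)\<^sup>2 - n * (P1 / N s)) (at s)"
  proof (rule DERIV_cong)
    let ?D = "2 * ((E * a s + n * e s / 2) * b s + d s * (e s / 2 - n * a s / 2) + (E * b s - n * d s / 2) * a s + e s * (d s / 2 + n * b s / 2))"
    have "((\<lambda>s. 2 * (d s * b s + e s * a s)) has_real_derivative ?D) (at s)"
      by (rule derivative_eq_intros ders refl | simp add: algebra_simps)+
    then show "((\<lambda>s. 2 * (d s * b s + e s * a s) / N s) has_real_derivative
      (?D * N s - P2 * ?N') / (N s * N s)) (at s)"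
      using DERIV_divide[OF _ dN] N0 by (auto simp: P2_def)
    have e: "?D * N s - P2 * ?N' = 4 * h2 * (((d s)\<^sup>2 + (e s)\<^sup>2) / 2 - E * n) + (- n) * P1 * N s"
      unfolding N_def P1_def P2_def h2_def n_def by (simp add: field_simps power2_eq_square)
    show "(?D * N s - P2 * ?N') / (N s * N s) = h2 / (N s / 2)\<^sup>2 - n * (P1 / N s)"
      unfolding e one quo by simp
  qed
  have x3: "((\<lambda>s. ((d s)\<^sup>2 + (e s)\<^sup>2 - ((a s)\<^sup>2 + (b s)\<^sup>2)) / N s) has_real_derivative h3 / (N s / 2)\<^sup>2) (at s)"
  proof (rule DERIV_cong)
    let ?D = "(2 * E - 1) * (a s * d s + b s * e s)"
    have "((\<lambda>s. (d s)\<^sup>2 + (e s)\<^sup>2 - ((a s)\<^sup>2 + (b s)\<^sup>2)) has_real_derivative ?D) (at s)"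
      by (rule derivative_eq_intros ders refl | simp add: algebra_simps)+
    then show "((\<lambda>s. ((d s)\<^sup>2 + (e s)\<^sup>2 - ((a s)\<^sup>2 + (b s)\<^sup>2)) / N s) has_real_derivative
      (?D * N s - P3 * ?N') / (N s * N s)) (at s)"
      using DERIV_divide[OF _ dN] N0 by (auto simp: P3_def)
    have e: "?D * N s - P3 * ?N' = 4 * h3 * (((d s)\<^sup>2 + (e s)\<^sup>2) / 2 - E * n) + 0 * P3 * N s"
      unfolding N_def P3_def h3_def n_def by (simp add: field_simps power2_eq_square)
    show "(?D * N s - P3 * ?N') / (N s * N s) = h3 / (N s / 2)\<^sup>2"
      unfolding e one quo by simp
  qed
  \<comment> \<open>The coefficient of \<open>e\<^sub>3 - \<xi>\<^sub>3 \<xi>\<close> in \<open>reg_field\<close>.\<close>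
  define K where "K = N s / 2 * (c - 1 / 2 + - (E + c))"
  have K: "K = - (N s * (2 * E + 1)) / 4" by (simp add: K_def field_simps)
  have key: "(2 * E - 1) * N s = (2 * E + 1) * P3 - 4"
  proof -
    have "(2 * E - 1) * N s = (2 * E + 1) * P3 - 4 * (((d s)\<^sup>2 + (e s)\<^sup>2) / 2 - E * n)"
      unfolding N_def P3_def n_def by (simp add: field_simps)
    then show ?thesis unfolding one by simp
  qed
  have KP: "- (P / N s) + K * (- (P3 / N s) * (P / N s)) = (2 * E - 1) * P / 4" for P
  proof -
    have "- (P / N s) + K * (- (P3 / N s) * (P / N s)) = ((2 * E + 1) * P3 - 4) * (P / (4 * N s))"
      unfolding K using N0 by (simp add: field_simps)
    also have "\<dots> = (2 * E - 1) * P / 4" unfolding key[symmetric] using N0 by simp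
    finally show ?thesis .
  qed
  have y1: "((\<lambda>s. ((d s)\<^sup>2 - (e s)\<^sup>2 - (a s)\<^sup>2 + (b s)\<^sup>2) / 2) has_real_derivative
      - (P1 / N s) + K * (- (P3 / N s) * (P1 / N s)) + n * h2) (at s)"
    unfolding KP P1_def h2_def by (rule derivative_eq_intros ders refl | simp add: power2_eq_square field_simps)+
  have y2: "((\<lambda>s. d s * e s - a s * b s) has_real_derivative
      - (P2 / N s) + K * (- (P3 / N s) * (P2 / N s)) - n * h1) (at s)"
    unfolding KP P2_def h1_def by (rule derivative_eq_intros ders refl | simp add: power2_eq_square field_simps)+
  have y3: "((\<lambda>s. - (a s * d s + b s * e s)) has_real_derivative
      - (P3 / N s) + K * (1 - (P3 / N s) * (P3 / N s))) (at s)"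
  proof (rule DERIV_cong)
    show "((\<lambda>s. - (a s * d s + b s * e s)) has_real_derivative - (((d s)\<^sup>2 + (e s)\<^sup>2) / 2 + E * n)) (at s)"
      unfolding n_def by (rule derivative_eq_intros ders refl | simp add: n_def power2_eq_square field_simps)+
    have "- (P3 / N s) + K * (1 - (P3 / N s) * (P3 / N s)) = (2 * E - 1) * P3 / 4 + K"
      unfolding KP[symmetric] by (simp add: algebra_simps)
    also have "\<dots> = - (((d s)\<^sup>2 + (e s)\<^sup>2) / 2 + E * n)"
      unfolding K P3_def N_def n_def by (simp add: field_simps)
    finally show "- (((d s)\<^sup>2 + (e s)\<^sup>2) / 2 + E * n) = - (P3 / N s) + K * (1 - (P3 / N s) * (P3 / N s))" by simp
  qed
  have "reg_field c (LC_cover (z s, w s)) =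
    (vector [h1 / (N s / 2)\<^sup>2 + n * (P2 / N s), h2 / (N s / 2)\<^sup>2 - n * (P1 / N s), h3 / (N s / 2)\<^sup>2],
     vector [- (P1 / N s) + K * (- (P3 / N s) * (P1 / N s)) + n * h2,
       - (P2 / N s) + K * (- (P3 / N s) * (P2 / N s)) - n * h1,
       - (P3 / N s) + K * (1 - (P3 / N s) * (P3 / N s))])"
    unfolding Ls reg_field_def prod.case nrm sp rd K_def[symmetric] prod.inject eq_real3_iff
    by (simp add: axis_def)
  then show ?thesis
    unfolding Leq by (simp only:) (intro has_vector_derivative_Pair has_vector_derivative_vector3 x1 x2 x3 y1 y2 y3)
qed

section \<open>Uniqueness of Reeb orbits\<close>

text \<open>Gronwall: the squared distance \<open>D\<close> of the curves satisfies \<open>\<bar>D'\<bar> \<le> 2 L D\<close>, so that \<open>exp (- 2 L t) D\<close> is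
  nonincreasing and \<open>exp (2 L t) D\<close> is nondecreasing.\<close>
lemma integral_curve_unique:
  fixes X :: "'a::euclidean_space \<Rightarrow> 'a"
  assumes L: "\<And>x y. x \<in> S \<Longrightarrow> y \<in> S \<Longrightarrow> norm (X x - X y) \<le> L * norm (x - y)"
    and a: "integral_curve_on X S \<alpha>" and b: "integral_curve_on X S \<beta>" and 0: "\<alpha> 0 = \<beta> 0"
  shows "\<alpha> t = \<beta> t"
proof -
  define D where "D = (\<lambda>t. (\<alpha> t - \<beta> t) \<bullet> (\<alpha> t - \<beta> t))"
  define D' where "D' = (\<lambda>t. 2 * ((\<alpha> t - \<beta> t) \<bullet> (X (\<alpha> t) - X (\<beta> t))))"
  have dD: "(D has_real_derivative D' t) (at t)" for t
  proof -
    have "((\<lambda>t. \<alpha> t - \<beta> t) has_vector_derivative X (\<alpha> t) - X (\<beta> t)) (at t)"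
      using a b by (intro has_vector_derivative_diff) (auto simp: integral_curve_on_def)
    from has_real_derivative_inner[OF this this] show ?thesis
      unfolding D_def D'_def by (rule DERIV_cong) (simp add: inner_commute)
  qed
  have bound: "\<bar>D' t\<bar> \<le> 2 * L * D t" for t
  proof -
    have S: "\<alpha> t \<in> S" "\<beta> t \<in> S" using a b by (auto simp: integral_curve_on_def)
    have "\<bar>(\<alpha> t - \<beta> t) \<bullet> (X (\<alpha> t) - X (\<beta> t))\<bar> \<le> norm (\<alpha> t - \<beta> t) * norm (X (\<alpha> t) - X (\<beta> t))"
      by (rule Cauchy_Schwarz_ineq2)
    also have "\<dots> \<le> norm (\<alpha> t - \<beta> t) * (L * norm (\<alpha> t - \<beta> t))"
      by (intro mult_left_mono L S) auto
    also have "\<dots> = L * D t" by (simp add: D_def dot_square_norm power2_eq_square)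
    finally show ?thesis by (simp add: D'_def abs_mult)
  qed
  have D0: "D 0 = 0" "D t \<ge> 0" for t by (simp_all add: D_def 0)
  have "D t = 0"
  proof (cases "t \<ge> 0")
    case True
    have "exp (- 2 * L * t) * D t \<le> exp (- 2 * L * 0) * D 0"
    proof (rule DERIV_nonpos_imp_nonincreasing[OF True])
      fix s
      have "((\<lambda>t. exp (- 2 * L * t) * D t) has_real_derivative exp (- 2 * L * s) * (D' s - 2 * L * D s)) (at s)"
        by (rule derivative_eq_intros dD refl | simp add: algebra_simps)+
      moreover have "exp (- 2 * L * s) * (D' s - 2 * L * D s) \<le> 0"
        using bound[of s] by (intro mult_nonneg_nonpos) auto
      ultimately show "\<exists>y. ((\<lambda>t. exp (- 2 * L * t) * D t) has_real_derivative y) (at s) \<and> y \<le> 0" by blast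
    qed
    then have "exp (- 2 * L * t) * D t \<le> 0" by (simp add: D0)
    then have "D t \<le> 0" by (simp add: mult_le_0_iff not_le[symmetric])
    then show ?thesis using D0(2)[of t] by simp
  next
    case False
    then have t: "t \<le> 0" by simp
    have "exp (2 * L * t) * D t \<le> exp (2 * L * 0) * D 0"
    proof (rule DERIV_nonneg_imp_nondecreasing[OF t])
      fix s
      have "((\<lambda>t. exp (2 * L * t) * D t) has_real_derivative exp (2 * L * s) * (D' s + 2 * L * D s)) (at s)"
        by (rule derivative_eq_intros dD refl | simp add: algebra_simps)+
      moreover have "exp (2 * L * s) * (D' s + 2 * L * D s) \<ge> 0"
        using bound[of s] by (intro mult_nonneg_nonneg) auto
      ultimately show "\<exists>y. ((\<lambda>t. exp (2 * L * t) * D t) has_real_derivative y) (at s) \<and> 0 \<le> y" by blast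
    qed
    then have "exp (2 * L * t) * D t \<le> 0" by (simp add: D0)
    then have "D t \<le> 0" by (simp add: mult_le_0_iff not_le[symmetric])
    then show ?thesis using D0(2)[of t] by simp
  qed
  then show ?thesis by (simp add: D_def)
qed

text \<open>Unlike the Lipschitz functions alone, the bounded ones are closed under products.\<close>
definition bounded_lipschitz :: "'a::real_normed_vector set \<Rightarrow> ('a \<Rightarrow> 'b::real_normed_vector) \<Rightarrow> bool" where
  "bounded_lipschitz S f \<longleftrightarrow> (\<exists>B. \<forall>x\<in>S. norm (f x) \<le> B) \<and> (\<exists>L. \<forall>x\<in>S. \<forall>y\<in>S. norm (f x - f y) \<le> L * norm (x - y))"

lemma bounded_lipschitz_const: "bounded_lipschitz S (\<lambda>x. k)"
  unfolding bounded_lipschitz_def by (auto intro: exI[of _ 0] exI[of _ "norm k"])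

lemma bounded_lipschitz_id:
  assumes "bounded S"
  shows "bounded_lipschitz S (\<lambda>x. x)"
proof -
  obtain B where "\<forall>x\<in>S. norm x \<le> B" using assms unfolding bounded_iff by blast
  then show ?thesis unfolding bounded_lipschitz_def by (auto intro: exI[of _ 1])
qed

lemma bounded_lipschitz_linear:
  assumes "bounded_linear g" and "bounded_lipschitz S f"
  shows "bounded_lipschitz S (\<lambda>x. g (f x))"
proof -
  interpret g: bounded_linear g by fact
  obtain K where K: "K \<ge> 0" "\<And>x. norm (g x) \<le> norm x * K" using g.nonneg_bounded by blast
  obtain B L where B: "\<And>x. x \<in> S \<Longrightarrow> norm (f x) \<le> B" and L: "\<And>x y. x \<in> S \<Longrightarrow> y \<in> S \<Longrightarrow> norm (f x - f y) \<le> L * norm (x - y)"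
    using assms(2) unfolding bounded_lipschitz_def by blast
  have "norm (g (f x)) \<le> B * K" if "x \<in> S" for x
    using K(2)[of "f x"] mult_right_mono[OF B[OF that] K(1)] by linarith
  moreover have "norm (g (f x) - g (f y)) \<le> (L * K) * norm (x - y)" if "x \<in> S" "y \<in> S" for x y
    using K(2)[of "f x - f y"] mult_right_mono[OF L[OF that] K(1)] by (simp add: g.diff mult_ac)
  ultimately show ?thesis unfolding bounded_lipschitz_def by blast
qed

lemma bounded_lipschitz_add:
  assumes "bounded_lipschitz S f" "bounded_lipschitz S g"
  shows "bounded_lipschitz S (\<lambda>x. f x + g x)"
proof -
  obtain B L where B: "\<And>x. x \<in> S \<Longrightarrow> norm (f x) \<le> B" and L: "\<And>x y. x \<in> S \<Longrightarrow> y \<in> S \<Longrightarrow> norm (f x - f y) \<le> L * norm (x - y)"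
    using assms(1) unfolding bounded_lipschitz_def by blast
  obtain B' L' where B': "\<And>x. x \<in> S \<Longrightarrow> norm (g x) \<le> B'" and L': "\<And>x y. x \<in> S \<Longrightarrow> y \<in> S \<Longrightarrow> norm (g x - g y) \<le> L' * norm (x - y)"
    using assms(2) unfolding bounded_lipschitz_def by blast
  have "norm (f x + g x) \<le> B + B'" if "x \<in> S" for x
    using norm_triangle_le[OF add_mono[OF B[OF that] B'[OF that]]] .
  moreover have "norm ((f x + g x) - (f y + g y)) \<le> (L + L') * norm (x - y)" if "x \<in> S" "y \<in> S" for x y
    using norm_triangle_le[OF add_mono[OF L[OF that] L'[OF that]]] by (simp add: algebra_simps)
  ultimately show ?thesis unfolding bounded_lipschitz_def by blast
qed

lemma bounded_lipschitz_bilinear: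
  assumes "bounded_bilinear h" and "bounded_lipschitz S f" "bounded_lipschitz S g"
  shows "bounded_lipschitz S (\<lambda>x. h (f x) (g x))"
proof -
  interpret h: bounded_bilinear h by fact
  obtain K where K: "K \<ge> 0" "\<And>x y. norm (h x y) \<le> norm x * norm y * K" using h.nonneg_bounded by blast
  obtain B L where B: "\<And>x. x \<in> S \<Longrightarrow> norm (f x) \<le> B" and L: "\<And>x y. x \<in> S \<Longrightarrow> y \<in> S \<Longrightarrow> norm (f x - f y) \<le> L * norm (x - y)"
    using assms(2) unfolding bounded_lipschitz_def by blast
  obtain B' L' where B': "\<And>x. x \<in> S \<Longrightarrow> norm (g x) \<le> B'" and L': "\<And>x y. x \<in> S \<Longrightarrow> y \<in> S \<Longrightarrow> norm (g x - g y) \<le> L' * norm (x - y)"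
    using assms(3) unfolding bounded_lipschitz_def by blast
  have bound: "norm (h u v) \<le> p * q * K" if "norm u \<le> p" "norm v \<le> q" for u v p q
  proof -
    have "norm u * norm v \<le> p * q" using that by (intro mult_mono) (auto intro: order_trans[OF norm_ge_zero])
    then show ?thesis using K(2)[of u v] mult_right_mono[OF _ K(1)] by (meson order_trans)
  qed
  have "norm (h (f x) (g x)) \<le> B * B' * K" if "x \<in> S" for x using bound[OF B[OF that] B'[OF that]] .
  moreover have "norm (h (f x) (g x) - h (f y) (g y)) \<le> (B * L' * K + L * B' * K) * norm (x - y)"
    if "x \<in> S" "y \<in> S" for x y
  proof -
    have "h (f x) (g x) - h (f y) (g y) = h (f x) (g x - g y) + h (f x - f y) (g y)"
      by (simp add: h.diff_left h.diff_right)
    also have "norm \<dots> \<le> B * (L' * norm (x - y)) * K + (L * norm (x - y)) * B' * K"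
      by (intro norm_triangle_le add_mono bound B B' L L' that)
    finally show ?thesis by (simp add: algebra_simps)
  qed
  ultimately show ?thesis unfolding bounded_lipschitz_def by blast
qed

lemma bounded_lipschitz_inverse:
  fixes f :: "_ \<Rightarrow> real"
  assumes "bounded_lipschitz S f" "\<delta> > 0" "\<And>x. x \<in> S \<Longrightarrow> f x \<ge> \<delta>"
  shows "bounded_lipschitz S (\<lambda>x. inverse (f x))"
proof -
  obtain L where L: "\<And>x y. x \<in> S \<Longrightarrow> y \<in> S \<Longrightarrow> norm (f x - f y) \<le> L * norm (x - y)"
    using assms(1) unfolding bounded_lipschitz_def by blast
  have i: "norm (inverse (f x)) \<le> inverse \<delta>" if "x \<in> S" for x
    using assms(2) assms(3)[OF that] by (auto intro!: le_imp_inverse_le)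
  moreover have "norm (inverse (f x) - inverse (f y)) \<le> (inverse \<delta> * inverse \<delta> * L) * norm (x - y)"
    if S: "x \<in> S" "y \<in> S" for x y
  proof -
    have nz: "f x \<noteq> 0" "f y \<noteq> 0" using assms(2) assms(3)[OF S(1)] assms(3)[OF S(2)] by auto
    then have "inverse (f x) - inverse (f y) = - (inverse (f x) * (f x - f y) * inverse (f y))"
      by (simp add: field_simps)
    then have "norm (inverse (f x) - inverse (f y)) = norm (inverse (f x)) * norm (inverse (f y)) * norm (f x - f y)"
      by (simp only: norm_minus_cancel norm_mult) simp
    also have "\<dots> \<le> inverse \<delta> * inverse \<delta> * (L * norm (x - y))"
      using assms(2) by (intro mult_mono i L S mult_nonneg_nonneg) auto
    finally show ?thesis by (simp add: mult.assoc)
  qed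
  ultimately show ?thesis unfolding bounded_lipschitz_def by blast
qed

lemma bounded_lipschitz_norm:
  assumes "bounded_lipschitz S f"
  shows "bounded_lipschitz S (\<lambda>x. norm (f x))"
proof -
  obtain B L where B: "\<And>x. x \<in> S \<Longrightarrow> norm (f x) \<le> B" and L: "\<And>x y. x \<in> S \<Longrightarrow> y \<in> S \<Longrightarrow> norm (f x - f y) \<le> L * norm (x - y)"
    using assms unfolding bounded_lipschitz_def by blast
  have "norm (norm (f x) - norm (f y)) \<le> L * norm (x - y)" if "x \<in> S" "y \<in> S" for x y
    using order_trans[OF norm_triangle_ineq3 L[OF that]] by simp
  then show ?thesis unfolding bounded_lipschitz_def using B by auto
qed

lemma compact_pos_lower_bound:
  fixes f :: "'a::topological_space \<Rightarrow> real"
  assumes "compact S" "continuous_on S f" "\<And>x. x \<in> S \<Longrightarrow> f x > 0"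
  shows "\<exists>\<delta>>0. \<forall>x\<in>S. f x \<ge> \<delta>"
proof (cases "S = {}")
  case False
  then obtain x where "x \<in> S" "\<forall>y\<in>S. f x \<le> f y" using continuous_attains_inf[OF assms(1) _ assms(2)] by blast
  then show ?thesis using assms(3) by blast
qed (auto intro: exI[of _ 1])

lemma reeb_speed_lower_bound:
  assumes c: "c > 3 / 2"
  shows "\<exists>\<delta>>0. \<forall>\<zeta>\<in>Sigma_R c. reeb_speed \<zeta> \<ge> \<delta>"
proof (rule compact_pos_lower_bound[OF compact_Sigma_R[OF c]])
  show "continuous_on (Sigma_R c) reeb_speed"
    unfolding reeb_speed_def[abs_def] rad_def spin_def case_prod_beta by (intro continuous_intros)
  show "\<And>\<zeta>. \<zeta> \<in> Sigma_R c \<Longrightarrow> reeb_speed \<zeta> > 0"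
    using Sigma_R_iff[OF c] by (simp add: reeb_speed_def)
qed

text \<open>The Reeb field is built by algebraic operations from the coordinates, and the denominators are bounded
  away from zero on the compact set \<open>Sigma_R c\<close>.\<close>
lemma reeb_lipschitz:
  assumes c: "c > 3 / 2"
  shows "\<exists>L. \<forall>x\<in>Sigma_R c. \<forall>y\<in>Sigma_R c.
    norm ((1 / reeb_speed x) *\<^sub>R reg_field c x - (1 / reeb_speed y) *\<^sub>R reg_field c y) \<le> L * norm (x - y)"
proof -
  let ?S = "Sigma_R c"
  have comp: "compact ?S" by (rule compact_Sigma_R[OF c])
  have id: "bounded_lipschitz ?S (\<lambda>x. x)" using comp by (intro bounded_lipschitz_id compact_imp_bounded)
  have f: "bounded_lipschitz ?S fst" and s: "bounded_lipschitz ?S snd"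
    using bounded_lipschitz_linear[OF bounded_linear_fst id] bounded_lipschitz_linear[OF bounded_linear_snd id] by simp_all
  have nth: "bounded_lipschitz ?S (\<lambda>x. g x $ i)" if "bounded_lipschitz ?S g" for g :: "_ \<Rightarrow> real^3" and i
    using bounded_lipschitz_linear[OF bounded_linear_vec_nth that] .
  have mul: "bounded_lipschitz ?S (\<lambda>x. g x * h x)" if "bounded_lipschitz ?S g" "bounded_lipschitz ?S h" for g h :: "_ \<Rightarrow> real"
    using bounded_lipschitz_bilinear[OF bounded_bilinear_mult that] .
  have scl: "bounded_lipschitz ?S (\<lambda>x. g x *\<^sub>R h x)" if "bounded_lipschitz ?S g" "bounded_lipschitz ?S h" for g :: "_ \<Rightarrow> real" and h :: "_ \<Rightarrow> 'b::real_normed_vector"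
    using bounded_lipschitz_bilinear[OF bounded_bilinear_scaleR that] .
  have neg: "bounded_lipschitz ?S (\<lambda>x. - g x)" if "bounded_lipschitz ?S g" for g :: "_ \<Rightarrow> 'b::real_normed_vector"
    using bounded_lipschitz_linear[OF bounded_linear_minus[OF bounded_linear_ident] that] .
  have dif: "bounded_lipschitz ?S (\<lambda>x. g x - h x)" if "bounded_lipschitz ?S g" "bounded_lipschitz ?S h" for g h :: "_ \<Rightarrow> 'b::real_normed_vector"
    using bounded_lipschitz_add[OF that(1) neg[OF that(2)]] by simp
  have nrm: "bounded_lipschitz ?S (\<lambda>x. norm (snd x))" by (rule bounded_lipschitz_norm[OF s])
  have pair: "bounded_lipschitz ?S (\<lambda>x. (g x, h x))" if "bounded_lipschitz ?S g" "bounded_lipschitz ?S h" for g h :: "_ \<Rightarrow> real^3"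
  proof -
    have "bounded_lipschitz ?S (\<lambda>x. (g x, 0 :: real^3) + (0 :: real^3, h x))"
      by (intro bounded_lipschitz_add bounded_lipschitz_linear[OF _ that(1)] bounded_lipschitz_linear[OF _ that(2)]
          bounded_linear_Pair bounded_linear_ident bounded_linear_zero)
    then show ?thesis by simp
  qed
  have vec: "bounded_lipschitz ?S (\<lambda>x. vector [g x, h x, k x] :: real^3)" if "bounded_lipschitz ?S g" "bounded_lipschitz ?S h" "bounded_lipschitz ?S k" for g h k :: "_ \<Rightarrow> real"
    unfolding vector3_axis by (intro bounded_lipschitz_add scl that bounded_lipschitz_const)
  have "continuous_on ?S (\<lambda>x. norm (snd x))" by (intro continuous_intros)
  moreover have "norm (snd x) > 0" if "x \<in> ?S" for x
    using Sigma_R_facts(3)[OF c, of "fst x" "snd x"] that by simp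
  ultimately obtain \<epsilon> where \<epsilon>: "\<epsilon> > 0" "\<forall>x\<in>?S. norm (snd x) \<ge> \<epsilon>"
    using compact_pos_lower_bound[OF comp, of "\<lambda>x. norm (snd x)"] by blast
  have invn: "bounded_lipschitz ?S (\<lambda>x. inverse (norm (snd x)))"
    by (rule bounded_lipschitz_inverse[OF nrm \<epsilon>(1)]) (use \<epsilon>(2) in blast)
  have spin: "bounded_lipschitz ?S spin" unfolding spin_def case_prod_beta by (intro dif mul nth f s)
  have rad: "bounded_lipschitz ?S rad" unfolding rad_def case_prod_beta by (intro dif mul nth f s nrm bounded_lipschitz_const)
  have ls: "bounded_lipschitz ?S reeb_speed" unfolding reeb_speed_def[abs_def] by (intro bounded_lipschitz_add bounded_lipschitz_const mul rad spin)
  obtain \<delta> where \<delta>: "\<delta> > 0" "\<forall>\<zeta>\<in>?S. reeb_speed \<zeta> \<ge> \<delta>" using reeb_speed_lower_bound[OF c] by blast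
  have inv: "bounded_lipschitz ?S (\<lambda>x. inverse (reeb_speed x))"
    by (rule bounded_lipschitz_inverse[OF ls \<delta>(1)]) (use \<delta>(2) in blast)
  have eq: "reg_field c = (\<lambda>x.
     ((inverse (norm (snd x)) * inverse (norm (snd x))) *\<^sub>R snd x + rad x *\<^sub>R vector [fst x $2, - (fst x$1), 0],
      - fst x + (norm (snd x) * (c - 1 / 2 + spin x)) *\<^sub>R (axis 3 1 - fst x$3 *\<^sub>R fst x)
        + rad x *\<^sub>R vector [snd x$2, - (snd x$1), 0]))"
    by (rule ext) (simp add: reg_field_def case_prod_beta power2_eq_square inverse_eq_divide)
  have "bounded_lipschitz ?S (reg_field c)"
    unfolding eq by (intro pair bounded_lipschitz_add scl vec mul nth neg dif f s nrm invn rad spin bounded_lipschitz_const)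
  then have "bounded_lipschitz ?S (\<lambda>x. inverse (reeb_speed x) *\<^sub>R reg_field c x)" by (intro scl inv)
  then show ?thesis unfolding bounded_lipschitz_def inverse_eq_divide by blast
qed

text \<open>The lower bound on the speed makes the new time run through all reals.\<close>
lemma time_change_inverse:
  fixes f f' :: "real \<Rightarrow> real"
  assumes d: "\<And>s. (f has_real_derivative f' s) (at s)" and \<delta>: "\<delta> > 0" "\<And>s. f' s \<ge> \<delta>" and 0: "f 0 = 0"
  shows "\<exists>g. (\<forall>t. f (g t) = t) \<and> (\<forall>s. g (f s) = s) \<and> (\<forall>t. (g has_real_derivative 1 / f' (g t)) (at t))"
proof -
  have smono: "f x < f y" if "x < y" for x y
    by (rule DERIV_pos_imp_increasing[OF that]) (use d \<delta> in \<open>force intro: less_le_trans\<close>)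
  then have inj: "f x = f y \<longleftrightarrow> x = y" for x y by (metis linorder_neqE_linordered_idom less_irrefl)
  have cont: "continuous_on A f" for A using d by (meson DERIV_continuous_on DERIV_subset subset_UNIV has_field_derivative_at_within)
  have grow: "f y - \<delta> * y \<ge> f x - \<delta> * x" if "x \<le> y" for x y
  proof (rule DERIV_nonneg_imp_nondecreasing[OF that])
    fix s
    have "((\<lambda>s. f s - \<delta> * s) has_real_derivative f' s - \<delta>) (at s)"
      by (rule derivative_eq_intros d refl | simp)+
    then show "\<exists>y. ((\<lambda>s. f s - \<delta> * s) has_real_derivative y) (at s) \<and> 0 \<le> y" using \<delta>(2)[of s] by force
  qed
  have "\<exists>s. f s = t" for t
  proof -
    \<comment> \<open>At speed at least \<open>\<delta>\<close> the time \<open>M\<close> suffices to reach both \<open>t\<close> and \<open>- t\<close>.\<close>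
    define M where "M = \<bar>t\<bar> / \<delta>"
    have M: "M \<ge> 0" "\<delta> * M = \<bar>t\<bar>" using \<delta> by (simp_all add: M_def)
    have "f M \<ge> \<bar>t\<bar>" "f (- M) \<le> - \<bar>t\<bar>" using grow[of 0 M] grow[of "- M" 0] M 0 by auto
    then have "\<exists>s\<ge>- M. s \<le> M \<and> f s = t" using M by (intro IVT' cont) auto
    then show ?thesis by blast
  qed
  then obtain g where g: "\<And>t. f (g t) = t" by metis
  have gf: "g (f s) = s" for s using g inj by blast
  have "(g has_real_derivative 1 / f' (g t)) (at t)" for t
  proof -
    have "isCont g (f (g t))"
      by (rule isCont_inverse_function[where d = 1]) (use gf d in \<open>auto intro: DERIV_isCont\<close>)
    then have c: "isCont g t" by (simp add: g)
    have "f' (g t) \<noteq> 0" using \<delta>(1) \<delta>(2)[of "g t"] by auto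
    have "(g has_real_derivative inverse (f' (g t))) (at t)"
      by (rule DERIV_inverse_function[where f = f and g = g and x = t and a = "t - 1" and b = "t + 1"
            and D = "f' (g t)"]) (use g c d \<open>f' (g t) \<noteq> 0\<close> in auto)
    then show ?thesis by (simp add: inverse_eq_divide)
  qed
  then show ?thesis using g gf by blast
qed

section \<open>The flow on the double cover\<close>

text \<open>The solution of \<open>z' = w / 2\<close>, \<open>w' = - 2 k\<^sup>2 z\<close>, a harmonic oscillator of frequency \<open>k\<close>.\<close>
definition osc :: "real \<Rightarrow> complex \<times> complex \<Rightarrow> real \<Rightarrow> complex \<times> complex" where
  "osc k = (\<lambda>(z, w) s. (cos (k * s) *\<^sub>R z + (sin (k * s) / (2 * k)) *\<^sub>R w,
     cos (k * s) *\<^sub>R w - (2 * k * sin (k * s)) *\<^sub>R z))"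

text \<open>The integral of \<open>(cmod z)\<^sup>2\<close> along \<open>osc\<close>, which is the physical time elapsed and hence the angle by
  which the frame has turned. Its secular part is the mean of \<open>(cmod z)\<^sup>2\<close> over a period.\<close>
definition sweep :: "real \<Rightarrow> complex \<times> complex \<Rightarrow> real \<Rightarrow> real" where
  "sweep k = (\<lambda>(z, w) s. ((cmod z)\<^sup>2 + (cmod w)\<^sup>2 / (4 * k\<^sup>2)) / 2 * s
     + ((cmod z)\<^sup>2 - (cmod w)\<^sup>2 / (4 * k\<^sup>2)) / 2 * (sin (2 * (k * s)) / (2 * k))
     + Re (cnj z * w) / (2 * k) * ((1 - cos (2 * (k * s))) / (2 * k)))"

text \<open>Half the angle appears because \<open>q = z\<^sup>2\<close>.\<close>
definition LC_flow :: "real \<Rightarrow> complex \<times> complex \<Rightarrow> real \<Rightarrow> complex \<times> complex" where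
  "LC_flow k x s = (cis (- sweep k x s / 2) * fst (osc k x s), cis (- sweep k x s / 2) * snd (osc k x s))"

text \<open>The flow acts on \<open>u_plus\<close> and \<open>u_minus\<close> by phase factors; they are the amplitudes of the two circular
  motions that make up the ellipse.\<close>
definition u_plus :: "real \<Rightarrow> complex \<times> complex \<Rightarrow> complex" where
  "u_plus k = (\<lambda>(z, w). w + 2 * \<i> * of_real k * z)"

definition u_minus :: "real \<Rightarrow> complex \<times> complex \<Rightarrow> complex" where
  "u_minus k = (\<lambda>(z, w). w - 2 * \<i> * of_real k * z)"

lemma phases_inject:
  assumes "k \<noteq> 0"
  shows "x = y \<longleftrightarrow> u_plus k x = u_plus k y \<and> u_minus k x = u_minus k y"
proof
  assume h: "u_plus k x = u_plus k y \<and> u_minus k x = u_minus k y"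
  obtain z w z' w' where x: "x = (z, w)" and y: "y = (z', w')" by (meson surj_pair)
  have inv: "2 * snd v = u_plus k v + u_minus k v" "4 * \<i> * of_real k * fst v = u_plus k v - u_minus k v" for v
    by (simp_all add: u_plus_def u_minus_def case_prod_beta algebra_simps)
  have "2 * w = 2 * w'" using inv(1)[of x] inv(1)[of y] h x y by simp
  moreover have "4 * \<i> * of_real k * z = 4 * \<i> * of_real k * z'" using inv(2)[of x] inv(2)[of y] h x y by simp
  ultimately show "x = y" using assms by (simp add: x y)
qed simp

lemma phases_minus: "u_plus k (- x) = - u_plus k x" "u_minus k (- x) = - u_minus k x"
  by (cases x; simp add: u_plus_def u_minus_def)+

lemma phase_norms:
  "(cmod (u_plus k (z, w)))\<^sup>2 = (cmod w)\<^sup>2 + 4 * k\<^sup>2 * (cmod z)\<^sup>2 + 4 * k * ang_mom (z, w)"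
  "(cmod (u_minus k (z, w)))\<^sup>2 = (cmod w)\<^sup>2 + 4 * k\<^sup>2 * (cmod z)\<^sup>2 - 4 * k * ang_mom (z, w)"
  unfolding cmod_power2 by (simp_all add: u_plus_def u_minus_def ang_mom_def power2_eq_square algebra_simps)

lemma osc_phases:
  assumes "k \<noteq> 0"
  shows "u_plus k (osc k x s) = cis (k * s) * u_plus k x" "u_minus k (osc k x s) = cis (- (k * s)) * u_minus k x"
  using assms by (cases x; simp add: u_plus_def u_minus_def osc_def complex_eq_iff field_simps)+

lemma LC_flow_phases:
  assumes "k \<noteq> 0"
  shows "u_plus k (LC_flow k x s) = cis (k * s - sweep k x s / 2) * u_plus k x"
    "u_minus k (LC_flow k x s) = cis (- (k * s) - sweep k x s / 2) * u_minus k x"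
proof -
  have "u_plus k (LC_flow k x s) = cis (- sweep k x s / 2) * u_plus k (osc k x s)"
    "u_minus k (LC_flow k x s) = cis (- sweep k x s / 2) * u_minus k (osc k x s)"
    by (cases "osc k x s"; simp add: u_plus_def u_minus_def LC_flow_def algebra_simps)+
  then show "u_plus k (LC_flow k x s) = cis (k * s - sweep k x s / 2) * u_plus k x"
    "u_minus k (LC_flow k x s) = cis (- (k * s) - sweep k x s / 2) * u_minus k x"
    unfolding osc_phases[OF assms] by (simp_all add: cis_mult add.commute flip: mult.assoc)
qed

lemma LC_flow_0: "LC_flow k x 0 = x"
  by (cases x) (simp add: LC_flow_def sweep_def osc_def)

text \<open>Both quantities are combinations of the squared moduli of \<open>u_plus\<close> and \<open>u_minus\<close>.\<close>
lemma LC_flow_conserved: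
  assumes "k \<noteq> 0"
  defines "I \<equiv> \<lambda>x. (cmod (snd x))\<^sup>2 + 4 * k\<^sup>2 * (cmod (fst x))\<^sup>2"
  shows "ang_mom (LC_flow k x s) = ang_mom x" "I (LC_flow k x s) = I x"
proof -
  have pn: "(cmod (u_plus k y))\<^sup>2 = I y + 4 * k * ang_mom y" "(cmod (u_minus k y))\<^sup>2 = I y - 4 * k * ang_mom y" for y
    using phase_norms[of k "fst y" "snd y"] by (simp_all add: I_def)
  have "I (LC_flow k x s) + 4 * k * ang_mom (LC_flow k x s) = I x + 4 * k * ang_mom x"
    "I (LC_flow k x s) - 4 * k * ang_mom (LC_flow k x s) = I x - 4 * k * ang_mom x"
    unfolding pn[symmetric] LC_flow_phases[OF assms(1)] norm_mult norm_cis by simp_all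
  then have "I (LC_flow k x s) = I x" "4 * k * ang_mom (LC_flow k x s) = 4 * k * ang_mom x" by linarith+
  then show "ang_mom (LC_flow k x s) = ang_mom x" "I (LC_flow k x s) = I x" using assms(1) by simp_all
qed

lemma sweep_deriv:
  assumes "k \<noteq> 0"
  shows "(sweep k x has_real_derivative (cmod (fst (osc k x s)))\<^sup>2) (at s)"
proof -
  obtain z w where x: "x = (z, w)" by force
  let ?C = "cos (k * s)" and ?S = "sin (k * s)"
  define M A D where "M = ((cmod z)\<^sup>2 + (cmod w)\<^sup>2 / (4 * k\<^sup>2)) / 2"
    and "A = ((cmod z)\<^sup>2 - (cmod w)\<^sup>2 / (4 * k\<^sup>2)) / 2" and "D = Re (cnj z * w) / (2 * k)"
  have sw: "sweep k x = (\<lambda>s. M * s + A * (sin (2 * (k * s)) / (2 * k)) + D * ((1 - cos (2 * (k * s))) / (2 * k)))"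
    by (simp add: sweep_def x M_def A_def D_def)
  have "(sweep k x has_real_derivative M + A * cos (2 * (k * s)) + D * sin (2 * (k * s))) (at s)"
    unfolding sw by (rule derivative_eq_intros refl | use assms in simp)+
  moreover have "M + A * cos (2 * (k * s)) + D * sin (2 * (k * s)) = (cmod (fst (osc k x s)))\<^sup>2"
  proof -
    have "M + A * cos (2 * (k * s)) + D * sin (2 * (k * s)) =
        M * (?C\<^sup>2 + ?S\<^sup>2) + A * (?C\<^sup>2 - ?S\<^sup>2) + D * (2 * ?S * ?C)"
      by (simp add: cos_double sin_double)
    also have "\<dots> = (M + A) * ?C\<^sup>2 + (M - A) * ?S\<^sup>2 + 2 * D * ?S * ?C"
      by (simp only: distrib_left distrib_right left_diff_distrib right_diff_distrib mult_ac)
    also have "\<dots> = (cmod z)\<^sup>2 * ?C\<^sup>2 + (cmod w)\<^sup>2 / (4 * k\<^sup>2) * ?S\<^sup>2 + Re (cnj z * w) / k * ?S * ?C"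
    proof -
      have "M + A = (cmod z)\<^sup>2" "M - A = (cmod w)\<^sup>2 / (4 * k\<^sup>2)" unfolding M_def A_def by argo+
      moreover have "2 * (y / (2 * k)) = y / k" for y :: real by simp
      then have "2 * D = Re (cnj z * w) / k" unfolding D_def .
      ultimately show ?thesis by (simp only:)
    qed
    also have "\<dots> = (cmod (?C *\<^sub>R z + (?S / (2 * k)) *\<^sub>R w))\<^sup>2"
      unfolding cmod_power2 using assms by (simp add: field_simps power2_eq_square)
    finally show ?thesis by (simp add: osc_def x)
  qed
  ultimately show ?thesis by simp
qed

lemma LC_flow_derivs:
  fixes x :: "complex \<times> complex"
  assumes "k \<noteq> 0"
  defines "z \<equiv> \<lambda>s. fst (LC_flow k x s)" and "w \<equiv> \<lambda>s. snd (LC_flow k x s)"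
  shows "(z has_vector_derivative w s / 2 - \<i> * of_real ((cmod (z s))\<^sup>2) * z s / 2) (at s)"
    "(w has_vector_derivative of_real (- 2 * k\<^sup>2) * z s - \<i> * of_real ((cmod (z s))\<^sup>2) * w s / 2) (at s)"
proof -
  obtain z0 w0 where x: "x = (z0, w0)" by force
  define Z W where "Z = (\<lambda>s. fst (osc k x s))" and "W = (\<lambda>s. snd (osc k x s))"
  define \<rho> where "\<rho> = (\<lambda>s. cis (- sweep k x s / 2))"
  have zw: "z = (\<lambda>s. \<rho> s * Z s)" "w = (\<lambda>s. \<rho> s * W s)"
    by (simp_all add: z_def w_def LC_flow_def Z_def W_def \<rho>_def)
  have n: "cmod (z s) = cmod (Z s)" by (simp add: zw \<rho>_def norm_mult)
  have "((\<lambda>s. - sweep k x s / 2) has_real_derivative - (cmod (Z s))\<^sup>2 / 2) (at s)"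
    unfolding Z_def by (rule derivative_eq_intros sweep_deriv assms refl | simp)+
  then have r: "(\<rho> has_vector_derivative (- (cmod (Z s))\<^sup>2 / 2) *\<^sub>R (\<i> * \<rho> s)) (at s)"
    unfolding \<rho>_def by (rule has_vector_derivative_cis)
  have Z: "(Z has_vector_derivative W s / 2) (at s)"
    unfolding Z_def W_def osc_def x prod.case fst_conv snd_conv has_vector_derivative_complex_iff using assms(1)
    by (auto intro!: derivative_eq_intros simp: field_simps)
  have W: "(W has_vector_derivative of_real (- 2 * k\<^sup>2) * Z s) (at s)"
    unfolding Z_def W_def osc_def x prod.case fst_conv snd_conv has_vector_derivative_complex_iff using assms(1)
    by (auto intro!: derivative_eq_intros simp: field_simps power2_eq_square)
  show "(z has_vector_derivative w s / 2 - \<i> * of_real ((cmod (z s))\<^sup>2) * z s / 2) (at s)"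
    using has_vector_derivative_mult[OF r Z] unfolding n unfolding zw
    by (simp add: scaleR_conv_of_real algebra_simps)
  show "(w has_vector_derivative of_real (- 2 * k\<^sup>2) * z s - \<i> * of_real ((cmod (z s))\<^sup>2) * w s / 2) (at s)"
    using has_vector_derivative_mult[OF r W] unfolding n unfolding zw
    by (simp add: scaleR_conv_of_real algebra_simps)
qed

lemma frequency_exists:
  assumes c: "c > 3 / 2" and x: "x \<in> LC_bdd c"
  shows "\<exists>k>0. c = ang_mom x + 2 * k\<^sup>2"
  using ang_less_1[OF assms] c by (intro exI[of _ "sqrt ((c - ang_mom x) / 2)"]) (simp add: field_simps)

lemma LC_level_frequency:
  assumes "c = ang_mom x + 2 * k\<^sup>2"
  shows "x \<in> LC_level c \<longleftrightarrow> (cmod (snd x))\<^sup>2 + 4 * k\<^sup>2 * (cmod (fst x))\<^sup>2 = 2"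
  using assms energy_form[of c "fst x" "snd x"] by (auto simp: LC_level_def)

text \<open>The flow preserves the level, and by continuity it cannot cross the omitted value \<open>1\<close> of \<open>quart_part\<close>.\<close>
lemma LC_flow_in_LC_bdd:
  assumes c: "c > 3 / 2" and x: "x \<in> LC_bdd c" and k: "k > 0" "c = ang_mom x + 2 * k\<^sup>2"
  shows "LC_flow k x s \<in> LC_bdd c"
proof -
  have k0: "k \<noteq> 0" using k by simp
  have lev: "LC_flow k x s \<in> LC_level c" for s
    using LC_level_frequency[of c "LC_flow k x s" k] LC_level_frequency[OF k(2)] x LC_bdd_subset k(2)
      LC_flow_conserved[OF k0, of x s] by auto
  have "continuous_on UNIV (\<lambda>s. LC_flow k x s)"
  proof -
    have "continuous_on UNIV (\<lambda>s. fst (LC_flow k x s))" "continuous_on UNIV (\<lambda>s. snd (LC_flow k x s))"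
      using LC_flow_derivs[OF k0, of x]
      by (meson continuous_at_imp_continuous_on has_vector_derivative_continuous)+
    from continuous_on_Pair[OF this] show ?thesis by simp
  qed
  then have "connected (range (\<lambda>s. quart_part (LC_flow k x s)))"
    by (intro connected_continuous_image continuous_on_quart) auto
  moreover have "quart_part (LC_flow k x 0) < 1" using x by (simp add: LC_flow_0 LC_bdd_def)
  moreover have "1 \<notin> range (\<lambda>s. quart_part (LC_flow k x s))" using quart_neq_1[OF c lev] by force
  ultimately have "quart_part (LC_flow k x s) < 1"
    using connectedD_interval[of "range (\<lambda>s. quart_part (LC_flow k x s))" "quart_part (LC_flow k x 0)" "quart_part (LC_flow k x s)" 1]
    by (metis UNIV_I imageI linorder_not_le order_less_imp_le)
  then show ?thesis using lev[of s] by (simp add: LC_bdd_def LC_level_def)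
qed

text \<open>The time parameter of the Reeb flow, which is also the action: its derivative is \<open>reeb_speed\<close>.\<close>
definition reeb_time :: "real \<Rightarrow> complex \<times> complex \<Rightarrow> real \<Rightarrow> real" where
  "reeb_time k x s = s - ang_mom x * sweep k x s"

lemma LC_cover_LC_flow:
  assumes c: "c > 3 / 2" and x: "x \<in> LC_bdd c" and k: "k > 0" "c = ang_mom x + 2 * k\<^sup>2"
  shows "LC_cover (LC_flow k x s) \<in> Sigma_R c"
    "((\<lambda>s. LC_cover (LC_flow k x s)) has_vector_derivative reg_field c (LC_cover (LC_flow k x s))) (at s)"
    "(reeb_time k x has_real_derivative reeb_speed (LC_cover (LC_flow k x s))) (at s)"
proof -
  have k0: "k \<noteq> 0" using k by simp
  note b = LC_flow_in_LC_bdd[OF assms]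
  show "LC_cover (LC_flow k x s) \<in> Sigma_R c" unfolding Sigma_R_eq[OF c] using b by blast
  define z w where "z = (\<lambda>s. fst (LC_flow k x s))" and "w = (\<lambda>s. snd (LC_flow k x s))"
  have zw: "LC_flow k x = (\<lambda>s. (z s, w s))" by (simp add: z_def w_def)
  have E: "ang_mom (z s, w s) - c = - 2 * k\<^sup>2"
    using k(2) LC_flow_conserved(1)[OF k0, of x s] unfolding zw by simp
  show "((\<lambda>s. LC_cover (LC_flow k x s)) has_vector_derivative reg_field c (LC_cover (LC_flow k x s))) (at s)"
    unfolding zw
    by (rule LC_cover_has_derivative)
      (use b[of s] LC_bdd_subset LC_flow_derivs[OF k0, of x s] E in \<open>auto simp: zw simp flip: of_real_diff\<close>)
  have "reeb_speed (LC_cover (LC_flow k x s)) = 1 - quart_part (LC_flow k x s)"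
    using LC_cover_pullbacks(4)[OF LC_bdd_nonzero[OF b[of s]]] by (simp add: reeb_speed_def)
  also have "\<dots> = 1 - ang_mom x * (cmod (fst (osc k x s)))\<^sup>2"
    using LC_flow_conserved(1)[OF k0, of x s]
    by (simp add: quart_part_def case_prod_beta LC_flow_def norm_mult)
  finally show "(reeb_time k x has_real_derivative reeb_speed (LC_cover (LC_flow k x s))) (at s)"
    unfolding reeb_time_def[abs_def] by (auto intro!: derivative_eq_intros sweep_deriv k0)
qed

lemma reeb_field_Sigma_R:
  assumes c: "c > 3 / 2" and z: "\<zeta> \<in> Sigma_R c"
  shows "reeb_field (Sigma_R c) lambda_can \<zeta> = (1 / reeb_speed \<zeta>) *\<^sub>R reg_field c \<zeta>"
proof (rule reeb_field_eq[OF c z])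
  obtain x where x: "x \<in> LC_bdd c" "\<zeta> = LC_cover x" using z unfolding Sigma_R_eq[OF c] by blast
  obtain k where k: "k > 0" "c = ang_mom x + 2 * k\<^sup>2" using frequency_exists[OF c x(1)] by blast
  note F = LC_cover_LC_flow[OF c x(1) k]
  define r where "r = 1 / reeb_speed \<zeta>"
  have "((\<lambda>t. LC_cover (LC_flow k x (r * t))) has_vector_derivative r *\<^sub>R reg_field c \<zeta>) (at 0)"
  proof -
    have 1: "((\<lambda>t. r * t) has_vector_derivative r) (at 0)"
      by (auto intro!: derivative_eq_intros)
    have "((\<lambda>s. LC_cover (LC_flow k x s)) \<circ> (\<lambda>t. r * t) has_vector_derivative r *\<^sub>R reg_field c \<zeta>) (at 0)"
      by (rule vector_diff_chain_at[OF 1]) (use F(2)[of 0] in \<open>simp add: LC_flow_0 x(2)\<close>)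
    then show ?thesis by (simp add: o_def)
  qed
  then show "(1 / reeb_speed \<zeta>) *\<^sub>R reg_field c \<zeta> \<in> tangent_vectors (Sigma_R c) \<zeta>"
    unfolding tangent_vectors_def r_def[symmetric] using F(1)
    by (intro CollectI exI[of _ "\<lambda>t. LC_cover (LC_flow k x (r * t))"] exI[of _ 1]) (simp add: LC_flow_0 x(2))
qed

abbreviation reeb_orbit :: "real \<Rightarrow> (real \<Rightarrow> (real^3) \<times> (real^3)) \<Rightarrow> bool" where
  "reeb_orbit c \<equiv> integral_curve_on (reeb_field (Sigma_R c) lambda_can) (Sigma_R c)"

lemma reeb_orbit_unique:
  assumes c: "c > 3 / 2"
    and "reeb_orbit c \<alpha>"
    and "reeb_orbit c \<beta>" "\<alpha> 0 = \<beta> 0"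
  shows "\<alpha> t = \<beta> t"
proof -
  obtain L where L: "\<forall>x\<in>Sigma_R c. \<forall>y\<in>Sigma_R c.
    norm ((1 / reeb_speed x) *\<^sub>R reg_field c x - (1 / reeb_speed y) *\<^sub>R reg_field c y) \<le> L * norm (x - y)"
    using reeb_lipschitz[OF c] by blast
  show ?thesis
    by (rule integral_curve_unique[OF _ assms(2-4), of L]) (use L reeb_field_Sigma_R[OF c] in simp)
qed

lemma reeb_orbit_exists:
  assumes c: "c > 3 / 2" and x: "x \<in> LC_bdd c" and k: "k > 0" "c = ang_mom x + 2 * k\<^sup>2"
  shows "\<exists>g. (\<forall>t. reeb_time k x (g t) = t) \<and> (\<forall>s. g (reeb_time k x s) = s) \<and> (\<forall>t>0. g t > 0) \<and>
    (\<forall>s>0. reeb_time k x s > 0) \<and>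
    reeb_orbit c (\<lambda>t. LC_cover (LC_flow k x (g t)))"
proof -
  note F = LC_cover_LC_flow[OF c x k]
  obtain \<delta> where \<delta>: "\<delta> > 0" "\<forall>\<zeta>\<in>Sigma_R c. reeb_speed \<zeta> \<ge> \<delta>" using reeb_speed_lower_bound[OF c] by blast
  have r0: "reeb_time k x 0 = 0" by (cases x) (simp add: reeb_time_def sweep_def)
  obtain g where g: "\<And>t. reeb_time k x (g t) = t" "\<And>s. g (reeb_time k x s) = s"
    "\<And>t. (g has_real_derivative 1 / reeb_speed (LC_cover (LC_flow k x (g t)))) (at t)"
    using time_change_inverse[OF F(3) \<delta>(1) _ r0] \<delta>(2) F(1) by blast
  have mono: "reeb_time k x a < reeb_time k x b" if "a < b" for a b
  proof (rule DERIV_pos_imp_increasing[OF that])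
    fix s show "\<exists>y. (reeb_time k x has_real_derivative y) (at s) \<and> 0 < y"
      using F(3)[of s] \<delta> F(1)[of s] by (metis less_le_trans)
  qed
  have "((\<lambda>t. LC_cover (LC_flow k x (g t))) has_vector_derivative
     reeb_field (Sigma_R c) lambda_can (LC_cover (LC_flow k x (g t)))) (at t)" for t
  proof -
    have "((\<lambda>s. LC_cover (LC_flow k x s)) \<circ> g has_vector_derivative
        (1 / reeb_speed (LC_cover (LC_flow k x (g t)))) *\<^sub>R reg_field c (LC_cover (LC_flow k x (g t)))) (at t)"
      by (rule vector_diff_chain_at[OF g(3)[unfolded has_real_derivative_iff_has_vector_derivative] F(2)])
    then show ?thesis unfolding reeb_field_Sigma_R[OF c F(1)] by (simp add: o_def)
  qed
  then have "reeb_orbit c (\<lambda>t. LC_cover (LC_flow k x (g t)))"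
    unfolding integral_curve_on_def using F(1) by blast
  moreover have "g t > 0" if "t > 0" for t
    using mono[of "g t" 0] g(1)[of t] r0 that by (metis less_asym linorder_neqE_linordered_idom)
  moreover have "reeb_time k x s > 0" if "s > 0" for s using mono[OF that] r0 by simp
  ultimately show ?thesis using g(1,2) by blast
qed

text \<open>By uniqueness every Reeb orbit is the image of an explicit solution, reparametrised by \<open>reeb_time\<close>; and
  it closes up exactly when the solution upstairs returns to the starting point or to its antipode,
  since these two points have the same image.\<close>
lemma action_spectrum_iff:
  assumes c: "c > 3 / 2"
  shows "T \<in> action_spectrum (Sigma_R c) lambda_can \<longleftrightarrow>
    (\<exists>x k s. x \<in> LC_bdd c \<and> k > 0 \<and> c = ang_mom x + 2 * k\<^sup>2 \<and> s > 0 \<and> T = reeb_time k x s \<and>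
      (LC_flow k x s = x \<or> LC_flow k x s = - x))"
proof
  assume "T \<in> action_spectrum (Sigma_R c) lambda_can"
  then obtain \<gamma> where \<gamma>: "reeb_orbit c \<gamma>"
    and per: "is_period \<gamma> T" unfolding action_spectrum_def by blast
  have T: "T > 0" "\<gamma> T = \<gamma> 0" using per by (auto simp: is_period_def dest: spec[of _ 0])
  have "\<gamma> 0 \<in> Sigma_R c" using \<gamma> by (simp add: integral_curve_on_def)
  then obtain x where x: "x \<in> LC_bdd c" "\<gamma> 0 = LC_cover x" unfolding Sigma_R_eq[OF c] by blast
  obtain k where k: "k > 0" "c = ang_mom x + 2 * k\<^sup>2" using frequency_exists[OF c x(1)] by blast
  obtain g where g: "\<And>t. reeb_time k x (g t) = t" "\<And>s. g (reeb_time k x s) = s" "\<And>t. t > 0 \<Longrightarrow> g t > 0"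
    and int: "reeb_orbit c (\<lambda>t. LC_cover (LC_flow k x (g t)))"
    using reeb_orbit_exists[OF c x(1) k] by blast
  have "reeb_time k x 0 = 0" by (cases x) (simp add: reeb_time_def sweep_def)
  then have g0: "g 0 = 0" using g(2)[of 0] by simp
  have "\<gamma> t = LC_cover (LC_flow k x (g t))" for t
    by (rule reeb_orbit_unique[OF c \<gamma> int]) (simp add: x(2) LC_flow_0 g0)
  then have "LC_cover (LC_flow k x (g T)) = LC_cover x" using T x(2) by metis
  then have "LC_flow k x (g T) = x \<or> LC_flow k x (g T) = - x"
    using LC_cover_eq_iff[OF LC_bdd_nonzero[OF LC_flow_in_LC_bdd[OF c x(1) k]] LC_bdd_nonzero[OF x(1)]] by simp
  then show "\<exists>x k s. x \<in> LC_bdd c \<and> k > 0 \<and> c = ang_mom x + 2 * k\<^sup>2 \<and> s > 0 \<and> T = reeb_time k x s \<and>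
      (LC_flow k x s = x \<or> LC_flow k x s = - x)"
    using x(1) k g(1)[of T] g(3)[OF T(1)] by metis
next
  assume "\<exists>x k s. x \<in> LC_bdd c \<and> k > 0 \<and> c = ang_mom x + 2 * k\<^sup>2 \<and> s > 0 \<and> T = reeb_time k x s \<and>
      (LC_flow k x s = x \<or> LC_flow k x s = - x)"
  then obtain x k s where x: "x \<in> LC_bdd c" and k: "k > 0" "c = ang_mom x + 2 * k\<^sup>2" and s: "s > 0" "T = reeb_time k x s"
    and cl: "LC_flow k x s = x \<or> LC_flow k x s = - x" by blast
  obtain g where g: "\<And>t. reeb_time k x (g t) = t" "\<And>s. g (reeb_time k x s) = s" "\<And>s. s > 0 \<Longrightarrow> reeb_time k x s > 0"
    and int: "reeb_orbit c (\<lambda>t. LC_cover (LC_flow k x (g t)))"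
    using reeb_orbit_exists[OF c x(1) k] by blast
  define \<gamma> where "\<gamma> = (\<lambda>t. LC_cover (LC_flow k x (g t)))"
  have "reeb_time k x 0 = 0" by (cases x) (simp add: reeb_time_def sweep_def)
  then have "g 0 = 0" using g(2)[of 0] by simp
  have "LC_cover (LC_flow k x s) = LC_cover x"
    using cl LC_cover_eq_iff[OF LC_bdd_nonzero[OF LC_flow_in_LC_bdd[OF c x k]] LC_bdd_nonzero[OF x]] by simp
  then have "\<gamma> T = \<gamma> 0" unfolding \<gamma>_def s(2) g(2) \<open>g 0 = 0\<close> LC_flow_0 .
  have "reeb_orbit c (\<lambda>t. \<gamma> (t + T))"
    unfolding integral_curve_on_def
  proof (intro allI conjI)
    fix t
    show "\<gamma> (t + T) \<in> Sigma_R c" using int by (simp add: integral_curve_on_def \<gamma>_def)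
    have 1: "((\<lambda>t. t + T) has_vector_derivative 1) (at t)" by (auto intro!: derivative_eq_intros)
    have "(\<gamma> \<circ> (\<lambda>t. t + T) has_vector_derivative 1 *\<^sub>R reeb_field (Sigma_R c) lambda_can (\<gamma> (t + T))) (at t)"
      by (rule vector_diff_chain_at[OF 1]) (use int in \<open>simp add: integral_curve_on_def \<gamma>_def\<close>)
    then show "((\<lambda>t. \<gamma> (t + T)) has_vector_derivative reeb_field (Sigma_R c) lambda_can (\<gamma> (t + T))) (at t)"
      by (simp add: o_def)
  qed
  then have "\<gamma> (t + T) = \<gamma> t" for t
    using reeb_orbit_unique[OF c _ int[folded \<gamma>_def], of "\<lambda>t. \<gamma> (t + T)" t] \<open>\<gamma> T = \<gamma> 0\<close> by simp
  then have "is_period \<gamma> T" using g(3)[OF s(1)] s(2) by (simp add: is_period_def)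
  then show "T \<in> action_spectrum (Sigma_R c) lambda_can"
    unfolding action_spectrum_def using int \<gamma>_def by blast
qed

section \<open>Closed orbits and their actions\<close>

lemma cis_pm_1_iff: "(cis a = 1 \<or> cis a = - 1) \<longleftrightarrow> (\<exists>m::int. a = pi * m)"
proof
  assume "cis a = 1 \<or> cis a = - 1"
  then have "sin a = 0" by (auto simp: complex_eq_iff)
  then show "\<exists>m::int. a = pi * m" by (auto simp: sin_zero_iff_int2 mult.commute)
next
  assume "\<exists>m::int. a = pi * m"
  then have s: "sin a = 0" by (auto simp: sin_zero_iff_int2 mult.commute)
  then have "(cos a)\<^sup>2 = 1" using sin_cos_squared_add[of a] by simp
  then have "cos a = 1 \<or> cos a = - 1" by (simp add: power2_eq_1_iff)
  then show "cis a = 1 \<or> cis a = - 1" using s by (auto simp: complex_eq_iff)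
qed

lemma cis_eq_1_imp: "cis a = 1 \<Longrightarrow> \<exists>m::int. a = 2 * pi * m"
proof -
  assume "cis a = 1"
  then have "cos a = 1" by (simp add: complex_eq_iff)
  then obtain m :: int where "a = of_int m * 2 * pi" unfolding cos_one_2pi_int by blast
  then show ?thesis by (intro exI[of _ m]) simp
qed

lemma LC_flow_closes_iff:
  assumes "k \<noteq> 0"
  shows "(LC_flow k x s = x \<or> LC_flow k x s = - x) \<longleftrightarrow>
    (\<exists>\<epsilon>\<in>{1, - 1}. (u_plus k x = 0 \<or> cis (k * s - sweep k x s / 2) = \<epsilon>) \<and>
       (u_minus k x = 0 \<or> cis (- (k * s) - sweep k x s / 2) = \<epsilon>))"
proof -
  have 1: "LC_flow k x s = x \<longleftrightarrow> (u_plus k x = 0 \<or> cis (k * s - sweep k x s / 2) = 1) \<and>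
       (u_minus k x = 0 \<or> cis (- (k * s) - sweep k x s / 2) = 1)"
    unfolding phases_inject[OF assms, of "LC_flow k x s" x] LC_flow_phases[OF assms] by auto
  have m: "a * b = - b \<longleftrightarrow> b = 0 \<or> a = - 1" for a b :: complex
    by (metis add.inverse_inverse mult_cancel_right2 mult_minus_left)
  have 2: "LC_flow k x s = - x \<longleftrightarrow> (u_plus k x = 0 \<or> cis (k * s - sweep k x s / 2) = - 1) \<and>
       (u_minus k x = 0 \<or> cis (- (k * s) - sweep k x s / 2) = - 1)"
    unfolding phases_inject[OF assms, of "LC_flow k x s" "- x"] LC_flow_phases[OF assms] phases_minus m ..
  show ?thesis unfolding 1 2 by blast
qed

text \<open>One of the amplitudes vanishes precisely for the circular motions, along which \<open>cmod z\<close> is constant.\<close>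
lemma circular_imp:
  assumes "k \<noteq> 0" "u_plus k (z, w) = 0 \<or> u_minus k (z, w) = 0"
  shows "(cmod w)\<^sup>2 = 4 * k\<^sup>2 * (cmod z)\<^sup>2" "Re (cnj z * w) = 0"
proof -
  have "w = - (2 * \<i> * of_real k * z) \<or> w = 2 * \<i> * of_real k * z"
    using assms(2) by (auto simp: u_plus_def u_minus_def eq_neg_iff_add_eq_0)
  then show "(cmod w)\<^sup>2 = 4 * k\<^sup>2 * (cmod z)\<^sup>2" "Re (cnj z * w) = 0"
    by (auto simp: norm_mult power_mult_distrib)
qed

text \<open>The oscillating part of the elapsed time disappears for circular motions and after full periods.\<close>
lemma sweep_average:
  assumes k: "k \<noteq> 0" and n: "(cmod (snd x))\<^sup>2 + 4 * k\<^sup>2 * (cmod (fst x))\<^sup>2 = 2"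
    and h: "u_plus k x = 0 \<or> u_minus k x = 0 \<or> cis (2 * (k * s)) = 1"
  shows "sweep k x s = s / (4 * k\<^sup>2)"
proof -
  obtain z w where x: "x = (z, w)" by force
  have "(cmod z)\<^sup>2 + (cmod w)\<^sup>2 / (4 * k\<^sup>2) = 2 / (4 * k\<^sup>2)"
    using n k by (simp add: x field_simps)
  then have M: "((cmod z)\<^sup>2 + (cmod w)\<^sup>2 / (4 * k\<^sup>2)) / 2 * s = s / (4 * k\<^sup>2)" by simp
  show ?thesis
  proof (cases "u_plus k x = 0 \<or> u_minus k x = 0")
    case True
    then have "(cmod w)\<^sup>2 / (4 * k\<^sup>2) = (cmod z)\<^sup>2" "Re (cnj z * w) = 0"
      using circular_imp[OF k, of z w] k by (simp_all add: x)
    then show ?thesis unfolding sweep_def x prod.case M by simp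
  next
    case False
    then have "cos (2 * (k * s)) = 1" "sin (2 * (k * s)) = 0" using h by (auto simp: complex_eq_iff)
    then show ?thesis unfolding sweep_def x prod.case M by simp
  qed
qed

text \<open>The number \<open>X = 1 / (2 k)\<close> is the square root of the semi-major axis. By the formulas for the amplitudes,
  \<open>ang_mom x\<close> lies between \<open>- X\<close> and \<open>X\<close>, and the ends correspond to the circular motions.\<close>
lemma frequency_bounds:
  assumes c: "c > 3 / 2" and x: "x \<in> LC_bdd c" and k: "k > 0" "c = ang_mom x + 2 * k\<^sup>2"
  defines "X \<equiv> 1 / (2 * k)"
  shows "0 < X" "X < 1" "2 * k\<^sup>2 = 1 / (2 * X\<^sup>2)"
    "(cmod (u_plus k x))\<^sup>2 = 2 + 2 * ang_mom x / X" "(cmod (u_minus k x))\<^sup>2 = 2 - 2 * ang_mom x / X"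
    "(cmod (snd x))\<^sup>2 + 4 * k\<^sup>2 * (cmod (fst x))\<^sup>2 = 2"
proof -
  show "0 < X" using k by (simp add: X_def)
  show "2 * k\<^sup>2 = 1 / (2 * X\<^sup>2)" using k by (simp add: X_def power2_eq_square)
  have "(2 * k)\<^sup>2 > 1\<^sup>2" using ang_less_1[OF c x] c k by (simp add: power2_eq_square)
  then have "2 * k > 1" using k by (intro power_less_imp_less_base[of 1 2 "2 * k"]) auto
  then show "X < 1" by (simp add: X_def)
  show n: "(cmod (snd x))\<^sup>2 + 4 * k\<^sup>2 * (cmod (fst x))\<^sup>2 = 2"
    using LC_level_frequency[OF k(2)] x LC_bdd_subset by blast
  show "(cmod (u_plus k x))\<^sup>2 = 2 + 2 * ang_mom x / X" "(cmod (u_minus k x))\<^sup>2 = 2 - 2 * ang_mom x / X"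
    using phase_norms[of k "fst x" "snd x"] n k by (simp_all add: X_def)
qed

text \<open>Kepler's third law in the form \<open>l / k = X\<^sup>3\<close>, the ratio of the period of the motion to that of the frame.\<close>
lemma torus_action:
  fixes X :: real and k l :: nat
  assumes "X > 0" "k \<ge> 1" "l \<ge> 1" "real l = real k * X ^ 3"
  shows "real k powr (2 / 3) * real l powr (1 / 3) = real k * X"
proof -
  have "real l powr (1 / 3) = real k powr (1 / 3) * X"
    using assms by (simp add: powr_mult powr_powr flip: powr_numeral)
  moreover have "real k powr (2 / 3) * real k powr (1 / 3) = real k"
    using assms(2) by (simp flip: powr_add)
  ultimately show ?thesis by (simp flip: mult.assoc)
qed

definition torus_actions :: "real \<Rightarrow> real set" where
  "torus_actions c = {2 * pi * (- real l * c + 3 / 2 * real k powr (2 / 3) * real l powr (1 / 3)) | k l.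
         k \<ge> 1 \<and> l \<ge> 1 \<and> k > l \<and> real l / real k \<in> {(L_R c) ^ 3 <..< - ((L_D c) ^ 3)}}"

lemma L_D_cube: "- ((L_D c) ^ 3) = (- L_D c) ^ 3"
  by (simp add: power3_eq_cube)

text \<open>If one amplitude vanishes, the motion is circular, \<open>X\<close> is \<open>L_R c\<close> or \<open>- L_D c\<close>, and closing up is a
  single condition on the phase. Otherwise the phases of both amplitudes must agree; then the Kepler
  motion makes \<open>K\<close> full revolutions while the frame makes \<open>K - m\<close>, which fixes \<open>X\<close>, the energy and the
  action. The strict inequalities \<open>- X < B < X\<close> become the range of \<open>l / k\<close>.\<close>
lemma closed_orbit_action:
  assumes c: "c > 3 / 2" and x: "x \<in> LC_bdd c" and k: "k > 0" "c = ang_mom x + 2 * k\<^sup>2"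
    and s: "s > 0" and cl: "LC_flow k x s = x \<or> LC_flow k x s = - x"
  shows "(\<exists>n\<ge>1. reeb_time k x s = 2 * pi * L_R c * real n) \<or>
    (\<exists>n\<ge>1. reeb_time k x s = - (2 * pi * L_D c) * real n) \<or> reeb_time k x s \<in> torus_actions c"
proof -
  have k0: "k \<noteq> 0" using k by simp
  define X B where "X = 1 / (2 * k)" and "B = ang_mom x"
  note F = frequency_bounds[OF c x k, folded X_def B_def]
  have kX: "k = 1 / (2 * X)" using k0 by (simp add: X_def)
  have X4: "1 / (4 * k\<^sup>2) = X\<^sup>2" using k0 by (simp add: X_def power2_eq_square)
  have cX: "c = B + 1 / (2 * X\<^sup>2)" using k(2) F(3) by (simp add: B_def)
  have X0: "X \<noteq> 0" using F(1) by simp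
  define \<theta> where "\<theta> = sweep k x s"
  obtain \<epsilon> where \<epsilon>: "\<epsilon> = 1 \<or> \<epsilon> = - 1" and up: "u_plus k x = 0 \<or> cis (k * s - \<theta> / 2) = \<epsilon>"
    and um: "u_minus k x = 0 \<or> cis (- (k * s) - \<theta> / 2) = \<epsilon>"
    using cl unfolding LC_flow_closes_iff[OF k0] \<theta>_def by blast
  have T: "reeb_time k x s = s - B * \<theta>" by (simp add: reeb_time_def \<theta>_def B_def)
  consider (R) "u_plus k x = 0" | (D) "u_plus k x \<noteq> 0" "u_minus k x = 0" | (E) "u_plus k x \<noteq> 0" "u_minus k x \<noteq> 0"
    by blast
  then show ?thesis
  proof cases
    case R
    then have "2 + 2 * B / X = 0" using F(4) by simp
    then have B: "B = - X" using X0 by (simp add: field_simps)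
    then have "(cmod (u_minus k x))\<^sup>2 = 4" using F(5) X0 by simp
    then have "u_minus k x \<noteq> 0" by auto
    then obtain m :: int where m: "- (k * s) - \<theta> / 2 = pi * m" using um \<epsilon> cis_pm_1_iff by metis
    have \<theta>: "\<theta> = X\<^sup>2 * s" unfolding X4[symmetric] using sweep_average[OF k0 F(6), of s] R by (simp add: \<theta>_def)
    have XL: "X = L_R c" using L_R_eq_iff[OF c F(1)] cX B by simp
    have "reeb_time k x s = 2 * X * (k * s + \<theta> / 2)"
      unfolding T B \<theta> using X0 by (simp add: kX field_simps)
    also have "k * s + \<theta> / 2 = pi * real_of_int (- m)" using m by simp
    finally have t: "reeb_time k x s = 2 * pi * X * real_of_int (- m)" by simp
    have "reeb_time k x s > 0" unfolding T B \<theta> using s F(1) by (simp add: add_pos_pos)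
    then have "real_of_int (- m) > 0" unfolding t by (rule zero_less_mult_pos) (use F(1) in simp)
    then have "nat (- m) \<ge> 1" "real (nat (- m)) = real_of_int (- m)" by simp_all
    then show ?thesis using t XL by metis
  next
    case D
    then have "2 - 2 * B / X = 0" using F(5) by simp
    then have B: "B = X" using X0 by (simp add: field_simps)
    obtain m :: int where m: "k * s - \<theta> / 2 = pi * m" using up \<epsilon> D(1) cis_pm_1_iff by metis
    have \<theta>: "\<theta> = X\<^sup>2 * s" unfolding X4[symmetric] using sweep_average[OF k0 F(6), of s] D by (simp add: \<theta>_def)
    have XL: "X = - L_D c" using L_D_eq_iff[OF c F(1,2)] cX B by simp
    have "reeb_time k x s = 2 * X * (k * s - \<theta> / 2)"
      unfolding T B \<theta> using X0 by (simp add: kX field_simps)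
    then have t: "reeb_time k x s = 2 * pi * X * m" unfolding m by simp
    \<comment> \<open>Since \<open>X < 1\<close>, the frame turns more slowly than the motion, so that \<open>m\<close> is positive.\<close>
    have "X ^ 3 < 1" using F(1,2) power_strict_mono[of X 1 3] by simp
    moreover have "reeb_time k x s = s * (1 - X ^ 3)"
      unfolding T B \<theta> by (simp add: power3_eq_cube power2_eq_square algebra_simps)
    ultimately have "reeb_time k x s > 0" using s by simp
    then have "real_of_int m > 0" unfolding t by (rule zero_less_mult_pos) (use F(1) in simp)
    then have "nat m \<ge> 1" "real (nat m) = real_of_int m" by simp_all
    then have "\<exists>n\<ge>1. reeb_time k x s = - (2 * pi * L_D c) * real n"
      using t XL by (intro exI[of _ "nat m"]) simp
    then show ?thesis by blast
  next
    case E
    have "(cmod (u_plus k x))\<^sup>2 > 0" "(cmod (u_minus k x))\<^sup>2 > 0" using E by auto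
    then have "- X < B" "B < X" unfolding F(4,5) using F(1) by (simp_all add: field_simps)
    have e: "cis (k * s - \<theta> / 2) = \<epsilon>" "cis (- (k * s) - \<theta> / 2) = \<epsilon>" using up um E by auto
    \<comment> \<open>The two phases differ by \<open>2 k s\<close>.\<close>
    have "cis (2 * (k * s)) * \<epsilon> = \<epsilon>"
      using e by (metis cis_mult add_diff_eq mult_2 add.commute add_diff_cancel_left' diff_minus_eq_add minus_diff_eq uminus_add_conv_diff diff_add_cancel)
    then have per: "cis (2 * (k * s)) = 1" using \<epsilon> by auto
    then obtain K :: int where "2 * (k * s) = 2 * pi * K" using cis_eq_1_imp by blast
    then have K: "k * s = pi * K" by simp
    have "real_of_int K > 0" using K k(1) s by (metis mult_pos_pos pi_gt_zero zero_less_mult_pos)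
    obtain m :: int where m: "k * s - \<theta> / 2 = pi * m" using e(1) \<epsilon> cis_pm_1_iff by metis
    have \<theta>: "\<theta> = X\<^sup>2 * s" unfolding X4[symmetric] using sweep_average[OF k0 F(6), of s] per by (simp add: \<theta>_def)
    have sK: "s = 2 * pi * K * X" using K X0 by (simp add: kX field_simps)
    have "\<theta> = 2 * pi * real_of_int (K - m)" using m K by (simp add: algebra_simps)
    moreover have "\<theta> = 2 * pi * (K * X ^ 3)" unfolding \<theta> sK by (simp add: power2_eq_square power3_eq_cube)
    ultimately have l: "real_of_int (K - m) = K * X ^ 3" by simp
    then have "real_of_int (K - m) > 0" using \<open>real_of_int K > 0\<close> F(1) by simp
    define k' l' where "k' = nat K" and "l' = nat (K - m)"
    have kl: "real k' = K" "real l' = K - m" "k' \<ge> 1" "l' \<ge> 1"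
      using \<open>real_of_int K > 0\<close> \<open>real_of_int (K - m) > 0\<close> by (simp_all add: k'_def l'_def)
    have lk: "real l' = real k' * X ^ 3" using l kl by simp
    have "X ^ 3 < 1" using F(1,2) power_strict_mono[of X 1 3] by simp
    then have "real k' * X ^ 3 < real k' * 1" using kl(3) by (intro mult_strict_left_mono) auto
    then have "k' > l'" using lk by simp
    have LX: "L_R c < X" using L_R_less_iff[OF c F(1)] cX \<open>- X < B\<close> by simp
    have XL: "X < - L_D c" using L_D_less_iff[OF c F(1,2)] cX \<open>B < X\<close> by simp
    have q: "real l' / real k' = X ^ 3" using lk kl(3) by simp
    have "real l' / real k' \<in> {(L_R c) ^ 3 <..< - ((L_D c) ^ 3)}"
      unfolding L_D_cube q greaterThanLessThan_iff
      using power_strict_mono[OF LX, of 3] power_strict_mono[OF XL, of 3] L_R_pos[OF c] F(1) by (simp del: power_minus_odd)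
    moreover have "reeb_time k x s = 2 * pi * (- real l' * c + 3 / 2 * real k' powr (2 / 3) * real l' powr (1 / 3))"
    proof -
      have "3 / 2 * real k' powr (2 / 3) * real l' powr (1 / 3) = 3 / 2 * (real k' * X)"
        using torus_action[OF F(1) kl(3,4) lk] by simp
      moreover have "reeb_time k x s = 2 * pi * (k' * X) - B * (2 * pi * l')"
        unfolding T using \<open>\<theta> = 2 * pi * real_of_int (K - m)\<close> sK kl by simp
      moreover have "real l' * c = real l' * B + k' * X / 2"
      proof -
        have "l' * (1 / (2 * X\<^sup>2)) = k' * X / 2"
          unfolding lk using X0 by (simp add: power2_eq_square power3_eq_cube)
        then show ?thesis unfolding cX distrib_left by (rule arg_cong)
      qed
      ultimately show ?thesis by (simp add: algebra_simps)
    qed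
    ultimately have "reeb_time k x s \<in> torus_actions c"
      unfolding torus_actions_def using kl(3,4) \<open>k' > l'\<close> by blast
    then show ?thesis by blast
  qed
qed

text \<open>The amplitudes may be prescribed freely. Real nonnegative ones put the starting point at the
  pericentre, where \<open>quart_part < 1\<close> is easiest to verify.\<close>
lemma point_with_phases:
  assumes c: "c > 3 / 2" and X: "0 < X" "X < 1" and B: "- X \<le> B" "B \<le> X" "c = B + 1 / (2 * X\<^sup>2)"
  defines "k \<equiv> 1 / (2 * X)"
  shows "\<exists>x \<in> LC_bdd c. ang_mom x = B \<and> k > 0 \<and> c = ang_mom x + 2 * k\<^sup>2"
proof -
  define u v where "u = sqrt (2 + 2 * B / X)" and "v = sqrt (2 - 2 * B / X)"
  have "- 1 \<le> B / X" "B / X \<le> 1" using X B by (simp_all add: field_simps)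
  then have u: "u\<^sup>2 = 2 + 2 * B / X" "u \<ge> 0" and v: "v\<^sup>2 = 2 - 2 * B / X" "v \<ge> 0"
    by (simp_all add: u_def v_def)
  define y where "y = X * (u - v) / 2"
  define x where "x = (- \<i> * of_real y, of_real ((u + v) / 2) :: complex)"
  have ang_mom: "ang_mom x = B"
  proof -
    have "ang_mom x = X / 4 * (u\<^sup>2 - v\<^sup>2)" by (simp add: ang_mom_def x_def y_def power2_eq_square field_simps)
    also have "\<dots> = B" unfolding u v using X by simp
    finally show ?thesis .
  qed
  have k: "k > 0" "2 * k\<^sup>2 = 1 / (2 * X\<^sup>2)" "k * X = 1 / 2" using X by (simp_all add: k_def power2_eq_square)
  then have ck: "c = ang_mom x + 2 * k\<^sup>2" using B(3) ang_mom by simp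
  have y2: "y\<^sup>2 = X\<^sup>2 * (u - v)\<^sup>2 / 4" by (simp add: y_def power_mult_distrib power_divide)
  have "cmod (snd x) = \<bar>(u + v) / 2\<bar>" "cmod (fst x) = \<bar>y\<bar>"
    unfolding x_def fst_conv snd_conv norm_mult norm_minus_cancel norm_of_real by simp_all
  then have "(cmod (snd x))\<^sup>2 = (u + v)\<^sup>2 / 4" "(cmod (fst x))\<^sup>2 = y\<^sup>2"
    by (simp_all only: power2_abs power_divide) simp
  moreover have "4 * k\<^sup>2 * y\<^sup>2 = (u - v)\<^sup>2 / 4"
  proof -
    have "4 * k\<^sup>2 * y\<^sup>2 = (k * X)\<^sup>2 * (u - v)\<^sup>2" unfolding y2 by (simp add: power_mult_distrib)
    then show ?thesis unfolding k(3) by (simp add: power2_eq_square)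
  qed
  ultimately have "(cmod (snd x))\<^sup>2 + 4 * k\<^sup>2 * (cmod (fst x))\<^sup>2 = (u\<^sup>2 + v\<^sup>2) / 2"
    by (simp add: power2_eq_square algebra_simps add_divide_distrib)
  also have "\<dots> = 2" unfolding u v by simp
  finally have lev: "x \<in> LC_level c" unfolding LC_level_frequency[OF ck] .
  have "quart_part x = (cmod (fst x))\<^sup>2 * ang_mom x" by (simp add: quart_part_def case_prod_beta)
  then have "quart_part x = y\<^sup>2 * B" unfolding ang_mom \<open>(cmod (fst x))\<^sup>2 = y\<^sup>2\<close> .
  also have "\<dots> < 1"
  proof (cases "B \<le> 0")
    case True
    then have "y\<^sup>2 * B \<le> 0" by (simp add: mult_nonneg_nonpos)
    then show ?thesis by simp
  next
    case False
    have "0 \<le> u * v" using u v by simp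
    moreover have "u\<^sup>2 + v\<^sup>2 = 4" unfolding u v by simp
    ultimately have "(u - v)\<^sup>2 \<le> 4" by (simp add: power2_eq_square algebra_simps)
    then have "y\<^sup>2 \<le> X\<^sup>2" unfolding y2 using mult_left_mono[of "(u - v)\<^sup>2" 4 "X\<^sup>2"] by simp
    then have "y\<^sup>2 * B \<le> X\<^sup>2 * X" using B False by (intro mult_mono) auto
    also have "\<dots> = X ^ 3" by (simp add: power2_eq_square power3_eq_cube)
    also have "\<dots> < 1" using X power_strict_mono[of X 1 3] by simp
    finally show ?thesis .
  qed
  finally have "x \<in> LC_bdd c" using lev by (simp add: LC_bdd_def LC_level_def)
  then show ?thesis using ang_mom k(1) ck by blast
qed

text \<open>The converse construction for the three families at once; the two phase conditions are stated only
  for the amplitudes that do not vanish.\<close>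
lemma closed_flow_in_spectrum:
  assumes c: "c > 3 / 2" and X: "0 < X" "X < 1" and B: "- X \<le> B" "B \<le> X" "c = B + 1 / (2 * X\<^sup>2)"
    and s: "s > 0" and \<epsilon>: "\<epsilon> = 1 \<or> \<epsilon> = - 1"
    and p: "B = - X \<or> cis (s / (2 * X) - X\<^sup>2 * s / 2) = \<epsilon>" and m: "B = X \<or> cis (- (s / (2 * X)) - X\<^sup>2 * s / 2) = \<epsilon>"
  shows "s - B * (X\<^sup>2 * s) \<in> action_spectrum (Sigma_R c) lambda_can"
proof -
  define k where "k = 1 / (2 * X)"
  obtain x where x: "x \<in> LC_bdd c" "ang_mom x = B" and k: "k > 0" "c = ang_mom x + 2 * k\<^sup>2"
    using point_with_phases[OF c X B] unfolding k_def by blast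
  have k0: "k \<noteq> 0" using k by simp
  have kX: "X = 1 / (2 * k)" by (simp add: k_def)
  note F = frequency_bounds[OF c x(1) k, folded kX]
  have u: "u_plus k x = 0 \<longleftrightarrow> B = - X" "u_minus k x = 0 \<longleftrightarrow> B = X"
  proof -
    have "2 + 2 * B / X = 0 \<longleftrightarrow> B = - X" "2 - 2 * B / X = 0 \<longleftrightarrow> B = X" using X by (auto simp: field_simps)
    moreover have "y = 0 \<longleftrightarrow> (cmod y)\<^sup>2 = 0" for y by simp
    ultimately show "u_plus k x = 0 \<longleftrightarrow> B = - X" "u_minus k x = 0 \<longleftrightarrow> B = X"
      using F(4,5) unfolding x(2) by presburger+
  qed
  have ks: "k * s = s / (2 * X)" by (simp add: k_def)
  have "cis (2 * (k * s)) = 1" if "B \<noteq> - X" "B \<noteq> X"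
  proof -
    have "cis (2 * (k * s)) * cis (- (k * s) - X\<^sup>2 * s / 2) = cis (k * s - X\<^sup>2 * s / 2)"
      unfolding cis_mult by (simp add: algebra_simps)
    then show ?thesis using p m \<epsilon> that unfolding ks by auto
  qed
  then have \<theta>: "sweep k x s = X\<^sup>2 * s"
    using sweep_average[OF k0 F(6), of s] u X by (auto simp: k_def power2_eq_square)
  have "LC_flow k x s = x \<or> LC_flow k x s = - x"
    unfolding LC_flow_closes_iff[OF k0] \<theta> ks u using p m \<epsilon> by blast
  moreover have "reeb_time k x s = s - B * (X\<^sup>2 * s)" by (simp add: reeb_time_def \<theta> x(2))
  ultimately show ?thesis unfolding action_spectrum_iff[OF c] using x(1) k s by metis
qed

lemma action_retrograde_in_spectrum:
  assumes c: "c > 3 / 2" and n: "n \<ge> 1"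
  shows "2 * pi * L_R c * real n \<in> action_spectrum (Sigma_R c) lambda_can"
proof -
  define X s where "X = L_R c" and "s = 2 * pi * real n * X / (1 + X ^ 3)"
  have X: "0 < X" using L_R_pos[OF c] by (simp add: X_def)
  have cX: "c = - X + 1 / (2 * X\<^sup>2)" using L_R_eq_iff[OF c X] by (simp add: X_def)
  have "X < 1"
  proof (rule ccontr)
    assume "\<not> X < 1"
    then have "1 \<le> X\<^sup>2" by (simp add: one_le_power)
    then have "1 / (2 * X\<^sup>2) \<le> 1 / 2" by (simp add: divide_le_eq)
    then show False using cX c X by linarith
  qed
  have "1 + X ^ 3 > 0" using X by (simp add: add_pos_pos)
  then have s: "s > 0" "s * (1 + X ^ 3) = 2 * pi * real n * X" using X n by (simp_all add: s_def)
  have "- (s / (2 * X)) - X\<^sup>2 * s / 2 = - (s * (1 + X ^ 3) / (2 * X))"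
    using X by (simp add: field_simps power2_eq_square power3_eq_cube)
  also have "\<dots> = pi * real_of_int (- int n)" unfolding s(2) using X by simp
  finally have pm: "cis (- (s / (2 * X)) - X\<^sup>2 * s / 2) = 1 \<or> cis (- (s / (2 * X)) - X\<^sup>2 * s / 2) = - 1"
    using cis_pm_1_iff by blast
  have "s - - X * (X\<^sup>2 * s) \<in> action_spectrum (Sigma_R c) lambda_can"
    by (rule closed_flow_in_spectrum[OF c X \<open>X < 1\<close> _ _ cX s(1) pm]) (use X in simp_all)
  then show ?thesis using s(2) by (simp add: X_def power2_eq_square power3_eq_cube algebra_simps)
qed

lemma action_direct_in_spectrum:
  assumes c: "c > 3 / 2" and n: "n \<ge> 1"
  shows "- (2 * pi * L_D c) * real n \<in> action_spectrum (Sigma_R c) lambda_can"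
proof -
  define X s where "X = - L_D c" and "s = 2 * pi * real n * X / (1 - X ^ 3)"
  have X: "0 < X" "X < 1" using L_D_neg[OF c] L_D_gt[OF c] by (simp_all add: X_def)
  have cX: "c = X + 1 / (2 * X\<^sup>2)" using L_D_eq_iff[OF c X] by (simp add: X_def)
  have "X ^ 3 < 1" using X power_strict_mono[of X 1 3] by simp
  then have s: "s > 0" "s * (1 - X ^ 3) = 2 * pi * real n * X" using X n by (simp_all add: s_def)
  have "s / (2 * X) - X\<^sup>2 * s / 2 = s * (1 - X ^ 3) / (2 * X)"
    using X by (simp add: field_simps power2_eq_square power3_eq_cube)
  also have "\<dots> = pi * real_of_int (int n)" unfolding s(2) using X by simp
  finally have pm: "cis (s / (2 * X) - X\<^sup>2 * s / 2) = 1 \<or> cis (s / (2 * X) - X\<^sup>2 * s / 2) = - 1"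
    using cis_pm_1_iff by blast
  have "s - X * (X\<^sup>2 * s) \<in> action_spectrum (Sigma_R c) lambda_can"
    by (rule closed_flow_in_spectrum[OF c X _ _ cX s(1) pm]) (use X in simp_all)
  then show ?thesis using s(2) by (simp add: X_def power2_eq_square power3_eq_cube algebra_simps)
qed

lemma torus_actions_in_spectrum:
  assumes c: "c > 3 / 2" and T: "T \<in> torus_actions c"
  shows "T \<in> action_spectrum (Sigma_R c) lambda_can"
proof -
  obtain k l :: nat where T: "T = 2 * pi * (- real l * c + 3 / 2 * real k powr (2 / 3) * real l powr (1 / 3))"
    and kl: "k \<ge> 1" "l \<ge> 1" "k > l" "(L_R c) ^ 3 < real l / real k" "real l / real k < (- L_D c) ^ 3"
    using T unfolding torus_actions_def L_D_cube by auto
  define X where "X = root 3 (real l / real k)"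
  have X3: "X ^ 3 = real l / real k" by (simp add: X_def odd_real_root_pow)
  have X: "X > 0" using kl by (simp add: X_def)
  have "X ^ 3 < 1 ^ 3" unfolding X3 using kl by simp
  then have X1: "X < 1" by (rule power_less_imp_less_base) simp
  have "L_R c < X" using kl(4) X unfolding X3[symmetric] by (auto intro: power_less_imp_less_base)
  have "X < - L_D c"
    by (rule power_less_imp_less_base[OF kl(5)[folded X3]]) (use L_D_neg[OF c] in simp)
  define B where "B = c - 1 / (2 * X\<^sup>2)"
  have B: "- X \<le> B" "B \<le> X" and cX: "c = B + 1 / (2 * X\<^sup>2)"
    using L_R_less_iff[OF c X] \<open>L_R c < X\<close> L_D_less_iff[OF c X X1] \<open>X < - L_D c\<close> by (simp_all add: B_def)
  define s where "s = 2 * pi * real k * X"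
  have s: "s > 0" using X kl by (simp add: s_def)
  have lk: "real l = real k * X ^ 3" unfolding X3 using kl by simp
  have \<theta>: "X\<^sup>2 * s = 2 * pi * real l" unfolding lk s_def by (simp add: power2_eq_square power3_eq_cube)
  have ks: "s / (2 * X) = pi * real k" using X by (simp add: s_def)
  have a: "s / (2 * X) - X\<^sup>2 * s / 2 = pi * real_of_int (int k - int l)"
    unfolding ks \<theta> by (simp add: algebra_simps)
  have "cis (s / (2 * X) - X\<^sup>2 * s / 2) = cis (2 * pi * real k) * cis (- (s / (2 * X)) - X\<^sup>2 * s / 2)"
    unfolding cis_mult ks by (simp add: algebra_simps)
  moreover have "cis (2 * pi * real k) = 1" using cis_multiple_2pi[of "real k"] by simp
  ultimately have e: "cis (s / (2 * X) - X\<^sup>2 * s / 2) = cis (- (s / (2 * X)) - X\<^sup>2 * s / 2)" by simp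
  have pm: "cis (s / (2 * X) - X\<^sup>2 * s / 2) = 1 \<or> cis (s / (2 * X) - X\<^sup>2 * s / 2) = - 1"
    using cis_pm_1_iff a by blast
  have "s - B * (X\<^sup>2 * s) \<in> action_spectrum (Sigma_R c) lambda_can"
    by (rule closed_flow_in_spectrum[OF c X X1 B cX s pm]) (simp_all add: e)
  moreover have "s - B * (X\<^sup>2 * s) = T"
  proof -
    have "3 / 2 * real k powr (2 / 3) * real l powr (1 / 3) = 3 / 2 * (real k * X)"
      using torus_action[OF X kl(1,2) lk] by simp
    moreover have "s - B * (X\<^sup>2 * s) = 2 * pi * (k * X) - B * (2 * pi * l)"
      unfolding \<theta> by (simp add: s_def)
    moreover have "real l * c = real l * B + k * X / 2"
    proof -
      have "l * (1 / (2 * X\<^sup>2)) = k * X / 2"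
        unfolding lk using X by (simp add: power2_eq_square power3_eq_cube)
      then show ?thesis unfolding cX distrib_left by (rule arg_cong)
    qed
    ultimately show ?thesis unfolding T by (simp add: algebra_simps)
  qed
  ultimately show ?thesis by simp
qed

lemma action_spectrum_Sigma_R:
  assumes c: "c > 3 / 2"
  shows "action_spectrum (Sigma_R c) lambda_can =
      {2 * pi * L_R c * real n | n. n \<ge> 1} \<union> {- (2 * pi * L_D c) * real n | n. n \<ge> 1} \<union> torus_actions c"
proof (intro equalityI subsetI)
  fix T assume "T \<in> action_spectrum (Sigma_R c) lambda_can"
  then obtain x k s where "x \<in> LC_bdd c" "k > 0" "c = ang_mom x + 2 * k\<^sup>2" "s > 0" "T = reeb_time k x s"
      "LC_flow k x s = x \<or> LC_flow k x s = - x" unfolding action_spectrum_iff[OF c] by blast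
  then show "T \<in> {2 * pi * L_R c * real n | n. n \<ge> 1} \<union> {- (2 * pi * L_D c) * real n | n. n \<ge> 1} \<union> torus_actions c"
    using closed_orbit_action[OF c, of x k s] by blast
next
  fix T assume "T \<in> {2 * pi * L_R c * real n | n. n \<ge> 1} \<union> {- (2 * pi * L_D c) * real n | n. n \<ge> 1} \<union> torus_actions c"
  then show "T \<in> action_spectrum (Sigma_R c) lambda_can"
    using action_retrograde_in_spectrum[OF c] action_direct_in_spectrum[OF c] torus_actions_in_spectrum[OF c] by blast
qed

theorem proposition3p5:
  fixes c :: real
  assumes "c > 3 / 2"
  shows "(\<exists>!x. x > 0 \<and> c = 1 / (2 * x\<^sup>2) - x) \<and>
    (\<exists>!x. - 1 < x \<and> x < 0 \<and> c = 1 / (2 * x\<^sup>2) - x) \<and>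
    action_spectrum (Sigma_R c) lambda_can =
      {2 * pi * L_R c * real n | n. n \<ge> 1} \<union>
      {- (2 * pi * L_D c) * real n | n. n \<ge> 1} \<union>
      {2 * pi * (- real l * c + 3 / 2 * real k powr (2 / 3) * real l powr (1 / 3)) | k l.
         k \<ge> 1 \<and> l \<ge> 1 \<and> k > l \<and> real l / real k \<in> {(L_R c) ^ 3 <..< - ((L_D c) ^ 3)}} \<and>
    (\<exists>\<gamma> T. retrograde_orbit c \<gamma> T) \<and>
    (\<forall>\<gamma> T. retrograde_orbit c \<gamma> T \<longrightarrow> action lambda_can (Phi \<circ> Psi \<circ> \<gamma>) T = 2 * pi * L_R c) \<and>
    (\<exists>\<gamma> T. direct_orbit c \<gamma> T) \<and>
    (\<forall>\<gamma> T. direct_orbit c \<gamma> T \<longrightarrow> action lambda_can (Phi \<circ> Psi \<circ> \<gamma>) T = - (2 * pi * L_D c))"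
proof (intro conjI allI impI)
  show "\<exists>!x. x > 0 \<and> c = 1 / (2 * x\<^sup>2) - x" using retrograde_momentum_exists assms by simp
  show "\<exists>!x. - 1 < x \<and> x < 0 \<and> c = 1 / (2 * x\<^sup>2) - x" using direct_momentum_exists[OF assms] .
  show "action_spectrum (Sigma_R c) lambda_can =
      {2 * pi * L_R c * real n | n. n \<ge> 1} \<union>
      {- (2 * pi * L_D c) * real n | n. n \<ge> 1} \<union>
      {2 * pi * (- real l * c + 3 / 2 * real k powr (2 / 3) * real l powr (1 / 3)) | k l.
         k \<ge> 1 \<and> l \<ge> 1 \<and> k > l \<and> real l / real k \<in> {(L_R c) ^ 3 <..< - ((L_D c) ^ 3)}}"
    using action_spectrum_Sigma_R[OF assms] unfolding torus_actions_def .
qed (use retrograde_orbits[OF assms] direct_orbits[OF assms] in auto)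

end
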